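(* Let $g$ be a positive integer. Then $\alpha_g(n)=(1+o_g(1))\sqrt{gn}$, i.e. $\lim_{n\to\infty}\frac{\alpha_g(n)}{\sqrt{gn}}=1$.
   Context: For a positive integer $n$ write $[n]=\{1,\dots,n\}$. For a set $A$ of integers and an integer $d$, let $r_{A-A}(d)=|\{(a,a')\in A\times A: d=a-a'\}|$. Define $\alpha_g(n)$ to be the largest cardinality of a set $A\subseteq[n]$ such that $r_{A-A}(x)\le g$ for every nonzero integer $x$. The notation $o_g(1)$ denotes a quantity tending to $0$ as $n\to\infty$, with rate possibly depending on $g$. *)

theory Defs
  imports Complex_Main
begin

(* Only meaningful for finite A, since card of an infinite set is 0; it is only
   applied below to subsets of {1..n}. *)
definition diff_rep :: "int set \<Rightarrow> int \<Rightarrow> nat" where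
  "diff_rep A d = card {(a, a'). a \<in> A \<and> a' \<in> A \<and> d = a - a'}"

definition alpha :: "nat \<Rightarrow> nat \<Rightarrow> nat" where
  "alpha g n = Max (card ` {A. A \<subseteq> {1..int n} \<and> (\<forall>x. x \<noteq> 0 \<longrightarrow> diff_rep A x \<le> g)})"

end

theory Submission
  imports Defs "HOL-Complex_Analysis.Complex_Analysis" "HOL-Real_Asymp.Real_Asymp"
    "HOL-Number_Theory.Number_Theory"
begin

text \<open>
  Upper bound (Erdos--Turan): counting solutions of \<open>a + s = a' + s'\<close> with \<open>a, a' \<in> A\<close> and \<open>s, s'\<close> in an
  interval of length \<open>u\<close>, Cauchy--Schwarz gives \<open>(|A| u)\<^sup>2 \<le> (n + u) (u |A| + g u\<^sup>2)\<close>; take \<open>u = n\<^sup>3\<^sup>/\<^sup>4\<close>.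

  Lower bound: for a prime \<open>p \<equiv> 1 (mod g)\<close> with primitive root \<open>\<theta>\<close>, the residues \<open>x\<close> modulo \<open>p (p - 1) / g\<close>
  with \<open>x \<equiv> \<theta>\<^sup>i (mod p)\<close> and \<open>x \<equiv> i (mod (p - 1) / g)\<close>, for \<open>0 \<le> i < p - 1\<close>, represent every nonzero difference
  at most \<open>g\<close> times. This is sharp along such primes, and it suffices for all \<open>n\<close> because consecutive primes in
  the class of \<open>1\<close> modulo \<open>g\<close> have ratio tending to \<open>1\<close>. The latter follows from the prime number theorem for
  that class, proved by Newman's contour method from the nonvanishing of all Dirichlet \<open>L\<close>-functions
  modulo \<open>g\<close> on the line \<open>Re s = 1\<close>: at \<open>s \<noteq> 1\<close> by the inequality \<open>3 + 4 cos x + cos 2x \<ge> 0\<close>, and at \<open>s = 1\<close>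
  because at most one character could vanish there, which is then real and is excluded by Monsky's argument.
\<close>

section \<open>The upper bound\<close>

text \<open>The class of 1 modulo \<open>g\<close> enters because the construction needs
  \<open>g\<close> to divide \<open>p - 1\<close>. Restricting to this class lets one series,
  \<open>Fone\<close>, carry the whole analytic part: by orthogonality it is the average of
  \<open>- L'/L\<close> over all characters, and its coefficients are nonnegative. The trigonometric
  inequality is therefore applied to \<open>Fone\<close> once and bounds the zeros of all characters
  together, counted with multiplicity. This is also how at most one character can vanish at 1; it
  must be real because a nonreal one would vanish together with its conjugate.

  Newman's theorem requires bounded coefficients, and the von Mangoldt function is unbounded. The
  theorem is therefore applied to \<open>psi1 g n / n\<close> minus its expected mean, which is
  bounded by Chebyshev's estimate; the convergence of the resulting harmonic sum is turned into a
  limit through the monotonicity of \<open>psi1\<close>. All continuations come from summation by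
  parts and reach \<open>Re s > 0\<close>, which contains a neighbourhood of the closed half-plane
  \<open>Re s \<ge> 1\<close>.\<close>

definition admissible :: "nat \<Rightarrow> nat \<Rightarrow> int set \<Rightarrow> bool" where
  "admissible g n A \<longleftrightarrow> A \<subseteq> {1..int n} \<and> (\<forall>x. x \<noteq> 0 \<longrightarrow> diff_rep A x \<le> g)"

lemma finite_admissible: "finite {A. admissible g n A}"
  by (rule finite_subset[of _ "Pow {1..int n}"]) (auto simp: admissible_def)

lemma alpha_eq: "alpha g n = Max (card ` {A. admissible g n A})"
  by (simp add: alpha_def admissible_def)

lemma admissible_empty: "admissible g n {}"
  by (simp add: admissible_def diff_rep_def)

lemma card_le_alpha: "admissible g n A \<Longrightarrow> card A \<le> alpha g n"
  unfolding alpha_eq using finite_admissible by (intro Max_ge) auto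

lemma alpha_attained: "\<exists>A. admissible g n A \<and> card A = alpha g n"
proof -
  have "alpha g n \<in> card ` {A. admissible g n A}"
    unfolding alpha_eq by (intro Max_in finite_imageI finite_admissible) (use admissible_empty in blast)
  then show ?thesis by auto
qed

lemma diff_rep_0: "finite A \<Longrightarrow> diff_rep A 0 = card A"
proof -
  have "{(a, a'). a \<in> A \<and> a' \<in> A \<and> 0 = a - a'} = (\<lambda>a. (a, a)) ` A" by auto
  then show ?thesis by (simp add: diff_rep_def card_image inj_on_def)
qed

text \<open>Second moment of the number of \<open>s\<close> in \<open>U\<close> with
  \<open>t - s\<close> in \<open>A\<close>, where \<open>t\<close> runs through a window of length
  \<open>n + u\<close> that contains every \<open>a + s\<close>. The diagonal \<open>s = s'\<close>
  contributes \<open>u |A|\<close>, every other pair at most \<open>g\<close>.\<close>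

lemma admissible_card_bound:
  assumes A: "admissible g n A"
  shows "(real (card A) * real u)^2 \<le> real (n + u) * (real u * real (card A) + real g * real u^2)"
proof -
  define U where "U = {0..<int u}"
  define T where "T = {1..int (n + u)}"
  have fin: "finite A" "finite U" "finite T" using A finite_subset by (auto simp: admissible_def U_def T_def)
  have As: "A \<subseteq> {1..int n}" using A by (simp add: admissible_def)
  define i where "i t s = (if t - s \<in> A then 1 else 0 :: real)" for t s
  have row: "(\<Sum>t\<in>T. i t s) = real (card A)" if "s \<in> U" for s
  proof -
    have "(\<Sum>t\<in>T. i t s) = real (card {t\<in>T. t - s \<in> A})" unfolding i_def using fin by (simp add: sum.If_cases Int_def)
    also have "{t\<in>T. t - s \<in> A} = (\<lambda>a. a + s) ` A"
    proof (intro equalityI subsetI)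
      fix t assume "t \<in> {t\<in>T. t - s \<in> A}"
      then show "t \<in> (\<lambda>a. a + s) ` A" by (intro image_eqI[of _ _ "t - s"]) auto
    next
      fix t assume "t \<in> (\<lambda>a. a + s) ` A"
      then show "t \<in> {t\<in>T. t - s \<in> A}" using As that by (force simp: T_def U_def)
    qed
    also have "card \<dots> = card A" by (intro card_image) (auto simp: inj_on_def)
    finally show ?thesis .
  qed
  have pair: "(\<Sum>t\<in>T. i t s * i t s') \<le> real (diff_rep A (s' - s))" for s s'
  proof -
    have "(\<Sum>t\<in>T. i t s * i t s') = (\<Sum>t\<in>T. if t - s \<in> A \<and> t - s' \<in> A then 1 else 0)"
      by (intro sum.cong) (auto simp: i_def)
    also have "\<dots> = real (card {t\<in>T. t - s \<in> A \<and> t - s' \<in> A})" using fin by (simp add: sum.If_cases Int_def)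
    also have "card {t\<in>T. t - s \<in> A \<and> t - s' \<in> A} \<le> diff_rep A (s' - s)"
      unfolding diff_rep_def
    proof (rule card_inj_on_le[of "\<lambda>t. (t - s, t - s')"])
      show "finite {(a, a'). a \<in> A \<and> a' \<in> A \<and> s' - s = a - a'}"
        by (rule finite_subset[of _ "A \<times> A"]) (use fin in auto)
    qed (auto simp: inj_on_def)
    finally show ?thesis by simp
  qed
  have "(\<Sum>t\<in>T. \<Sum>s\<in>U. i t s) = (\<Sum>s\<in>U. \<Sum>t\<in>T. i t s)" by (rule sum.swap)
  also have "\<dots> = real u * real (card A)" using row by (simp add: U_def)
  finally have tot: "(\<Sum>t\<in>T. \<Sum>s\<in>U. i t s) = real u * real (card A)" .
  have "(\<Sum>t\<in>T. (\<Sum>s\<in>U. i t s)^2) = (\<Sum>t\<in>T. \<Sum>s\<in>U. \<Sum>s'\<in>U. i t s * i t s')"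
    by (simp add: power2_eq_square sum_product)
  also have "\<dots> = (\<Sum>s\<in>U. \<Sum>t\<in>T. \<Sum>s'\<in>U. i t s * i t s')" by (rule sum.swap)
  also have "\<dots> = (\<Sum>s\<in>U. \<Sum>s'\<in>U. \<Sum>t\<in>T. i t s * i t s')" by (intro sum.cong refl sum.swap)
  also have "\<dots> \<le> (\<Sum>s\<in>U. \<Sum>s'\<in>U. (if s' = s then real (card A) else 0) + real g)"
  proof (intro sum_mono)
    fix s s'
    have "diff_rep A (s' - s) \<le> (if s' = s then card A else 0) + g"
      using A diff_rep_0[OF fin(1)] by (auto simp: admissible_def)
    then have "real (diff_rep A (s' - s)) \<le> real ((if s' = s then card A else 0) + g)" by (simp only: of_nat_le_iff)
    also have "\<dots> = (if s' = s then real (card A) else 0) + real g" by simp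
    finally show "(\<Sum>t\<in>T. i t s * i t s') \<le> (if s' = s then real (card A) else 0) + real g" using pair[of s s'] by linarith
  qed
  also have "\<dots> = real u * real (card A) + real g * real u^2"
    using fin(2) by (simp add: sum.distrib U_def power2_eq_square algebra_simps)
  finally have sq: "(\<Sum>t\<in>T. (\<Sum>s\<in>U. i t s)^2) \<le> real u * real (card A) + real g * real u^2" .
  have "(\<Sum>t\<in>T. 1 * (\<Sum>s\<in>U. i t s))^2 \<le> (\<Sum>t\<in>T. 1^2) * (\<Sum>t\<in>T. (\<Sum>s\<in>U. i t s)^2)"
    by (rule Cauchy_Schwarz_ineq_sum)
  also have "(\<Sum>t\<in>T. 1^2 :: real) = real (n + u)" by (simp add: T_def)
  also have "real (n + u) * (\<Sum>t\<in>T. (\<Sum>s\<in>U. i t s)^2) \<le> real (n + u) * (real u * real (card A) + real g * real u^2)"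
    using sq by (intro mult_left_mono) auto
  finally show ?thesis using tot by (simp add: mult.commute)
qed

text \<open>The choice \<open>u = n\<close> gives a quadratic inequality for
  \<open>alpha g n\<close>. It yields only the order of magnitude \<open>sqrt n\<close>, which is
  what controls the diagonal term in the sharp estimate.\<close>

lemma alpha_crude_bound:
  assumes "n > 0"
  shows "real (alpha g n) \<le> 1 + sqrt (2 * real g * real n + 1)"
proof -
  obtain A where A: "admissible g n A" "card A = alpha g n" using alpha_attained by blast
  have "(real (alpha g n) * real n)^2 \<le> real (n + n) * (real n * real (alpha g n) + real g * real n^2)"
    using admissible_card_bound[OF A(1), of n] A(2) by simp
  then have "real n^2 * real (alpha g n)^2 \<le> real n^2 * (2 * real (alpha g n) + 2 * real g * real n)"
    by (simp add: power2_eq_square algebra_simps)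
  then have "real (alpha g n)^2 \<le> 2 * real (alpha g n) + 2 * real g * real n"
    using assms by (simp add: mult_le_cancel_left)
  then have "(real (alpha g n) - 1)^2 \<le> 2 * real g * real n + 1"
    by (simp add: power2_eq_square algebra_simps)
  then have "real (alpha g n) - 1 \<le> sqrt (2 * real g * real n + 1)" by (rule real_le_rsqrt)
  then show ?thesis by simp
qed

lemma alpha_upper:
  assumes "n > 0" "u > 0"
  shows "real (alpha g n)^2 \<le> real (n + u) * (real g + (1 + sqrt (2 * real g * real n + 1)) / real u)"
proof -
  obtain A where A: "admissible g n A" "card A = alpha g n" using alpha_attained by blast
  have "real (alpha g n)^2 * real u^2 \<le> (real (n + u) * (real g + real (alpha g n) / real u)) * real u^2"
  proof -
    have "(real (n + u) * (real g + real (alpha g n) / real u)) * real u^2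
        = real (n + u) * (real u * real (alpha g n) + real g * real u^2)"
      using assms by (simp add: power2_eq_square field_simps)
    then show ?thesis using admissible_card_bound[OF A(1), of u] A(2) by (simp only: power_mult_distrib)
  qed
  then have "real (alpha g n)^2 \<le> real (n + u) * (real g + real (alpha g n) / real u)"
    using assms by (simp add: mult_le_cancel_right)
  also have "\<dots> \<le> real (n + u) * (real g + (1 + sqrt (2 * real g * real n + 1)) / real u)"
    using alpha_crude_bound[OF assms(1), of g] by (intro mult_left_mono add_left_mono divide_right_mono) auto
  finally show ?thesis .
qed

lemma alpha_upper_ratio:
  assumes g: "g > 0"
  shows "\<exists>R. R \<longlonglongrightarrow> 1 \<and> (\<forall>\<^sub>F n in sequentially. real (alpha g n) / sqrt (real g * real n) \<le> R n)"
proof -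
  \<comment> \<open>Any exponent strictly between 1/2 and 1 works: \<open>u = o(n)\<close> keeps the
    window length at \<open>n (1 + o(1))\<close>, and \<open>sqrt n = o(u)\<close> makes the
    diagonal term negligible.\<close>
  define u where "u n = nat \<lceil>real n powr (3/4)\<rceil>" for n
  define R where "R n = sqrt (real (n + u n) * (real g + (1 + sqrt (2 * real g * real n + 1)) / real (u n)) / (real g * real n))" for n
  have "(\<lambda>n. real (n + u n) * (real g + (1 + sqrt (2 * real g * real n + 1)) / real (u n)) / (real g * real n)) \<longlonglongrightarrow> 1"
    unfolding u_def using g by real_asymp
  then have "R \<longlonglongrightarrow> sqrt 1" unfolding R_def by (rule tendsto_real_sqrt)
  moreover have "\<forall>\<^sub>F n in sequentially. real (alpha g n) / sqrt (real g * real n) \<le> R n"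
    using eventually_gt_at_top[of 0]
  proof eventually_elim
    case (elim n)
    have "u n > 0" using elim by (simp add: u_def)
    have "sqrt (real (alpha g n)^2 / (real g * real n)) \<le> R n"
      unfolding R_def using alpha_upper[OF elim \<open>u n > 0\<close>, of g] by (intro real_sqrt_le_mono divide_right_mono) auto
    then show ?case by (simp add: real_sqrt_divide)
  qed
  ultimately show ?thesis by auto
qed

section \<open>Ruzsa sets\<close>

text \<open>Ruzsa's Sidon set modulo \<open>p (p - 1)\<close>, reduced modulo \<open>p q\<close> with \<open>p - 1 = g q\<close>: the reduction merges
  \<open>g\<close> residues, so each nonzero difference is hit at most \<open>g\<close> times.\<close>

lemma ruzsa_diff_count:
  fixes x :: "nat \<Rightarrow> int"
  assumes p: "prime p" and q: "p - 1 = g * q" "q > 0"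
    and \<theta>: "coprime p \<theta>" "ord p \<theta> = p - 1"
    and x1: "\<And>i. [x i = int \<theta> ^ i] (mod int p)" and x2: "\<And>i. [x i = int i] (mod int q)"
    and d: "d \<noteq> 0"
  shows "card {(i, j). i < p - 1 \<and> j < p - 1 \<and> d = x i - x j} \<le> g"
proof -
  let ?Q = "{(i, j). i < p - 1 \<and> j < p - 1 \<and> d = x i - x j}"
  \<comment> \<open>The residue of \<open>i - j\<close> modulo \<open>p - 1\<close>; adding
    \<open>p - 1\<close> first keeps the natural subtraction exact, since
    \<open>j < p - 1\<close>.\<close>
  define r where "r = (\<lambda>(i, j). (i + (p - 1) - j) mod (p - 1))"
  have p1: "p - 1 > 0" using prime_gt_1_nat[OF p] by simp
  have ex: "[\<theta> ^ a = \<theta> ^ b] (mod p) \<longleftrightarrow> [a = b] (mod (p - 1))" for a b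
    using order_divides_expdiff[OF \<theta>(1), of a b] \<theta>(2) by simp
  have rc: "[r (i, j) + j = i] (mod (p - 1))" if "j < p - 1" for i j
  proof -
    have "[r (i, j) + j = (i + (p - 1) - j) + j] (mod (p - 1))"
      unfolding r_def by (intro cong_add) (auto simp: cong_def)
    also have "(i + (p - 1) - j) + j = i + (p - 1)" using that by simp
    also have "[i + (p - 1) = i] (mod (p - 1))" by (simp only: cong_def mod_add_self2)
    finally show ?thesis .
  qed
  have modq: "int (r (i, j)) mod int q = d mod int q" if "(i, j) \<in> ?Q" for i j
  proof -
    have "q dvd p - 1" using q by simp
    then have "[r (i, j) + j = i] (mod q)" using rc[of j i] that cong_dvd_modulus_nat by blast
    then have "[int (r (i, j)) + int j = int i] (mod int q)" by (metis cong_int_iff of_nat_add)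
    then have "[int (r (i, j)) + int j - int j = int i - int j] (mod int q)" by (intro cong_diff) auto
    then have 1: "[int (r (i, j)) = int i - int j] (mod int q)" by simp
    have "[x i - x j = int i - int j] (mod int q)" by (intro cong_diff x2)
    from cong_trans[OF 1 cong_sym[OF this]] have "[int (r (i, j)) = d] (mod int q)" using that by simp
    then show ?thesis by (simp add: cong_def)
  qed
  have modp: "[int \<theta> ^ j * (int \<theta> ^ r (i, j) - 1) = d] (mod int p)" if "(i, j) \<in> ?Q" for i j
  proof -
    have "[\<theta> ^ (r (i, j) + j) = \<theta> ^ i] (mod p)" using ex rc that by auto
    then have "[int \<theta> ^ (r (i, j) + j) = int \<theta> ^ i] (mod int p)" by (metis cong_int_iff of_nat_power)
    then have "[int \<theta> ^ (r (i, j) + j) - int \<theta> ^ j = int \<theta> ^ i - int \<theta> ^ j] (mod int p)" by (intro cong_diff) auto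
    from cong_trans[OF this cong_sym[OF cong_diff[OF x1 x1]]]
    have "[int \<theta> ^ (r (i, j) + j) - int \<theta> ^ j = x i - x j] (mod int p)" .
    moreover have "x i - x j = d" using that by simp
    moreover have "int \<theta> ^ (r (i, j) + j) - int \<theta> ^ j = int \<theta> ^ j * (int \<theta> ^ r (i, j) - 1)"
      by (simp add: power_add algebra_simps)
    ultimately show ?thesis by (simp only:)
  qed
  \<comment> \<open>Modulo \<open>q\<close> the value of \<open>r\<close> is that of
    \<open>d\<close>, so \<open>r div q\<close> determines \<open>r\<close>. Then
    \<open>\<theta> ^ j * (\<theta> ^ r - 1) = d\<close> modulo \<open>p\<close> determines
    \<open>j\<close>, and hence \<open>i\<close>. As \<open>r < g * q\<close>, only \<open>g\<close>
    quotients occur.\<close>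
  have "inj_on (\<lambda>ij. r ij div q) ?Q"
  proof (rule inj_onI)
    fix u v assume uv: "u \<in> ?Q" "v \<in> ?Q" "r u div q = r v div q"
    obtain i j i' j' where ij: "u = (i, j)" "v = (i', j')" by fastforce
    have b: "i < p - 1" "j < p - 1" "i' < p - 1" "j' < p - 1" "d = x i - x j" using uv ij by auto
    have "int (r u) mod int q = int (r v) mod int q" using modq uv ij by simp
    then have "r u mod q = r v mod q" by (metis of_nat_mod of_nat_eq_iff)
    then have ruv: "r u = r v" using uv(3) by (metis div_mult_mod_eq)
    \<comment> \<open>The case \<open>r u = 0\<close> would mean \<open>i = j\<close> and
      \<open>d = 0\<close>; excluding it makes \<open>\<theta> ^ r u - 1\<close> invertible modulo
      \<open>p\<close>.\<close>
    have rnz: "\<not> [\<theta> ^ r u = 1] (mod p)"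
    proof
      assume "[\<theta> ^ r u = 1] (mod p)"
      then have "[r u = 0] (mod (p - 1))" using ex[of "r u" 0] by simp
      then have "[r u + j = 0 + j] (mod (p - 1))" by (intro cong_add) auto
      from cong_trans[OF cong_sym[OF this]] have "[j = i] (mod (p - 1))" using rc[OF b(2), of i] ij by simp
      then have "j = i" using b by (simp add: cong_def)
      then show False using b d by simp
    qed
    have "[int \<theta> ^ j * (int \<theta> ^ r u - 1) = int \<theta> ^ j' * (int \<theta> ^ r u - 1)] (mod int p)"
      using cong_trans[OF modp[of i j] cong_sym[OF modp[of i' j']]] uv ij ruv by simp
    moreover have "coprime (int \<theta> ^ r u - 1) (int p)"
    proof -
      have "\<not> int p dvd int \<theta> ^ r u - 1"
      proof
        assume "int p dvd int \<theta> ^ r u - 1"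
        then have "[int \<theta> ^ r u = 1] (mod int p)" by (simp add: cong_iff_dvd_diff)
        then have "[\<theta> ^ r u = 1] (mod p)" by (metis cong_int_iff of_nat_1 of_nat_power)
        then show False using rnz by simp
      qed
      then show ?thesis using p by (metis coprime_commute prime_imp_coprime prime_int_nat_transfer prime_nat_int_transfer)
    qed
    ultimately have "[int \<theta> ^ j = int \<theta> ^ j'] (mod int p)" by (simp add: cong_mult_rcancel)
    then have "[\<theta> ^ j = \<theta> ^ j'] (mod p)" by (metis cong_int_iff of_nat_power)
    then have jj: "j = j'" using ex[of j j'] b by (simp add: cong_def)
    have "[i = i'] (mod (p - 1))" using cong_trans[OF cong_sym[OF rc[OF b(2), of i]], of i'] rc[OF b(4), of i'] ruv ij jj by simp
    then have "i = i'" using b by (simp add: cong_def)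
    then show "u = v" using ij jj by simp
  qed
  moreover have "(\<lambda>ij. r ij div q) ` ?Q \<subseteq> {..<g}"
  proof (rule image_subsetI)
    fix u assume "u \<in> ?Q"
    have "r u < g * q" unfolding r_def q(1)[symmetric] using p1 by (auto split: prod.splits)
    then show "r u div q \<in> {..<g}" by (simp add: less_mult_imp_div_less)
  qed
  ultimately have "card ?Q \<le> card {..<g}" by (intro card_inj_on_le) auto
  then show ?thesis by simp
qed

text \<open>The modulus \<open>p * q\<close> with \<open>q = (p - 1) / g\<close> is at most
  \<open>n\<close>, so the least residues, shifted by one, lie in \<open>{1..n}\<close>. Equal
  integer differences are in particular congruent modulo \<open>p\<close> and \<open>q\<close>, so
  the modular count applies.\<close>

lemma alpha_ge_prime:
  assumes p: "prime p" and pg: "[p = 1] (mod g)" and g: "g > 0" and n: "p * (p - 1) \<le> g * n"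
  shows "p - 1 \<le> alpha g n"
proof -
  have p1: "p > 1" using prime_gt_1_nat[OF p] .
  have "g dvd p - 1" using pg p1 by (simp add: cong_altdef_nat cong_sym_eq)
  then obtain q where q: "p - 1 = g * q" by auto
  have q0: "q > 0" using q p1 by (intro Nat.gr0I) auto
  obtain \<theta> where \<theta>: "residue_primroot p \<theta>" using prime_primitive_root_exists[OF p1 p] by blast
  then have \<theta>': "coprime p \<theta>" "ord p \<theta> = p - 1" using p by (auto simp: residue_primroot_def totient_prime)
  have "coprime p q"
  proof -
    have "coprime p (p - 1)" using p1 coprime_diff_one_left_nat[of p] by (simp add: coprime_commute)
    then show ?thesis using q by (metis coprime_mult_right_iff)
  qed
  then have "\<exists>y. [y = \<theta> ^ i] (mod p) \<and> [y = i] (mod q)" for i by (rule binary_chinese_remainder_nat)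
  then obtain y where y: "\<And>i. [y i = \<theta> ^ i] (mod p)" "\<And>i. [y i = i] (mod q)" by metis
  define x where "x i = int (y i mod (p * q))" for i
  have c: "[y i mod (p * q) = y i] (mod p)" "[y i mod (p * q) = y i] (mod q)" for i
    by (auto simp: cong_def mod_mod_cancel)
  have x1: "[x i = int \<theta> ^ i] (mod int p)" for i
    using cong_trans[OF c(1) y(1), of i] unfolding x_def by (metis cong_int_iff of_nat_power)
  have x2: "[x i = int i] (mod int q)" for i
    using cong_trans[OF c(2) y(2), of i] unfolding x_def by (metis cong_int_iff)
  have ex: "[\<theta> ^ a = \<theta> ^ b] (mod p) \<longleftrightarrow> [a = b] (mod (p - 1))" for a b
    using order_divides_expdiff[OF \<theta>'(1), of a b] \<theta>'(2) by simp
  have inj: "inj_on x {..<p - 1}"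
  proof (rule inj_onI)
    fix i j assume ij: "i \<in> {..<p - 1}" "j \<in> {..<p - 1}" "x i = x j"
    then have "[int \<theta> ^ i = int \<theta> ^ j] (mod int p)" using x1 by (metis cong_sym cong_trans)
    then have "[\<theta> ^ i = \<theta> ^ j] (mod p)" by (metis cong_int_iff of_nat_power)
    then show "i = j" using ex[of i j] ij by (simp add: cong_def)
  qed
  define A where "A = (\<lambda>i. x i + 1) ` {..<p - 1}"
  have cardA: "card A = p - 1"
    unfolding A_def using inj by (subst card_image) (auto simp: inj_on_def)
  have "p * q \<le> n"
  proof -
    have "g * (p * q) \<le> g * n" using n q by (simp add: mult_ac)
    then show ?thesis using g by simp
  qed
  have "A \<subseteq> {1..int n}"
  proof
    fix a assume "a \<in> A"
    then obtain i where i: "a = x i + 1" unfolding A_def by blast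
    have "y i mod (p * q) < p * q" using p1 q0 by simp
    then show "a \<in> {1..int n}" using i \<open>p * q \<le> n\<close> unfolding x_def by simp
  qed
  moreover have "diff_rep A d \<le> g" if "d \<noteq> 0" for d
  proof -
    let ?Q = "{(i, j). i < p - 1 \<and> j < p - 1 \<and> d = x i - x j}"
    have "finite ?Q" by (rule finite_subset[of _ "{..<p - 1} \<times> {..<p - 1}"]) auto
    moreover have "{(a, a'). a \<in> A \<and> a' \<in> A \<and> d = a - a'} \<subseteq> (\<lambda>(i, j). (x i + 1, x j + 1)) ` ?Q"
      unfolding A_def by (auto simp: image_iff)
    ultimately have "diff_rep A d \<le> card ?Q" unfolding diff_rep_def by (rule surj_card_le)
    also have "\<dots> \<le> g" using ruzsa_diff_count[OF p q q0 \<theta>' x1 x2 that] .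
    finally show ?thesis .
  qed
  ultimately have "admissible g n A" by (simp add: admissible_def)
  then show ?thesis using card_le_alpha cardA by metis
qed

section \<open>Dirichlet series\<close>

lemma norm_powr_diff_le:
  fixes s :: complex and x y :: real
  assumes "0 < x" "x \<le> y" "-1 \<le> Re s"
  shows "norm (of_real x powr (-s) - of_real y powr (-s)) \<le> norm s * x powr (- Re s - 1) * (y - x)"
proof -
  let ?S = "closed_segment (of_real x) (of_real y :: complex)"
  have seg: "\<exists>t. x \<le> t \<and> t \<le> y \<and> z = of_real t" if "z \<in> ?S" for z
    using that assms by (auto simp: closed_segment_of_real closed_segment_eq_real_ivl)
  have "norm ((\<lambda>z. z powr (-s)) (of_real x) - (\<lambda>z. z powr (-s)) (of_real y))
      \<le> (norm s * x powr (- Re s - 1)) * norm (of_real x - of_real y :: complex)"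
  proof (rule field_differentiable_bound[where S = ?S and f' = "\<lambda>z. -s * z powr (-s - 1)"])
    fix z assume "z \<in> ?S"
    then obtain t where t: "x \<le> t" "t \<le> y" "z = of_real t" using seg by blast
    have "z \<notin> \<real>\<^sub>\<le>\<^sub>0" using t assms by (auto simp: complex_nonpos_Reals_iff)
    then show "((\<lambda>z. z powr (-s)) has_field_derivative -s * z powr (-s - 1)) (at z within ?S)"
      by (intro has_field_derivative_at_within[OF has_field_derivative_powr])
    have "norm (z powr (-s - 1)) = t powr (- Re s - 1)"
      using t assms by (simp add: norm_powr_real_powr)
    also have "\<dots> \<le> x powr (- Re s - 1)"
      using t assms by (intro powr_mono2') auto
    finally show "norm (-s * z powr (-s - 1)) \<le> norm s * x powr (- Re s - 1)"
      by (simp add: norm_mult mult_left_mono)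
  qed auto
  also have "norm (of_real x - of_real y :: complex) = y - x"
    using assms by (metis abs_of_nonneg diff_ge_0_iff_ge norm_minus_commute norm_of_real of_real_diff)
  finally show ?thesis by simp
qed

text \<open>The error in replacing \<open>s n\<^sup>-\<^sup>s\<^sup>-\<^sup>1\<close> by the telescoping term \<open>n\<^sup>-\<^sup>s - (n + 1)\<^sup>-\<^sup>s\<close>;
  it gains one power of \<open>n\<close>. Since \<open>0 powr z = 0\<close>, its value at \<open>n = 0\<close> is \<open>1\<close>.\<close>

definition powr_err :: "nat \<Rightarrow> complex \<Rightarrow> complex" where
  "powr_err n s = s * of_nat n powr (-s - 1) - of_nat n powr (-s) + of_nat (Suc n) powr (-s)"

text \<open>Two applications of the mean value bound: the derivative of
  \<open>z \<mapsto> c z + z powr (-s)\<close> with \<open>c = s n powr (-s - 1)\<close> is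
  \<open>s\<close> times a difference of two powers with exponent \<open>-(s + 1)\<close>, to which
  \<open>norm_powr_diff_le\<close> applies.\<close>

lemma norm_powr_err_le:
  assumes "n > 0" "-2 \<le> Re s"
  shows "norm (powr_err n s) \<le> norm s * norm (s + 1) * real n powr (- Re s - 2)"
proof -
  let ?x = "real n"
  let ?S = "closed_segment (of_real ?x) (of_real (?x+1) :: complex)"
  let ?c = "s * of_real ?x powr (-s - 1)"
  let ?B = "norm s * norm (s + 1) * real n powr (- Re s - 2)"
  have seg: "\<exists>t. ?x \<le> t \<and> t \<le> ?x+1 \<and> z = of_real t" if "z \<in> ?S" for z
    using that closed_segment_of_real[of ?x "?x + 1", where ?'a = complex]
    by (auto simp: closed_segment_eq_real_ivl simp del: of_real_add of_real_of_nat_eq)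
  have "norm ((\<lambda>z. ?c * z + z powr (-s)) (of_real (?x+1)) - (\<lambda>z. ?c * z + z powr (-s)) (of_real ?x))
      \<le> ?B * norm (of_real (?x+1) - of_real ?x :: complex)"
  proof (rule field_differentiable_bound[where S = ?S and f' = "\<lambda>z. ?c - s * z powr (-s - 1)"])
    fix z assume "z \<in> ?S"
    then obtain t where t: "?x \<le> t" "t \<le> ?x+1" "z = of_real t" using seg by blast
    have "z \<notin> \<real>\<^sub>\<le>\<^sub>0" using t assms by (auto simp: complex_nonpos_Reals_iff)
    then show "((\<lambda>z. ?c * z + z powr (-s)) has_field_derivative ?c - s * z powr (-s - 1)) (at z within ?S)"
      by (auto intro!: derivative_eq_intros has_field_derivative_at_within[OF has_field_derivative_powr])
    have "norm (of_real ?x powr (-(s+1)) - z powr (-(s+1))) \<le> norm (s+1) * ?x powr (- Re (s+1) - 1) * (t - ?x)"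
      unfolding t(3) using t assms by (intro norm_powr_diff_le) auto
    also have "\<dots> \<le> norm (s+1) * ?x powr (- Re (s+1) - 1) * 1"
      using t by (intro mult_left_mono) auto
    finally have *: "norm (of_real ?x powr (-(s+1)) - z powr (-(s+1))) \<le> norm (s+1) * ?x powr (- Re s - 2)"
      by (simp add: algebra_simps)
    have "norm (?c - s * z powr (-s - 1)) = norm s * norm (of_real ?x powr (-(s+1)) - z powr (-(s+1)))"
      by (simp only: norm_mult[symmetric] right_diff_distrib minus_add_distrib add_uminus_conv_diff)
    also have "\<dots> \<le> ?B" using mult_left_mono[OF *, of "norm s"] by (simp add: mult_ac)
    finally show "norm (?c - s * z powr (-s - 1)) \<le> ?B" .
  qed auto
  moreover have "(\<lambda>z. ?c * z + z powr (-s)) (of_real (?x+1)) - (\<lambda>z. ?c * z + z powr (-s)) (of_real ?x) = powr_err n s"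
    by (simp add: powr_err_def algebra_simps)
  ultimately show ?thesis by simp
qed

text \<open>Weierstrass test: for \<open>Re s > \<kappa>\<close> the exponent of \<open>n\<close> is
  below \<open>-1\<close>, locally uniformly. The bound is asked only for \<open>n > 0\<close>
  because its right side is \<open>0\<close> at \<open>n = 0\<close>, whereas
  \<open>powr_err 0\<close> takes the value \<open>1\<close>.\<close>

lemma holomorphic_powr_series:
  fixes f :: "nat \<Rightarrow> complex \<Rightarrow> complex"
  assumes der: "\<And>n s. Re s > \<kappa> \<Longrightarrow> (f n has_field_derivative f' n s) (at s)"
    and bd: "\<And>n s. n > 0 \<Longrightarrow> Re s > \<kappa> \<Longrightarrow> norm (f n s) \<le> M * (1 + norm s)^2 * real n powr (\<kappa> - 1 - Re s)"
  shows "(\<lambda>s. \<Sum>n. f n s) holomorphic_on {s. Re s > \<kappa>}"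
    and "\<And>s. Re s > \<kappa> \<Longrightarrow> summable (\<lambda>n. f n s)"
    and "\<And>s. Re s > \<kappa> \<Longrightarrow> ((\<lambda>s. \<Sum>n. f n s) has_field_derivative (\<Sum>n. f' n s)) (at s)"
proof -
  let ?S = "{s. Re s > \<kappa>}"
  have op: "open ?S" by (rule open_halfspace_Re_gt)
  have "\<exists>g g'. \<forall>x \<in> ?S. ((\<lambda>n. f n x) sums g x) \<and> ((\<lambda>n. f' n x) sums g' x) \<and> (g has_field_derivative g' x) (at x)"
  proof (rule series_and_derivative_comparison_local[OF op])
    fix s assume "s \<in> ?S"
    \<comment> \<open>Half the distance to the boundary line, so that the exponent is at most
      \<open>- 1 - d\<close> on the whole ball around \<open>s\<close>.\<close>
    define d where "d = (Re s - \<kappa>) / 2"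
    have d: "d > 0" using \<open>s \<in> ?S\<close> by (simp add: d_def)
    define h where "h n = \<bar>M\<bar> * (1 + norm s + d)^2 * real n powr (- 1 - d)" for n
    have "summable h"
      unfolding h_def using d by (intro summable_mult) (simp add: summable_real_powr_iff)
    moreover have "\<forall>\<^sub>F n in sequentially. \<forall>y\<in>ball s d \<inter> ?S. norm (f n y) \<le> h n"
      using eventually_gt_at_top[of 0]
    proof eventually_elim
      case (elim n)
      show ?case
      proof
        fix y assume y: "y \<in> ball s d \<inter> ?S"
        have ny: "norm y \<le> norm s + d"
          using y norm_triangle_sub[of y s] by (auto simp: dist_norm norm_minus_commute)
        have "Re s - Re y \<le> norm (s - y)" using complex_Re_le_cmod[of "s - y"] by simp
        moreover have "norm (s - y) < d" using y by (simp add: dist_norm)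
        ultimately have re: "Re y \<ge> \<kappa> + d" by (simp add: d_def field_simps)
        have "norm (f n y) \<le> M * (1 + norm y)^2 * real n powr (\<kappa> - 1 - Re y)"
          using bd y elim by auto
        also have "\<dots> \<le> \<bar>M\<bar> * (1 + norm y)^2 * real n powr (\<kappa> - 1 - Re y)"
          by (intro mult_right_mono) auto
        also have "\<dots> \<le> h n"
          unfolding h_def using ny re elim d
          by (intro mult_mono powr_mono power_mono) auto
        finally show "norm (f n y) \<le> h n" .
      qed
    qed
    ultimately show "\<exists>d h. 0 < d \<and> summable h \<and> (\<forall>\<^sub>F n in sequentially. \<forall>y\<in>ball s d \<inter> ?S. norm (f n y) \<le> h n)"
      using d by blast
  qed (use der in auto)
  then obtain g g' where g: "\<And>x. x \<in> ?S \<Longrightarrow> (\<lambda>n. f n x) sums g x" "\<And>x. x \<in> ?S \<Longrightarrow> (\<lambda>n. f' n x) sums g' x"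
      "\<And>x. x \<in> ?S \<Longrightarrow> (g has_field_derivative g' x) (at x)" by blast
  show "\<And>s. Re s > \<kappa> \<Longrightarrow> summable (\<lambda>n. f n s)" 
    using g by (auto simp: summable_def)
  show *: "((\<lambda>s. \<Sum>n. f n s) has_field_derivative (\<Sum>n. f' n s)) (at s)" if "Re s > \<kappa>" for s
  proof (rule has_field_derivative_transform_within_open[OF _ op])
    show "(g has_field_derivative (\<Sum>n. f' n s)) (at s)"
      using g that sums_unique by fastforce
  qed (use that g in \<open>auto simp: sums_iff\<close>)
  show "(\<lambda>s. \<Sum>n. f n s) holomorphic_on ?S"
    using * op by (auto simp: holomorphic_on_open)
qed

lemma has_field_derivative_nat_powr:
  assumes "n > 0"
  shows "((\<lambda>s. of_nat n powr (-s) :: complex) has_field_derivative - of_real (ln (real n)) * of_nat n powr (-s)) (at s)"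
  using assms by (auto intro!: derivative_eq_intros simp: powr_def Ln_of_nat)

lemma nat_powr_holomorphic [holomorphic_intros]:
  "f holomorphic_on A \<Longrightarrow> (\<lambda>s. of_nat n powr f s) holomorphic_on A"
  by (cases "n = 0") (auto intro!: holomorphic_intros)

lemma powr_err_holomorphic [holomorphic_intros]:
  "f holomorphic_on A \<Longrightarrow> (\<lambda>s. powr_err n (f s)) holomorphic_on A"
  unfolding powr_err_def by (intro holomorphic_intros)

lemma deriv_if_holomorphic_halfplane:
  "f holomorphic_on {s. Re s > \<kappa>} \<Longrightarrow> Re s > \<kappa> \<Longrightarrow> (f has_field_derivative deriv f s) (at s)"
  by (rule holomorphic_derivI[OF _ open_halfspace_Re_gt]) auto

lemma powr_sum_by_parts:
  fixes a :: "nat \<Rightarrow> complex"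
  shows "(\<Sum>n=1..N. a n * of_nat n powr (-s)) =
    (\<Sum>n=1..N. (\<Sum>k=1..n. a k) * (of_nat n powr (-s) - of_nat (Suc n) powr (-s)))
      + (\<Sum>k=1..N. a k) * of_nat (Suc N) powr (-s)"
  by (induction N) (simp_all add: algebra_simps)

text \<open>Abel summation: partial sums of size \<open>n powr \<kappa>\<close> give convergence and
  holomorphy for \<open>Re s > \<kappa>\<close>. The two cases in use are \<kappa> = 0, for
  mean-zero periodic coefficients, and \<kappa> = 1, for Chebyshev's bound.\<close>

lemma dirichlet_series_by_parts:
  fixes a :: "nat \<Rightarrow> complex"
  assumes S: "\<And>n. n > 0 \<Longrightarrow> norm (\<Sum>k=1..n. a k) \<le> C * real n powr \<kappa>" and "\<kappa> \<ge> 0"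
  defines "f \<equiv> \<lambda>n s. (\<Sum>k=1..n. a k) * (of_nat n powr (-s) - of_nat (Suc n) powr (-s))"
  shows "Re s > \<kappa> \<Longrightarrow> (\<lambda>n. a n * of_nat n powr (-s)) sums (\<Sum>n. f n s)"
    and "(\<lambda>s. \<Sum>n. a n * of_nat n powr (-s)) holomorphic_on {s. Re s > \<kappa>}"
    and "Re s > \<kappa> \<Longrightarrow> summable (\<lambda>n. f n s)"
proof -
  have C0: "C \<ge> 0" using order_trans[OF norm_ge_zero S[of 1]] by simp
  have bd: "norm (f n s) \<le> C * (1 + norm s)^2 * real n powr (\<kappa> - 1 - Re s)" if "n > 0" "Re s > \<kappa>" for n s
  proof -
    have "norm (f n s) \<le> (C * real n powr \<kappa>) * (norm s * real n powr (- Re s - 1) * (real (Suc n) - real n))"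
      unfolding f_def norm_mult using norm_powr_diff_le[of "real n" "real (Suc n)" s] that S assms(2) C0
      by (intro mult_mono S) auto
    also have "\<dots> = C * norm s * (real n powr \<kappa> * real n powr (- Re s - 1))" by simp
    also have "real n powr \<kappa> * real n powr (- Re s - 1) = real n powr (\<kappa> - 1 - Re s)"
      by (simp flip: powr_add add: algebra_simps)
    also have "C * norm s * \<dots> \<le> C * (1 + norm s)^2 * \<dots>"
      using C0 by (intro mult_right_mono mult_left_mono) (auto simp: power2_eq_square algebra_simps)
    finally show ?thesis .
  qed
  have hol: "f n holomorphic_on {s. Re s > \<kappa>}" for n
    unfolding f_def by (intro holomorphic_intros)
  note ser = holomorphic_powr_series[where f = f and \<kappa> = \<kappa>, OF deriv_if_holomorphic_halfplane[OF hol] bd]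
  show *: "(\<lambda>n. a n * of_nat n powr (-s)) sums (\<Sum>n. f n s)" if s: "Re s > \<kappa>" for s
  proof -
    have "(\<lambda>N. \<Sum>n<Suc N. f n s) \<longlonglongrightarrow> (\<Sum>n. f n s)"
      using ser(2)[OF _ _ _ s] by (intro LIMSEQ_Suc[OF summable_LIMSEQ]) auto
    moreover have "(\<lambda>N. (\<Sum>k=1..N. a k) * of_nat (Suc N) powr (-s)) \<longlonglongrightarrow> 0"
    proof (rule Lim_null_comparison)
      show "\<forall>\<^sub>F N in sequentially. norm ((\<Sum>k=1..N. a k) * of_nat (Suc N) powr (-s)) \<le> C * real N powr (\<kappa> - Re s)"
        using eventually_gt_at_top[of 0]
      proof eventually_elim
        case (elim N)
        have "norm ((\<Sum>k=1..N. a k) * of_nat (Suc N) powr (-s)) \<le> (C * real N powr \<kappa>) * real (Suc N) powr (- Re s)"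
          unfolding norm_mult using S[of N] elim C0 by (intro mult_mono) (auto simp: norm_powr_real_powr)
        also have "\<dots> \<le> (C * real N powr \<kappa>) * real N powr (- Re s)"
          using C0 elim s assms(2) by (intro mult_left_mono powr_mono2') auto
        also have "\<dots> = C * real N powr (\<kappa> - Re s)" by (simp flip: powr_add)
        finally show ?case .
      qed
      show "(\<lambda>N. C * real N powr (\<kappa> - Re s)) \<longlonglongrightarrow> 0"
        using s by (intro tendsto_mult_right_zero tendsto_neg_powr filterlim_real_sequentially) auto
    qed
    ultimately have "(\<lambda>N. (\<Sum>n<Suc N. f n s) + (\<Sum>k=1..N. a k) * of_nat (Suc N) powr (-s)) \<longlonglongrightarrow> (\<Sum>n. f n s) + 0"
      by (intro tendsto_add)
    moreover have "(\<Sum>n<Suc N. f n s) + (\<Sum>k=1..N. a k) * of_nat (Suc N) powr (-s) = (\<Sum>n<Suc N. a n * of_nat n powr (-s))" for N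
    proof -
      have eq: "{..<Suc N} = insert 0 {1..N}" by auto
      show ?thesis unfolding eq using powr_sum_by_parts[of a s N] by (simp add: f_def)
    qed
    ultimately have "(\<lambda>N. \<Sum>n<Suc N. a n * of_nat n powr (-s)) \<longlonglongrightarrow> (\<Sum>n. f n s)" by simp
    then show ?thesis unfolding sums_def by (rule LIMSEQ_imp_Suc)
  qed
  show "Re s > \<kappa> \<Longrightarrow> summable (\<lambda>n. f n s)" using ser(2)[of s] by auto
  have "(\<lambda>s. \<Sum>n. f n s) holomorphic_on {s. Re s > \<kappa>}" using ser(1) by auto
  then show "(\<lambda>s. \<Sum>n. a n * of_nat n powr (-s)) holomorphic_on {s. Re s > \<kappa>}"
    by (rule holomorphic_transform) (use * in \<open>auto simp: sums_iff\<close>)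
qed

section \<open>Newman's Tauberian theorem\<close>

lemma powr_mvt:
  fixes u v p :: real
  assumes "0 < u" "u < v"
  obtains \<xi> where "u < \<xi>" "\<xi> < v" "v powr p - u powr p = p * \<xi> powr (p - 1) * (v - u)"
proof -
  have "\<exists>z>u. z < v \<and> v powr p - u powr p = (v - u) * (p * z powr (p - 1))"
    using assms by (intro MVT2) (auto intro!: derivative_eq_intros simp: field_simps powr_diff)
  then show ?thesis using that by (auto simp: mult_ac)
qed

text \<open>Comparison with the integral of \<open>x powr (- 1 - Re z)\<close>, done by the mean
  value theorem on each unit step so that the majorant telescopes.\<close>

lemma norm_powr_tail_le:
  fixes a :: "nat \<Rightarrow> complex"
  assumes bd: "\<And>n. norm (a n) \<le> C" and x: "Re z > 0" and N: "N > 0"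
    and f: "(\<lambda>n. a n * of_nat n powr (-1-z)) sums f"
  shows "norm (f - (\<Sum>n=1..N. a n * of_nat n powr (-1-z))) \<le> C * real N powr (- Re z) / Re z"
proof -
  let ?x = "Re z"
  define t where "t n = C * (real (n+N) powr (-?x) - real (Suc n + N) powr (-?x)) / ?x" for n
  have C0: "C \<ge> 0" using order_trans[OF norm_ge_zero bd] .
  have "(\<lambda>n. real (n + N) powr (-?x)) \<longlonglongrightarrow> 0"
    using x by (intro tendsto_neg_powr filterlim_compose[OF filterlim_real_sequentially] filterlim_add_const_nat_at_top) auto
  from telescope_sums'[OF this] have "(\<lambda>n. C * (real (n+N) powr (-?x) - real (Suc n + N) powr (-?x)) / ?x) sums (C * (real (0+N) powr (-?x) - 0) / ?x)"
    by (intro sums_divide sums_mult)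
  then have t: "t sums (C * real N powr (-?x) / ?x)" unfolding t_def by simp
  have "{..<Suc N} = insert 0 {1..N}" by auto
  then have "(\<Sum>n<Suc N. a n * of_nat n powr (-1-z)) = (\<Sum>n=1..N. a n * of_nat n powr (-1-z))" by simp
  with sums_split_initial_segment[OF f, of "Suc N"]
  have r: "(\<lambda>n. a (n + Suc N) * of_nat (n + Suc N) powr (-1-z)) sums (f - (\<Sum>n=1..N. a n * of_nat n powr (-1-z)))"
    by simp
  have le: "norm (a (n + Suc N) * of_nat (n + Suc N) powr (-1-z)) \<le> t n" for n
  proof -
    let ?u = "real (n + N)" and ?v = "real (Suc n + N)"
    obtain \<xi> where \<xi>: "?u < \<xi>" "\<xi> < ?v" "?v powr (-?x) - ?u powr (-?x) = (-?x) * \<xi> powr (-?x - 1) * (?v - ?u)"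
      using N by (rule_tac powr_mvt[of ?u ?v "-?x"]) auto
    then have e: "?u powr (-?x) - ?v powr (-?x) = ?x * \<xi> powr (-?x - 1)" by simp
    have "?v powr (-?x - 1) \<le> \<xi> powr (-?x - 1)" using \<xi> x by (intro powr_mono2') auto
    then have "?v powr (-?x - 1) \<le> (?u powr (-?x) - ?v powr (-?x)) / ?x" using x e by (simp add: field_simps)
    moreover have "norm (of_nat (n + Suc N) powr (-1-z)) = ?v powr (-?x - 1)"
      by (subst norm_powr_real_powr) (auto intro: arg_cong2[where f = "(powr)"])
    ultimately show ?thesis unfolding t_def norm_mult times_divide_eq_right[symmetric] using C0 bd by (intro mult_mono) auto
  qed
  have "norm (\<Sum>n. a (n + Suc N) * of_nat (n + Suc N) powr (-1-z)) \<le> (\<Sum>n. t n)"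
    using le t by (intro norm_suminf_le) (auto simp: sums_iff)
  then show ?thesis using r t by (simp add: sums_iff)
qed

text \<open>The cases follow the monotonicity of \<open>n powr (y - 1)\<close>. If it decreases,
  each term is below the integral over the preceding unit interval; if it increases, the following
  interval is used and the last term is left over.\<close>

lemma sum_powr_le:
  fixes y :: real
  assumes y: "y > 0"
  shows "N > 0 \<Longrightarrow> (\<Sum>n=1..N. real n powr (y - 1)) \<le> real N powr y / y + real N powr (y - 1)"
proof (cases "y \<le> 1")
  case True
  have "(\<Sum>n=1..N. real n powr (y - 1)) \<le> real N powr y / y" for N
  proof (induction N)
    case (Suc N)
    have "real (Suc N) powr (y - 1) \<le> (real (Suc N) powr y - real N powr y) / y"
    proof (cases "N = 0")
      case True then show ?thesis using y \<open>y \<le> 1\<close> by simp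
    next
      case False
      obtain \<xi> where \<xi>: "real N < \<xi>" "\<xi> < real (Suc N)" "real (Suc N) powr y - real N powr y = y * \<xi> powr (y - 1) * (real (Suc N) - real N)"
        using False by (rule_tac powr_mvt[of "real N" "real (Suc N)" y]) auto
      have "real (Suc N) powr (y - 1) \<le> \<xi> powr (y - 1)" using \<xi> True by (intro powr_mono2') auto
      then show ?thesis using \<xi> y by (simp add: field_simps)
    qed
    then show ?case using Suc y by (simp add: diff_divide_distrib)
  qed auto
  then show ?thesis by (meson add_increasing2 powr_ge_zero)
next
  case False
  show "N > 0 \<Longrightarrow> ?thesis"
  proof (induction N rule: nat_induct_non_zero)
    case 1 then show ?case using y by simp
  next
    case (Suc N)
    obtain \<xi> where \<xi>: "real N < \<xi>" "\<xi> < real (Suc N)" "real (Suc N) powr y - real N powr y = y * \<xi> powr (y - 1) * (real (Suc N) - real N)"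
      using Suc by (rule_tac powr_mvt[of "real N" "real (Suc N)" y]) auto
    have "real N powr (y - 1) \<le> \<xi> powr (y - 1)" using \<xi> False by (intro powr_mono2) auto
    then have "real N powr (y - 1) \<le> (real (Suc N) powr y - real N powr y) / y"
      using \<xi> y by (simp add: field_simps)
    then show ?case using Suc by (simp add: diff_divide_distrib)
  qed
qed

text \<open>On the circle \<open>z * cnj z = R^2\<close>, so the kernel is real and proportional to
  \<open>Re z\<close>. This factor cancels the \<open>1 / Re z\<close> of the tail bound and the
  \<open>1 / y\<close> of the bound for partial sums.\<close>

lemma newman_kernel:
  assumes "norm z = R" "R > 0"
  shows "(1 + z^2 / of_real R^2) / z = of_real (2 * Re z / R^2)"
proof -
  have z: "z \<noteq> 0" using assms by auto
  have "z * cnj z = of_real R ^ 2" using complex_norm_square[of z] assms by simp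
  then have "cnj z * z + z * z = z * of_real (2 * Re z)" 
    by (simp only: complex_add_cnj[symmetric]) (simp add: algebra_simps)
  moreover have "(1 + z^2 / of_real R^2) = (cnj z * z + z * z) / of_real R^2"
    using \<open>z * cnj z = _\<close> assms by (simp add: field_simps power2_eq_square)
  ultimately show ?thesis using z by (simp add: field_simps)
qed

text \<open>Cauchy's formula with the circle kept as two arcs, because the halves are estimated by
  different means. Subtracting \<open>g 0 / z\<close> leaves an entire function, and
  \<open>1 / z\<close> integrates over an arc to \<open>\<i>\<close> times its angle.\<close>

lemma contour_integral_two_arcs:
  assumes g: "g holomorphic_on UNIV" and R: "R > 0"
  shows "contour_integral (part_circlepath 0 R (-pi/2) (pi/2)) (\<lambda>z. g z / z)
       + contour_integral (part_circlepath 0 R (pi/2) (3*pi/2)) (\<lambda>z. g z / z) = 2 * of_real pi * \<i> * g 0"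
proof -
  let ?A = "part_circlepath 0 R (-pi/2) (pi/2)" and ?B = "part_circlepath 0 R (pi/2) (3*pi/2)"
  define k where "k = (\<lambda>z. if z = 0 then deriv g 0 else (g z - g 0) / (z - 0))"
  have kh: "k holomorphic_on UNIV" unfolding k_def by (rule pole_lemma[OF g]) auto
  have ends: "pathfinish ?A = pathstart ?B" "pathfinish ?B = pathstart ?A"
  proof -
    have "exp (\<i> * of_real (3*pi/2)) = exp (\<i> * of_real (-pi/2))"
      using exp_plus_2pin[of "\<i> * of_real (-pi/2)" 1] by (simp add: algebra_simps)
    then show "pathfinish ?B = pathstart ?A" by simp
  qed simp
  have "(k has_contour_integral 0) (?A +++ ?B)"
    using ends by (intro Cauchy_theorem_convex_simple[OF kh]) auto
  moreover have kint: "k contour_integrable_on part_circlepath 0 R s t" for s t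
    by (intro contour_integrable_continuous_part_circlepath continuous_on_subset[OF holomorphic_on_imp_continuous_on[OF kh]]) auto
  ultimately have k0: "contour_integral ?A k + contour_integral ?B k = 0"
    using ends by (metis contour_integral_join contour_integral_unique valid_path_part_circlepath)
  have arc: "contour_integral (part_circlepath 0 R s t) (\<lambda>z. g z / z) = contour_integral (part_circlepath 0 R s t) k + g 0 * \<i> * of_real (t - s)" if "s < t" for s t
  proof -
    have "((\<lambda>x. \<i> * of_real 1) has_integral (t - s) *\<^sub>R (\<i> * of_real 1)) {s..t}" 
      using that has_integral_const_real[of "\<i> * of_real 1" s t] by simp
    then have "((\<lambda>z. 1 / z) has_contour_integral (t - s) *\<^sub>R \<i>) (part_circlepath 0 R s t)"
      using R that by (subst has_contour_integral_part_circlepath_iff) (auto simp: field_simps)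
    then have 1: "((\<lambda>z. g 0 * (1 / z)) has_contour_integral g 0 * ((t - s) *\<^sub>R \<i>)) (part_circlepath 0 R s t)"
      by (rule has_contour_integral_lmul)
    have "((\<lambda>z. k z + g 0 * (1 / z)) has_contour_integral contour_integral (part_circlepath 0 R s t) k + g 0 * ((t - s) *\<^sub>R \<i>)) (part_circlepath 0 R s t)"
      using kint by (intro has_contour_integral_add 1 has_contour_integral_integral) auto
    then have "((\<lambda>z. g z / z) has_contour_integral contour_integral (part_circlepath 0 R s t) k + g 0 * ((t - s) *\<^sub>R \<i>)) (part_circlepath 0 R s t)"
    proof (rule has_contour_integral_eq)
      fix z assume "z \<in> path_image (part_circlepath 0 R s t)"
      then have "norm z = R" using in_path_image_part_circlepath[of z 0 R s t] R that by auto
      then show "k z + g 0 * (1 / z) = g z / z" using R by (auto simp: k_def field_simps)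
    qed
    then show ?thesis by (simp add: contour_integral_unique scaleR_conv_of_real mult_ac)
  qed
  show ?thesis
    using k0 by (subst arc, simp, subst arc, simp) (simp add: algebra_simps flip: add_divide_distrib)
qed


text \<open>Newman's kernel \<open>N\<^sup>z (1/z + z/R\<^sup>2)\<close>, integrated over the circle of radius \<open>R\<close>. Over the right
  half circle \<open>f\<close> itself contributes the same as over the imaginary axis, because \<open>f 0 = 0\<close> removes the
  pole; there integration by parts gains the factor \<open>1 / ln N\<close>.\<close>

lemma newman_aux:
  fixes a :: "nat \<Rightarrow> complex"
  assumes bd: "\<And>n. norm (a n) \<le> C"
    and U: "open U" "{z. Re z \<ge> 0} \<subseteq> U" "f holomorphic_on U" "f 0 = 0"
    and f: "\<And>z. Re z > 0 \<Longrightarrow> (\<lambda>n. a n * of_nat n powr (-1-z)) sums f z"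
    and R: "R > 0"
  shows "\<exists>M. \<forall>N\<ge>2. 2 * pi * norm (\<Sum>n=1..N. a n / of_nat n) \<le> 4 * pi * C / R + 2 * pi * C / real N + M / ln (real N)"
proof -
  let ?A = "part_circlepath 0 R (-pi/2) (pi/2)" and ?B = "part_circlepath 0 R (pi/2) (3*pi/2)"
  let ?L = "linepath (\<i> * of_real R) (-\<i> * of_real R)"
  let ?q = "\<lambda>z::complex. 1 + z^2 / of_real R^2"
  have C0: "C \<ge> 0" using order_trans[OF norm_ge_zero bd] .
  define S where "S N z = (\<Sum>n=1..N. a n * of_nat n powr (-1-z))" for N z
  define H where "H = (\<lambda>z. (if z = 0 then deriv f 0 else (f z - f 0) / (z - 0)) * ?q z)"
  have "0 \<in> U" using U by auto
  then have Hh: "H holomorphic_on U" unfolding H_def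
    using U by (intro holomorphic_intros pole_lemma) (auto simp: interior_open)
  have H'h: "deriv H holomorphic_on U" using Hh U(1) by (rule holomorphic_deriv)
  have segU: "closed_segment (\<i> * of_real R) (-\<i> * of_real R) \<subseteq> {z. Re z = 0}"
    by (auto simp: in_segment)
  then have segU': "closed_segment (\<i> * of_real R) (-\<i> * of_real R) \<subseteq> U" using U(2) by (rule_tac order_trans[OF _ U(2)]) force
  have "bounded (deriv H ` closed_segment (\<i> * of_real R) (-\<i> * of_real R))"
    by (intro compact_imp_bounded compact_continuous_image continuous_on_subset[OF holomorphic_on_imp_continuous_on[OF H'h]] segU') auto
  then obtain B where B: "\<And>z. z \<in> closed_segment (\<i> * of_real R) (-\<i> * of_real R) \<Longrightarrow> norm (deriv H z) \<le> B" "B > 0"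
    unfolding bounded_pos by auto
  define M where "M = norm (H (\<i> * of_real R)) + norm (H (-\<i> * of_real R)) + B * (2 * R)"
  have reA: "norm z = R \<and> Re z \<ge> 0" if "z \<in> path_image ?A" for z
  proof -
    from that obtain t where t: "-pi/2 \<le> t" "t \<le> pi/2" "z = of_real R * cis t"
      by (auto simp: path_image_part_circlepath' closed_segment_eq_real_ivl split: if_splits)
    then show ?thesis using R cos_ge_zero[of t] by (auto simp: norm_mult)
  qed
  have reB: "norm z = R \<and> Re z \<le> 0" if "z \<in> path_image ?B" for z
  proof -
    from that obtain t where t: "pi/2 \<le> t" "t \<le> 3*pi/2" "z = of_real R * cis t"
      by (auto simp: path_image_part_circlepath' closed_segment_eq_real_ivl split: if_splits)
    then have "cos (t - pi) \<ge> 0" by (intro cos_ge_zero) auto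
    then show ?thesis using R t by (auto simp: norm_mult cos_diff mult_nonneg_nonpos)
  qed
  have pts: "z = \<i> * of_real R \<or> z = -\<i> * of_real R" if "norm z = R" "Re z = 0" for z
    using that R by (auto simp: complex_eq_iff cmod_def abs_if split: if_splits)
  have main: "2 * pi * norm (S N 0) \<le> 4 * pi * C / R + 2 * pi * C / real N + M / ln (real N)" if N: "N \<ge> 2" for N
  proof -
    let ?P = "\<lambda>z. of_nat N powr z :: complex"
    have lnN: "ln (real N) > 0" using N by simp
    have normP: "norm (?P z) = real N powr Re z" for z using N by (simp add: norm_powr_real_powr)
    have Pd: "(?P has_field_derivative of_real (ln (real N)) * ?P z) (at z)" for z
      using N by (auto intro!: derivative_eq_intros simp: powr_def Ln_of_nat)
    have Ph: "?P holomorphic_on X" for X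
      using N by (intro holomorphic_intros)
    have Sh: "S N holomorphic_on X" for X
      unfolding S_def by (intro holomorphic_intros) auto
    let ?G = "\<lambda>z. S N z * ?P z * ?q z"
    have Gh: "?G holomorphic_on X" for X
      using R by (intro holomorphic_intros Sh Ph) auto
    have two: "contour_integral ?A (\<lambda>z. ?G z / z) + contour_integral ?B (\<lambda>z. ?G z / z) = 2 * of_real pi * \<i> * S N 0"
      using contour_integral_two_arcs[OF Gh R] N by simp
    have HPh: "(\<lambda>z. H z * ?P z) holomorphic_on U" by (intro holomorphic_intros Hh Ph)
    have Gint: "(\<lambda>z. ?G z / z) contour_integrable_on ?A" "(\<lambda>z. ?G z / z) contour_integrable_on ?B"
      by (intro contour_integrable_continuous_part_circlepath holomorphic_on_imp_continuous_on holomorphic_on_divide Gh holomorphic_intros; use reA reB R in force)+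
    have HPint: "(\<lambda>z. H z * ?P z) contour_integrable_on ?A" "(\<lambda>z. H z * ?P z) contour_integrable_on ?L"
      using U(2) reA segU' by (auto intro!: contour_integrable_continuous_part_circlepath contour_integrable_continuous_linepath
          continuous_on_subset[OF holomorphic_on_imp_continuous_on[OF HPh]])
    have ends: "pathfinish ?A = \<i> * of_real R" "pathstart ?A = -\<i> * of_real R"
      by (simp_all add: complex_eq_iff Re_exp Im_exp)
    \<comment> \<open>\<open>U\<close> need not be convex, so Cauchy's theorem is used on the closed
      half-plane, with differentiability in its interior and continuity up to the axis.\<close>
    have "((\<lambda>z. H z * ?P z) has_contour_integral 0) (?A +++ ?L)"
    proof (rule Cauchy_theorem_convex[where S = "{z. Re z \<ge> 0}" and K = "{}"])
      show "continuous_on {z. 0 \<le> Re z} (\<lambda>z. H z * ?P z)"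
        using continuous_on_subset[OF holomorphic_on_imp_continuous_on[OF HPh] U(2)] .
      show "convex {z. 0 \<le> Re z}" by (rule convex_halfspace_Re_ge)
      show "(\<lambda>z. H z * ?P z) field_differentiable at x" if "x \<in> interior {z. 0 \<le> Re z} - {}" for x
        using that U interior_subset by (intro holomorphic_on_imp_differentiable_at[OF HPh U(1)]) blast
      show "valid_path (?A +++ ?L)" using ends by (intro valid_path_join) auto
      show "path_image (?A +++ ?L) \<subseteq> {z. 0 \<le> Re z}"
        using reA segU by (subst path_image_join) (use ends in auto)
    qed (use ends in auto)
    then have AL: "contour_integral ?A (\<lambda>z. H z * ?P z) = - contour_integral ?L (\<lambda>z. H z * ?P z)"
      using HPint ends contour_integral_join[of "\<lambda>z. H z * ?P z" ?A ?L]
      by (simp add: contour_integral_unique eq_neg_iff_add_eq_0)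
    have parts: "norm (contour_integral ?L (\<lambda>z. H z * ?P z)) \<le> M / ln (real N)"
    proof -
      \<comment> \<open>The derivative of \<open>H * ?P\<close>; differentiating
        \<open>N powr z\<close> brings out \<open>ln N\<close>. On the axis \<open>N powr z\<close>
        has modulus 1, so the boundary terms and the integral of \<open>deriv H * ?P\<close> are
        bounded independently of \<open>N\<close>.\<close>
      let ?D = "\<lambda>z. deriv H z * ?P z + of_real (ln (real N)) * (H z * ?P z)"
      have "(?D has_contour_integral (H (-\<i> * of_real R) * ?P (-\<i> * of_real R) - H (\<i> * of_real R) * ?P (\<i> * of_real R))) ?L"
      proof -
        have 1: "((\<lambda>z. H z * ?P z) has_field_derivative ?D z) (at z within U)" if "z \<in> U" for z
          by (rule derivative_eq_intros has_field_derivative_at_within[OF Pd] refl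
              has_field_derivative_at_within[OF holomorphic_derivI[OF Hh U(1) that]])+ (simp add: mult_ac)
        show ?thesis using contour_integral_primitive[of U "\<lambda>z. H z * ?P z" ?D ?L, OF 1] segU' by simp
      qed
      moreover have "(\<lambda>z. of_real (ln (real N)) * (H z * ?P z)) contour_integrable_on ?L"
        using contour_integrable_lmul[OF HPint(2)] .
      ultimately have D': "((\<lambda>z. deriv H z * ?P z) has_contour_integral
          (H (-\<i> * of_real R) * ?P (-\<i> * of_real R) - H (\<i> * of_real R) * ?P (\<i> * of_real R))
            - of_real (ln (real N)) * contour_integral ?L (\<lambda>z. H z * ?P z)) ?L" (is "(_ has_contour_integral ?E - ?l * ?I) _")
        using has_contour_integral_diff[of ?D ?E ?L "\<lambda>z. of_real (ln (real N)) * (H z * ?P z)" "?l * ?I"]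
          has_contour_integral_lmul[OF has_contour_integral_integral[OF HPint(2)], of ?l] by simp
      have nb: "norm (deriv H z * ?P z) \<le> B" if "z \<in> closed_segment (\<i> * of_real R) (-\<i> * of_real R)" for z
      proof -
        have "Re z = 0" using that segU by auto
        then show ?thesis using B(1)[OF that] N by (simp add: norm_mult normP)
      qed
      have "norm (?E - ?l * ?I) \<le> B * norm (-\<i> * of_real R - \<i> * of_real R)"
        by (rule has_contour_integral_bound_linepath[OF D' _ nb]) (use B in auto)
      also have "-\<i> * of_real R - \<i> * of_real R = - (2 * \<i> * of_real R)" by simp
      also have "norm \<dots> = 2 * R" using R by (simp only: norm_minus_cancel norm_mult) simp
      finally have 1: "norm (?E - ?l * ?I) \<le> B * (2 * R)" .
      have "norm ?E \<le> norm (H (-\<i> * of_real R)) + norm (H (\<i> * of_real R))"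
        using N by (intro order_trans[OF norm_triangle_ineq4]) (simp add: norm_mult normP)
      then have "norm (?l * ?I) \<le> M"
        using 1 norm_triangle_ineq3[of "?l * ?I" ?E] unfolding M_def by (simp add: norm_minus_commute)
      then show ?thesis using lnN by (simp add: norm_mult field_simps)
    qed
    \<comment> \<open>Here \<open>f - S N\<close> is the tail of the series; its size
      \<open>N powr (- Re z) / Re z\<close> is cancelled by \<open>N powr (Re z)\<close> and the
      kernel. The endpoints have \<open>Re z = 0\<close>, where the tail bound fails, and are left
      out as a finite exceptional set.\<close>
    have diff: "norm (contour_integral ?A (\<lambda>z. H z * ?P z - ?G z / z)) \<le> (2 * C / R^2) * R * (pi/2 - (-pi/2))"
    proof (rule contour_integral_bound_part_circlepath_strong[where k = "{\<i> * of_real R, -\<i> * of_real R}"])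
      show "(\<lambda>z. H z * ?P z - ?G z / z) contour_integrable_on ?A"
        using HPint Gint by (intro contour_integrable_diff)
      fix z assume z: "z \<in> path_image ?A - {\<i> * of_real R, -\<i> * of_real R}"
      then have zR: "norm z = R" and x: "Re z > 0" using reA[of z] pts[of z] by force+
      then have "z \<noteq> 0" using R by auto
      then have "H z * ?P z - ?G z / z = (f z - S N z) * ?P z * (?q z / z)"
        using U(4) by (simp add: H_def field_simps)
      also have "?q z / z = of_real (2 * Re z / R^2)" using newman_kernel[OF zR R] .
      finally have "norm (H z * ?P z - ?G z / z) = norm (f z - S N z) * real N powr Re z * (2 * Re z / R^2)"
        using x by (simp add: norm_mult norm_divide normP norm_power)
      also have "\<dots> \<le> (C * real N powr (- Re z) / Re z) * real N powr Re z * (2 * Re z / R^2)"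
        using x N unfolding S_def by (intro mult_right_mono norm_powr_tail_le[OF bd x _ f[OF x]]) auto
      also have "\<dots> = C * (real N powr (- Re z) * real N powr Re z) * (2 / R^2)"
        using x by (simp add: field_simps)
      also have "real N powr (- Re z) * real N powr Re z = 1" using N by (simp flip: powr_add)
      finally show "norm (H z * ?P z - ?G z / z) \<le> 2 * C / R^2" by (simp only: mult_1_right mult_1 times_divide_eq_right mult.commute[of C 2])
    qed (use C0 R in auto)
    \<comment> \<open>The finite sum \<open>S N\<close> is entire, so it can be followed around the
      left arc at full radius, while \<open>f\<close> is known to the left of the axis only close to
      it.\<close>
    have diffB: "norm (contour_integral ?B (\<lambda>z. ?G z / z)) \<le> (2 * C / R^2 + 2 * C / (R * real N)) * R * (3*pi/2 - pi/2)"
    proof (rule contour_integral_bound_part_circlepath_strong[where k = "{\<i> * of_real R, -\<i> * of_real R}", OF Gint(2)])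
      fix z assume z: "z \<in> path_image ?B - {\<i> * of_real R, -\<i> * of_real R}"
      then have zR: "norm z = R" and x: "Re z < 0" using reB[of z] pts[of z] by force+
      define y where "y = - Re z"
      have y: "y > 0" "y \<le> R" using x zR abs_Re_le_cmod[of z] by (auto simp: y_def)
      have "?G z / z = S N z * ?P z * (?q z / z)" by simp
      also have "?q z / z = of_real (2 * Re z / R^2)" using newman_kernel[OF zR R] .
      finally have e: "norm (?G z / z) = norm (S N z) * real N powr (-y) * (2 * y / R^2)"
        using x by (simp add: norm_mult norm_divide normP norm_power y_def)
      have "norm (S N z) \<le> (\<Sum>n=1..N. C * real n powr (y - 1))"
        unfolding S_def
      proof (rule sum_norm_le)
        fix n assume "n \<in> {1..N}"
        then have "norm (of_nat n powr (-1-z)) = real n powr (y - 1)"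
          by (subst norm_powr_real_powr) (auto simp: y_def intro!: arg_cong2[where f = "(powr)"])
        then show "norm (a n * of_nat n powr (-1-z)) \<le> C * real n powr (y - 1)"
          using bd[of n] by (simp add: norm_mult mult_right_mono)
      qed
      also have "\<dots> \<le> C * (real N powr y / y + real N powr (y - 1))"
        unfolding sum_distrib_left[symmetric] using C0 N by (intro mult_left_mono sum_powr_le y(1)) auto
      finally have "norm (?G z / z) \<le> C * (real N powr y / y + real N powr (y - 1)) * real N powr (-y) * (2 * y / R^2)"
        unfolding e using y by (intro mult_right_mono) auto
      also have "\<dots> = C * ((real N powr y * real N powr (-y)) / y + real N powr (y - 1) * real N powr (-y)) * (2 * y / R^2)"
        by (simp add: algebra_simps)
      also have "\<dots> = C * (1 / y + 1 / real N) * (2 * y / R^2)"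
      proof -
        have "real N powr (y - 1) * real N powr (-y) = 1 / real N" "real N powr y * real N powr (-y) = 1"
          using N powr_minus_divide[of "real N" 1] by (simp_all flip: powr_add)
        then show ?thesis by simp
      qed
      also have "\<dots> = 2 * C / R^2 + (2 * C / real N) * (y / R^2)" using y by (simp add: field_simps)
      also have "\<dots> \<le> 2 * C / R^2 + (2 * C / real N) * (1 / R)"
        using y R C0 by (intro add_left_mono mult_left_mono) (auto simp: field_simps power2_eq_square)
      finally show "norm (?G z / z) \<le> 2 * C / R^2 + 2 * C / (R * real N)" by (simp add: mult.commute)
    qed (use C0 R in auto)
    have tri: "norm (p - q + r) \<le> norm p + norm q + norm r" for p q r :: complex
      using norm_triangle_ineq[of "p - q" r] norm_triangle_ineq4[of p q] by linarith
    have "2 * of_real pi * \<i> * S N 0 = contour_integral ?A (\<lambda>z. H z * ?P z) - contour_integral ?A (\<lambda>z. H z * ?P z - ?G z / z)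
        + contour_integral ?B (\<lambda>z. ?G z / z)"
      unfolding two[symmetric] using HPint Gint by (subst contour_integral_diff) auto
    then have "norm (2 * of_real pi * \<i> * S N 0) \<le> norm (contour_integral ?A (\<lambda>z. H z * ?P z))
      + norm (contour_integral ?A (\<lambda>z. H z * ?P z - ?G z / z)) + norm (contour_integral ?B (\<lambda>z. ?G z / z))"
      by (simp only: tri)
    also have "\<dots> \<le> M / ln (real N) + (2 * C / R^2) * R * (pi/2 - (-pi/2)) + (2 * C / R^2 + 2 * C / (R * real N)) * R * (3*pi/2 - pi/2)"
      using parts diff diffB AL by (intro add_mono) auto
    also have "\<dots> = 4 * pi * C / R + 2 * pi * C / real N + M / ln (real N)"
      using R N by (simp add: field_simps power2_eq_square)
    finally show ?thesis by (simp add: norm_mult)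
  qed
  have "S N 0 = (\<Sum>n=1..N. a n / of_nat n)" for N
    unfolding S_def by (intro sum.cong) (auto simp: powr_minus_divide)
  then show ?thesis using main by auto
qed


theorem newman_tauberian:
  fixes a :: "nat \<Rightarrow> complex"
  assumes bd: "\<And>n. norm (a n) \<le> C"
    and U: "open U" "{s. Re s \<ge> 1} \<subseteq> U" "F holomorphic_on U"
    and F: "\<And>s. Re s > 1 \<Longrightarrow> (\<lambda>n. a n * of_nat n powr (-s)) sums F s"
  shows "(\<lambda>N. \<Sum>n=1..N. a n / of_nat n) \<longlonglongrightarrow> F 1"
proof -
  \<comment> \<open>Changing the coefficient at \<open>n = 1\<close> by \<open>F 1\<close> shifts
    the sum by a constant and arranges \<open>f 0 = 0\<close>, as \<open>newman_aux\<close>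
    requires.\<close>
  define b where "b n = (if n = 1 then a 1 - F 1 else a n)" for n
  define f where "f z = F (1 + z) - F 1" for z
  define C' where "C' = C + norm (F 1)"
  have C0: "C \<ge> 0" using order_trans[OF norm_ge_zero bd] .
  have bd': "norm (b n) \<le> C'" for n
    unfolding b_def C'_def using bd[of n] bd[of 1] norm_triangle_ineq4[of "a 1" "F 1"] by (auto simp: add_increasing2)
  have op: "open ((\<lambda>z. 1 + z) -` U)" by (intro open_vimage U continuous_intros)
  have hol: "f holomorphic_on ((\<lambda>z. 1 + z) -` U)"
    unfolding f_def
    by (intro holomorphic_intros holomorphic_on_compose_gen[of "\<lambda>z. 1 + z" _ F U, OF _ U(3), unfolded o_def]) auto
  have sums: "(\<lambda>n. b n * of_nat n powr (-1-z)) sums f z" if "Re z > 0" for z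
  proof -
    have "(\<lambda>n. a n * of_nat n powr (-(1+z)) - (if n = 1 then F 1 else 0)) sums (F (1+z) - F 1)"
      using that by (intro sums_diff F sums_If_finite_set[of "{1}" "\<lambda>_. F 1", simplified] sums_single) auto
    moreover have "a n * of_nat n powr (-(1+z)) - (if n = 1 then F 1 else 0) = b n * of_nat n powr (-1-z)" for n
      by (auto simp: b_def)
    ultimately show ?thesis by (simp add: f_def)
  qed
  have lim0: "(\<lambda>N. \<Sum>n=1..N. b n / of_nat n) \<longlonglongrightarrow> 0"
  proof (rule tendstoI)
    fix e :: real assume e: "e > 0"
    \<comment> \<open>Makes the term independent of \<open>N\<close> smaller than
      \<open>pi * e\<close>; the other two terms of the bound tend to 0.\<close>
    define R where "R = 4 * (C' + 1) / e"
    have C'0: "C' \<ge> 0" using order_trans[OF norm_ge_zero bd'] .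
    then have R: "R > 0" using e by (simp add: R_def)
    obtain M where M: "\<And>N. N \<ge> 2 \<Longrightarrow> 2 * pi * norm (\<Sum>n=1..N. b n / of_nat n) \<le> 4 * pi * C' / R + 2 * pi * C' / real N + M / ln (real N)"
    proof -
      have "{z. 0 \<le> Re z} \<subseteq> (\<lambda>z. 1 + z) -` U" using U(2) by (auto simp: subset_iff)
      then show ?thesis using newman_aux[OF bd' op _ hol _ sums R] that by (auto simp: f_def)
    qed
    have "4 * pi * C' / R < pi * e"
      using e C'0 by (simp add: R_def field_simps)
    moreover have "(\<lambda>N. 4 * pi * C' / R + 2 * pi * C' / real N + M / ln (real N)) \<longlonglongrightarrow> 4 * pi * C' / R + 0 + 0"
      by (intro tendsto_add tendsto_const real_tendsto_divide_at_top[OF tendsto_const] filterlim_real_sequentially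
           filterlim_compose[OF ln_at_top])
    ultimately have "\<forall>\<^sub>F N in sequentially. 4 * pi * C' / R + 2 * pi * C' / real N + M / ln (real N) < pi * e"
      by (intro order_tendstoD(2)) auto
    then show "\<forall>\<^sub>F N in sequentially. dist (\<Sum>n=1..N. b n / of_nat n) 0 < e"
      using eventually_ge_at_top[of 2]
    proof eventually_elim
      case (elim N)
      then have "2 * pi * norm (\<Sum>n=1..N. b n / of_nat n) < pi * e" using M[of N] by linarith
      then have "pi * (2 * norm (\<Sum>n=1..N. b n / of_nat n)) < pi * e" by (simp add: mult_ac)
      then have "2 * norm (\<Sum>n=1..N. b n / of_nat n) < e" by (simp only: mult_less_cancel_left_pos[OF pi_gt_zero])
      then show ?case unfolding dist_0_norm dist_commute[of _ 0] using norm_ge_zero[of "\<Sum>n=1..N. b n / of_nat n"] by linarith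
    qed
  qed
  have "(\<lambda>N. (\<Sum>n=1..N. b n / of_nat n) + F 1) \<longlonglongrightarrow> 0 + F 1" by (intro tendsto_intros lim0)
  moreover have "\<forall>\<^sub>F N in sequentially. (\<Sum>n=1..N. b n / of_nat n) + F 1 = (\<Sum>n=1..N. a n / of_nat n)"
    using eventually_ge_at_top[of 1]
  proof eventually_elim
    case (elim N)
    have "{1..N} = insert 1 {2..N}" using elim by auto
    moreover have "(\<Sum>n=2..N. b n / of_nat n) = (\<Sum>n=2..N. a n / of_nat n)"
      by (intro sum.cong) (auto simp: b_def)
    ultimately show ?case by (simp add: b_def)
  qed
  ultimately have "(\<lambda>N. \<Sum>n=1..N. a n / of_nat n) \<longlonglongrightarrow> 0 + F 1" by (rule Lim_transform_eventually)
  then show ?thesis by simp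
qed

section \<open>Dirichlet characters\<close>

text \<open>Periodic functions on the naturals, extended by zero, so that they serve directly as
  coefficients. For \<open>g = 1\<close> the conditions force the value 1 also at
  \<open>n = 0\<close>, which is harmless because \<open>0 powr z = 0\<close>.\<close>

definition dchars :: "nat \<Rightarrow> (nat \<Rightarrow> complex) set" where
  "dchars g = {\<phi>. \<phi> 1 = 1 \<and> (\<forall>m n. \<phi> (m * n) = \<phi> m * \<phi> n) \<and> (\<forall>n. \<phi> (n + g) = \<phi> n) \<and> (\<forall>n. \<not> coprime n g \<longrightarrow> \<phi> n = 0)}"

definition principal_char :: "nat \<Rightarrow> nat \<Rightarrow> complex" where
  "principal_char g n = (if coprime n g then 1 else 0)"

lemma dcharsD:
  assumes "\<phi> \<in> dchars g"
  shows "\<phi> 1 = 1" "\<phi> (Suc 0) = 1" "\<phi> (m * n) = \<phi> m * \<phi> n" "\<phi> (n + g) = \<phi> n" "\<not> coprime n g \<Longrightarrow> \<phi> n = 0"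
  using assms by (auto simp: dchars_def)

lemma dchars_power: "\<phi> \<in> dchars g \<Longrightarrow> \<phi> (n ^ k) = \<phi> n ^ k"
  by (induction k) (simp_all add: dcharsD)

lemma dchars_cong:
  assumes "\<phi> \<in> dchars g" "[m = n] (mod g)"
  shows "\<phi> m = \<phi> n"
proof -
  have *: "\<phi> (k + j * g) = \<phi> k" for k j
    by (induction j) (simp_all add: dcharsD(4)[OF assms(1)] add.assoc[symmetric] add.commute[of g])
  have "\<phi> m = \<phi> (m mod g)" for m
    using *[of "m mod g" "m div g"] by simp
  then show ?thesis using assms(2) by (metis cong_def)
qed

lemma dchars_unit_power:
  assumes "\<phi> \<in> dchars g" "coprime n g"
  shows "\<phi> n ^ totient g = 1"
  using dchars_cong[OF assms(1) euler_theorem[OF assms(2)]] dchars_power[OF assms(1)] dcharsD(1)[OF assms(1)] by metis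

lemma norm_dchars_coprime:
  assumes "\<phi> \<in> dchars g" "coprime n g" "g > 0"
  shows "norm (\<phi> n) = 1"
proof -
  have "norm (\<phi> n) ^ totient g = 1" using dchars_unit_power[OF assms(1,2)] by (metis norm_one norm_power)
  then show ?thesis using assms(3) power_eq_imp_eq_base[of "norm (\<phi> n)" "totient g" 1] by simp
qed

lemma norm_dchars_le: "\<phi> \<in> dchars g \<Longrightarrow> g > 0 \<Longrightarrow> norm (\<phi> n) \<le> 1"
  using norm_dchars_coprime[of \<phi> g n] dcharsD(5)[of \<phi> g n] by fastforce

lemma coprime_add_modulus: "coprime (n + g) g \<longleftrightarrow> coprime n (g::nat)"
  by (metis coprime_iff_gcd_eq_1 gcd_add1)

lemma principal_dchars: "principal_char g \<in> dchars g"
  by (simp add: dchars_def principal_char_def coprime_add_modulus)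

lemma cnj_dchars: "\<phi> \<in> dchars g \<Longrightarrow> (\<lambda>n. cnj (\<phi> n)) \<in> dchars g"
  by (auto simp: dchars_def)

lemma mult_dchars: "\<phi> \<in> dchars g \<Longrightarrow> \<psi> \<in> dchars g \<Longrightarrow> (\<lambda>n. \<phi> n * \<psi> n) \<in> dchars g"
  by (auto simp: dchars_def mult_ac)

text \<open>A character is determined by its values below \<open>g\<close>, each of which is 0 or a
  root of unity of order dividing \<open>totient g\<close>.\<close>

lemma finite_dchars:
  assumes g: "g > 0"
  shows "finite (dchars g)"
proof -
  let ?Z = "insert 0 {z::complex. z ^ totient g = 1}"
  let ?r = "\<lambda>\<phi>::nat \<Rightarrow> complex. restrict \<phi> {..<g}"
  have fin: "finite ?Z" using g finite_roots_unity[of "totient g"] by (auto simp: Suc_leI)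
  have "?r ` dchars g \<subseteq> PiE {..<g} (\<lambda>_. ?Z)"
  proof (rule image_subsetI)
    fix \<phi> assume "\<phi> \<in> dchars g"
    then have "\<phi> n \<in> ?Z" for n
      using dchars_unit_power[of \<phi> g n] dcharsD(5)[of \<phi> g n] by (cases "coprime n g") auto
    then show "?r \<phi> \<in> PiE {..<g} (\<lambda>_. ?Z)" by auto
  qed
  moreover have "finite (PiE {..<g} (\<lambda>_. ?Z))" by (intro finite_PiE fin) auto
  ultimately have "finite (?r ` dchars g)" by (rule finite_subset)
  moreover have "inj_on ?r (dchars g)"
  proof (rule inj_onI, rule ext)
    fix \<phi> \<psi> n assume *: "\<phi> \<in> dchars g" "\<psi> \<in> dchars g" "?r \<phi> = ?r \<psi>"
    have "\<phi> (n mod g) = \<psi> (n mod g)" using fun_cong[OF *(3), of "n mod g"] g by simp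
    moreover have "\<phi> (n mod g) = \<phi> n" "\<psi> (n mod g) = \<psi> n"
      using dchars_cong *(1,2) by (auto intro!: dchars_cong simp: cong_def)
    ultimately show "\<phi> n = \<psi> n" by simp
  qed
  ultimately show ?thesis by (rule finite_imageD)
qed

text \<open>Characters of subgroups of the unit group, where a subgroup is represented by the set of all
  naturals whose residue lies in it; \<open>b\<close> is adjoined by sending it to a suitable root \<open>z\<close>.\<close>

definition subchar :: "nat \<Rightarrow> nat set \<Rightarrow> (nat \<Rightarrow> complex) \<Rightarrow> bool" where
  "subchar g H \<psi> \<longleftrightarrow> H \<subseteq> {n. coprime n g} \<and> 1 \<in> H \<and> (\<forall>m\<in>H. \<forall>n\<in>H. m * n \<in> H \<and> \<psi> (m * n) = \<psi> m * \<psi> n)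
     \<and> (\<forall>m\<in>H. \<forall>n. [m = n] (mod g) \<longrightarrow> n \<in> H \<and> \<psi> n = \<psi> m) \<and> \<psi> 1 = 1"

lemma subcharD:
  assumes "subchar g H \<psi>"
  shows "m \<in> H \<Longrightarrow> coprime m g" "1 \<in> H" "\<psi> 1 = 1" "m \<in> H \<Longrightarrow> n \<in> H \<Longrightarrow> m * n \<in> H"
    "m \<in> H \<Longrightarrow> n \<in> H \<Longrightarrow> \<psi> (m * n) = \<psi> m * \<psi> n" "m \<in> H \<Longrightarrow> [m = n] (mod g) \<Longrightarrow> n \<in> H"
    "m \<in> H \<Longrightarrow> [m = n] (mod g) \<Longrightarrow> \<psi> n = \<psi> m"
  using assms unfolding subchar_def by blast+

lemma subchar_power:
  assumes "subchar g H \<psi>" "m \<in> H"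
  shows "m ^ k \<in> H \<and> \<psi> (m ^ k) = \<psi> m ^ k"
proof (induction k)
  case 0
  then show ?case using subcharD(2,3)[OF assms(1)] by simp
next
  case (Suc k)
  then show ?case using subcharD(4,5)[OF assms(1,2), of "m ^ k"] by simp
qed

text \<open>By Euler's theorem the power \<open>m ^ (totient g - 1)\<close> acts as an inverse of
  \<open>m\<close> inside \<open>H\<close>.\<close>

lemma subchar_divide:
  assumes sc: "subchar g H \<psi>" and "g > 0" "m \<in> H" "m * n \<in> H"
  shows "n \<in> H"
proof -
  have "[m ^ totient g * n = 1 * n] (mod g)"
    by (intro cong_mult euler_theorem subcharD(1)[OF sc] assms) auto
  moreover have "m ^ totient g * n = m ^ (totient g - 1) * (m * n)"
    using \<open>g > 0\<close> by (cases "totient g") (auto simp: mult_ac)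
  moreover have "m ^ (totient g - 1) * (m * n) \<in> H"
    using subchar_power[OF sc \<open>m \<in> H\<close>] assms(4) subcharD(4)[OF sc, of "m ^ (totient g - 1)" "m * n"] by blast
  ultimately show ?thesis using subcharD(6)[OF sc, of "m ^ totient g * n" n] by (metis mult_1)
qed

lemma subchar_power_dvd:
  assumes sc: "subchar g H \<psi>" and g: "g > 0" and k: "k > 0" "b ^ k \<in> H" "\<And>j. 0 < j \<Longrightarrow> j < k \<Longrightarrow> b ^ j \<notin> H"
    and "b ^ m \<in> H"
  shows "k dvd m"
proof -
  have "b ^ m = (b ^ k) ^ (m div k) * b ^ (m mod k)"
    by (simp flip: power_mult power_add)
  then have "b ^ (m mod k) \<in> H"
    using subchar_divide[OF sc g, of "(b ^ k) ^ (m div k)"] subchar_power[OF sc k(2)] assms by metis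
  then have "m mod k = 0" using k by (meson mod_less_divisor not_gr_zero)
  then show ?thesis by auto
qed

text \<open>\<open>k\<close> is the order of \<open>b\<close> modulo \<open>H\<close>, so
  \<open>h * b ^ i = h' * b ^ j\<close> modulo \<open>g\<close> forces \<open>k\<close> to divide
  \<open>i - j\<close>; with \<open>z ^ k = \<psi> (b ^ k)\<close> the value
  \<open>\<psi> h * z ^ i\<close> is then independent of the representation. The root
  \<open>z\<close> is left free so that separation can choose one different from 1.\<close>

lemma subchar_extend:
  assumes sc: "subchar g H \<psi>" and g: "g > 0" and b: "coprime b g"
    and k: "k > 0" "b ^ k \<in> H" "\<And>j. 0 < j \<Longrightarrow> j < k \<Longrightarrow> b ^ j \<notin> H"
    and z: "z ^ k = \<psi> (b ^ k)"
  shows "\<exists>H' \<psi>'. subchar g H' \<psi>' \<and> H \<subseteq> H' \<and> b \<in> H' \<and> (\<forall>m\<in>H. \<psi>' m = \<psi> m) \<and> \<psi>' b = z"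
proof -
  define H' where "H' = {n. \<exists>h\<in>H. \<exists>i. [n = h * b ^ i] (mod g)}"
  have wd: "\<psi> h * z ^ i = \<psi> h' * z ^ j" if "h \<in> H" "h' \<in> H" "[h * b ^ i = h' * b ^ j] (mod g)" "j \<le> i" for h h' i j
  proof -
    have "[(h * b ^ (i - j)) * b ^ j = h' * b ^ j] (mod g)"
      using that by (simp add: mult.assoc flip: power_add)
    then have c: "[h * b ^ (i - j) = h'] (mod g)"
      using b by (simp add: cong_mult_rcancel_nat)
    then have mem: "h * b ^ (i - j) \<in> H" using subcharD(6)[OF sc that(2)] by (simp add: cong_sym_eq)
    then have bij: "b ^ (i - j) \<in> H" using subchar_divide[OF sc g that(1)] by simp
    then have "k dvd i - j" using subchar_power_dvd[OF sc g k] by simp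
    then obtain q where q: "i - j = k * q" by auto
    have "\<psi> (b ^ (i - j)) = z ^ (i - j)"
      unfolding q power_mult using subchar_power[OF sc k(2), of q] z by simp
    moreover have "\<psi> h' = \<psi> h * \<psi> (b ^ (i - j))"
      using subcharD(7)[OF sc mem c] subcharD(5)[OF sc that(1) bij] by simp
    ultimately show ?thesis using that(4) by (simp flip: power_add)
  qed
  then have wd': "\<psi> h * z ^ i = \<psi> h' * z ^ j" if "h \<in> H" "h' \<in> H" "[h * b ^ i = h' * b ^ j] (mod g)" for h h' i j
    using that by (metis cong_sym nle_le)
  define \<psi>' where "\<psi>' n = (SOME v. \<exists>h\<in>H. \<exists>i. [n = h * b ^ i] (mod g) \<and> v = \<psi> h * z ^ i)" for n
  have \<psi>': "\<psi>' n = \<psi> h * z ^ i" if "h \<in> H" "[n = h * b ^ i] (mod g)" for n h i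
  proof -
    have "\<exists>h\<in>H. \<exists>i. [n = h * b ^ i] (mod g) \<and> \<psi>' n = \<psi> h * z ^ i"
      unfolding \<psi>'_def by (rule someI[where x = "\<psi> h * z ^ i"]) (use that in blast)
    then obtain h' j where h': "h' \<in> H" "[n = h' * b ^ j] (mod g)" "\<psi>' n = \<psi> h' * z ^ j" by blast
    then show ?thesis using wd'[of h' h j i] that by (metis cong_sym cong_trans)
  qed
  have "subchar g H' \<psi>'"
    unfolding subchar_def
  proof (intro conjI ballI allI impI subsetI)
    fix n assume "n \<in> H'"
    then obtain h i where "h \<in> H" "[n = h * b ^ i] (mod g)" unfolding H'_def by blast
    moreover have "coprime (h * b ^ i) g" using b subcharD(1)[OF sc \<open>h \<in> H\<close>] by simp
    ultimately show "n \<in> {n. coprime n g}" using cong_imp_coprime cong_sym by blast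
  next
    show "1 \<in> H'" unfolding H'_def using subcharD(2)[OF sc] by (auto intro!: bexI[of _ 1] exI[of _ 0])
    show "\<psi>' 1 = 1" using \<psi>'[of 1 1 0] subcharD(2,3)[OF sc] by simp
  next
    fix m n assume "m \<in> H'" "n \<in> H'"
    then obtain h i h' j where *: "h \<in> H" "[m = h * b ^ i] (mod g)" "h' \<in> H" "[n = h' * b ^ j] (mod g)" unfolding H'_def by blast
    have "[m * n = (h * b ^ i) * (h' * b ^ j)] (mod g)" using * by (intro cong_mult)
    then have c: "[m * n = (h * h') * b ^ (i + j)] (mod g)" by (simp add: power_add mult_ac)
    have hh: "h * h' \<in> H" using * subcharD(4)[OF sc] by blast
    then show "m * n \<in> H'" unfolding H'_def using c by blast
    show "\<psi>' (m * n) = \<psi>' m * \<psi>' n"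
      using \<psi>'[OF hh c] \<psi>'[OF *(1,2)] \<psi>'[OF *(3,4)] subcharD(5)[OF sc *(1,3)] by (simp add: power_add)
  next
    fix m n assume "m \<in> H'" "[m = n] (mod g)"
    then obtain h i where *: "h \<in> H" "[m = h * b ^ i] (mod g)" unfolding H'_def by blast
    then have c: "[n = h * b ^ i] (mod g)" using \<open>[m = n] (mod g)\<close> by (metis cong_sym cong_trans)
    then show "n \<in> H'" unfolding H'_def using * by blast
    show "\<psi>' n = \<psi>' m" using \<psi>'[OF *] \<psi>'[OF *(1) c] by simp
  qed
  moreover have "H \<subseteq> H'" unfolding H'_def by (force intro!: exI[of _ 0])
  moreover have "b \<in> H'" unfolding H'_def using subcharD(2)[OF sc] by (auto intro!: bexI[of _ 1] exI[of _ 1])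
  moreover have "\<forall>m\<in>H. \<psi>' m = \<psi> m" using \<psi>'[of _ _ 0] by simp
  moreover have "\<psi>' b = z" using \<psi>'[of 1 b 1] subcharD(2,3)[OF sc] by simp
  ultimately show ?thesis by blast
qed

lemma subchar_first_power:
  assumes sc: "subchar g H \<psi>" and b: "coprime b g" and g: "g > 0"
  obtains k where "k > 0" "b ^ k \<in> H" "\<And>j. 0 < j \<Longrightarrow> j < k \<Longrightarrow> b ^ j \<notin> H"
proof -
  let ?P = "\<lambda>k. k > 0 \<and> b ^ k \<in> H"
  have "[1 = b ^ totient g] (mod g)" using euler_theorem[OF b] by (rule cong_sym)
  then have "?P (totient g)" using subcharD(2)[OF sc] subcharD(6)[OF sc] g by fastforce
  then have "?P (LEAST k. ?P k)" by (rule LeastI)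
  moreover have "\<not> ?P j" if "j < (LEAST k. ?P k)" for j using not_less_Least[OF that] .
  ultimately show ?thesis using that by blast
qed

text \<open>Each step adjoins one missing unit and increases the number of residues below
  \<open>g\<close> in the subgroup, which is at most \<open>g\<close>.\<close>

lemma subchar_extend_all:
  assumes g: "g > 0" and sc: "subchar g H \<psi>"
  shows "\<exists>\<psi>'. subchar g {n. coprime n g} \<psi>' \<and> (\<forall>m\<in>H. \<psi>' m = \<psi> m)"
  using sc
proof (induction "g - card (H \<inter> {..<g})" arbitrary: H \<psi> rule: less_induct)
  case less
  show ?case
  proof (cases "H = {n. coprime n g}")
    case True then show ?thesis using less.prems by blast
  next
    case False
    then obtain b where b: "coprime b g" "b \<notin> H" using subcharD(1)[OF less.prems] by blast
    obtain k where k: "k > 0" "b ^ k \<in> H" "\<And>j. 0 < j \<Longrightarrow> j < k \<Longrightarrow> b ^ j \<notin> H"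
      using subchar_first_power[OF less.prems b(1) g] by metis
    obtain z where z: "z ^ k = \<psi> (b ^ k)" using k(1) by (metis exists_complex_root not_gr_zero)
    obtain H' \<psi>' where H': "subchar g H' \<psi>'" "H \<subseteq> H'" "b \<in> H'" "\<forall>m\<in>H. \<psi>' m = \<psi> m"
      using subchar_extend[where z = z, OF less.prems g b(1) k z] by blast
    have c: "[b = b mod g] (mod g)" by (simp add: cong_def)
    have "b mod g \<notin> H" using b(2) subcharD(6)[OF less.prems, of "b mod g" b] c by (auto simp: cong_sym_eq)
    moreover have "b mod g \<in> H'" using subcharD(6)[OF H'(1,3) c] .
    ultimately have "H \<inter> {..<g} \<subset> H' \<inter> {..<g}" using H'(2) g by auto
    then have "card (H \<inter> {..<g}) < card (H' \<inter> {..<g})" by (intro psubset_card_mono) auto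
    moreover have "card (H' \<inter> {..<g}) \<le> g" using card_mono[of "{..<g}" "H' \<inter> {..<g}"] by simp
    ultimately have "g - card (H' \<inter> {..<g}) < g - card (H \<inter> {..<g})" by linarith
    from less.hyps[OF this H'(1)] show ?thesis using H'(2,4) by (metis subsetD)
  qed
qed

text \<open>To the trivial character of the trivial subgroup, \<open>a\<close> is adjoined with a
  primitive \<open>k\<close>-th root of unity as its value, where \<open>k\<close> is the order of
  \<open>a\<close>; \<open>k > 1\<close> makes this value different from 1.\<close>

lemma dchars_separate:
  assumes g: "g > 0" and a: "coprime a g" "\<not> [a = 1] (mod g)"
  shows "\<exists>\<phi>\<in>dchars g. \<phi> a \<noteq> 1"
proof -
  let ?H = "{n. [n = 1] (mod g)}"
  have sc: "subchar g ?H (\<lambda>_. 1)"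
    unfolding subchar_def
  proof (intro conjI ballI allI impI subsetI)
    fix n assume "n \<in> ?H" then show "n \<in> {n. coprime n g}" using cong_imp_coprime[of 1 n g] by (auto simp: cong_sym_eq)
  next
    fix m n assume "m \<in> ?H" "n \<in> ?H" then show "m * n \<in> ?H" using cong_mult[of m 1 g n 1] by simp
  next
    fix m n assume "m \<in> ?H" "[m = n] (mod g)" then show "n \<in> ?H" by (metis cong_sym cong_trans mem_Collect_eq)
  qed auto
  obtain k where k: "k > 0" "a ^ k \<in> ?H" "\<And>j. 0 < j \<Longrightarrow> j < k \<Longrightarrow> a ^ j \<notin> ?H"
    using subchar_first_power[OF sc a(1) g] by metis
  have "k \<noteq> 1" using k(2) a(2) by auto
  define z where "z = cis (2 * pi / real k)"
  have zk: "z ^ k = 1" using k(1) by (simp add: z_def Complex.DeMoivre)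
  have z1: "z \<noteq> 1"
  proof
    assume "z = 1"
    then have "cos (2 * pi / real k) = 1" by (simp add: z_def complex_eq_iff)
    then obtain n :: int where "2 * pi / real k = n * 2 * pi" by (auto simp: cos_one_2pi_int)
    then have "2 * pi * (1 / real k) = 2 * pi * n" by simp
    then have e: "1 / real k = n" by (subst (asm) mult_cancel_left) auto
    moreover have "0 < 1 / real k" "1 / real k < 1" using k(1) \<open>k \<noteq> 1\<close> by auto
    ultimately show False by auto
  qed
  obtain H' \<psi>' where H': "subchar g H' \<psi>'" "a \<in> H'" "\<psi>' a = z"
    using subchar_extend[where z = z, OF sc g a(1) k] zk by auto
  obtain \<psi> where \<psi>: "subchar g {n. coprime n g} \<psi>" "\<psi> a = z"
    using subchar_extend_all[OF g H'(1)] H' by auto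
  define \<phi> where "\<phi> n = (if coprime n g then \<psi> n else 0)" for n
  have "\<phi> \<in> dchars g"
    unfolding dchars_def mem_Collect_eq
  proof (intro conjI allI impI)
    fix n
    have "[n = n + g] (mod g)" by (simp add: cong_def)
    then show "\<phi> (n + g) = \<phi> n" using subcharD(7)[OF \<psi>(1), of n "n + g"] by (simp add: \<phi>_def coprime_add_modulus)
  qed (use subcharD(3,5)[OF \<psi>(1)] in \<open>auto simp: \<phi>_def\<close>)
  then show ?thesis using \<psi>(2) z1 a by (auto simp: \<phi>_def intro!: bexI[of _ \<phi>])
qed

section \<open>Orthogonality and sums over periods\<close>

lemma dchars_orthogonal:
  assumes g: "g > 0"
  shows "(\<Sum>\<phi>\<in>dchars g. \<phi> a) = (if [a = 1] (mod g) then of_nat (card (dchars g)) else 0)"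
proof (cases "[a = 1] (mod g)")
  case True
  then have "\<phi> a = 1" if "\<phi> \<in> dchars g" for \<phi> using dchars_cong[OF that] dcharsD(1)[OF that] by metis
  then have "(\<Sum>\<phi>\<in>dchars g. \<phi> a) = (\<Sum>\<phi>\<in>dchars g. 1)" by (intro sum.cong) auto
  then show ?thesis using True by simp
next
  case False
  show ?thesis
  proof (cases "coprime a g")
    case True
    then obtain \<xi> where \<xi>: "\<xi> \<in> dchars g" "\<xi> a \<noteq> 1" using dchars_separate[OF g _ False] by blast
    \<comment> \<open>Multiplication by \<xi> permutes the characters, so the sum equals
      \<open>\<xi> a\<close> times itself.\<close>
    let ?m = "\<lambda>\<phi> n. \<xi> n * \<phi> n :: complex"
    have inj: "inj_on ?m (dchars g)"
    proof (rule inj_onI, rule ext)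
      fix \<phi> \<psi> n assume *: "\<phi> \<in> dchars g" "\<psi> \<in> dchars g" "?m \<phi> = ?m \<psi>"
      show "\<phi> n = \<psi> n"
        using fun_cong[OF *(3), of n] norm_dchars_coprime[OF \<xi>(1) _ g, of n] dcharsD(5)[OF *(1)] dcharsD(5)[OF *(2)]
        by (cases "coprime n g") auto
    qed
    have "?m ` dchars g \<subseteq> dchars g" using mult_dchars[OF \<xi>(1)] by auto
    then have im: "?m ` dchars g = dchars g" using finite_dchars[OF g] inj by (intro endo_inj_surj)
    have "(\<Sum>\<phi>\<in>dchars g. \<phi> a) = (\<Sum>\<phi>\<in>?m ` dchars g. \<phi> a)" by (simp add: im)
    also have "\<dots> = \<xi> a * (\<Sum>\<phi>\<in>dchars g. \<phi> a)" by (subst sum.reindex[OF inj]) (simp add: sum_distrib_left)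
    finally show ?thesis using \<xi> False by simp
  next
    case notcop: False
    then show ?thesis using \<open>\<not> [a = 1] (mod g)\<close> by (simp add: dcharsD(5))
  qed
qed

text \<open>Full periods cancel and less than one period remains; the extra 1 in the constant pays
  for starting at 1 instead of 0.\<close>

lemma periodic_sum_bounded:
  fixes f :: "nat \<Rightarrow> complex"
  assumes per: "\<And>n. f (n + g) = f n" and z: "(\<Sum>k<g. f k) = 0" and bd: "\<And>n. norm (f n) \<le> C" and g: "g > 0"
  shows "norm (\<Sum>k=1..n. f k) \<le> C * (real g + 1)"
proof -
  have C0: "C \<ge> 0" using order_trans[OF norm_ge_zero bd] .
  have per': "f (k + j * g) = f k" for k j
    by (induction j) (simp_all add: per add.assoc[symmetric] add.commute[of g])
  have blk: "(\<Sum>k<q * g + r. f k) = (\<Sum>k<r. f k)" for q r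
  proof (induction q)
    case (Suc q)
    have "(\<Sum>k<Suc q * g + r. f k) = (\<Sum>k<g. f k) + (\<Sum>k<q * g + r. f (k + g))"
      using sum.atLeastLessThan_concat[of 0 g "Suc q * g + r" f] sum.shift_bounds_nat_ivl[of f 0 g "q * g + r"]
      by (simp add: atLeast0LessThan add_ac)
    then show ?case using Suc z per by simp
  qed simp
  have "(\<Sum>k=1..n. f k) = (\<Sum>k<Suc n. f k) - f 0"
    by (simp add: sum.atMost_shift lessThan_Suc_atMost sum.atLeast1_atMost_eq del: sum.lessThan_Suc)
  also have "(\<Sum>k<Suc n. f k) = (\<Sum>k<Suc n mod g. f k)" using blk[of "Suc n div g" "Suc n mod g"] by simp
  finally have "norm (\<Sum>k=1..n. f k) \<le> norm (\<Sum>k<Suc n mod g. f k) + norm (f 0)" by (metis norm_triangle_ineq4)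
  also have "\<dots> \<le> real (Suc n mod g) * C + C"
    using bd by (intro add_mono sum_norm_bound[of "{..<Suc n mod g}", simplified]) auto
  also have "\<dots> \<le> real g * C + C" using C0 g by (intro add_mono mult_right_mono) (auto intro: less_imp_le)
  finally show ?thesis by (simp add: algebra_simps)
qed

lemma dchars_nonprincipal_sum:
  assumes \<phi>: "\<phi> \<in> dchars g" "\<phi> \<noteq> principal_char g" and g: "g > 0"
  shows "(\<Sum>k<g. \<phi> k) = 0"
proof -
  obtain b where b: "coprime b g" "\<phi> b \<noteq> 1"
    using \<phi> dcharsD(5)[OF \<phi>(1)] by (auto simp: principal_char_def fun_eq_iff split: if_splits)
  let ?m = "\<lambda>k. b * k mod g"
  have inj: "inj_on ?m {..<g}"
  proof (rule inj_onI)
    fix x y assume *: "x \<in> {..<g}" "y \<in> {..<g}" "?m x = ?m y"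
    then have "[b * x = b * y] (mod g)" by (simp add: cong_def)
    then have "[x = y] (mod g)" using b(1) by (simp add: cong_mult_lcancel_nat)
    then show "x = y" using * by (simp add: cong_def)
  qed
  have im: "?m ` {..<g} = {..<g}" using g inj by (intro endo_inj_surj) auto
  have "(\<Sum>k<g. \<phi> k) = (\<Sum>k\<in>?m ` {..<g}. \<phi> k)" by (simp add: im)
  also have "\<dots> = (\<Sum>k<g. \<phi> (b * k mod g))" by (simp add: sum.reindex[OF inj])
  also have "\<dots> = (\<Sum>k<g. \<phi> b * \<phi> k)"
  proof (intro sum.cong refl)
    fix k
    have "\<phi> (b * k mod g) = \<phi> (b * k)" by (intro dchars_cong[OF \<phi>(1)]) (simp add: cong_def)
    then show "\<phi> (b * k mod g) = \<phi> b * \<phi> k" by (simp add: dcharsD(3)[OF \<phi>(1)])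
  qed
  also have "\<dots> = \<phi> b * (\<Sum>k<g. \<phi> k)" by (simp add: sum_distrib_left)
  finally show ?thesis using b(2) by simp
qed

section \<open>Divisor sums and the Chebyshev bound\<close>

text \<open>Absolute convergence over the pairs \<open>(d, e)\<close> permits grouping by the
  product \<open>n = d * e\<close>. Vanishing at zero arguments discards the pairs with product 0,
  in agreement with the inner sum at \<open>n = 0\<close>, which runs over all naturals but has only
  zero terms.\<close>

lemma sums_divisor_rearrange:
  fixes h :: "nat \<Rightarrow> nat \<Rightarrow> complex"
  assumes z: "\<And>e. h 0 e = 0" "\<And>d. h d 0 = 0"
    and abs: "\<And>d. summable (\<lambda>e. norm (h d e))" "summable (\<lambda>d. \<Sum>e. norm (h d e))"
    and G: "\<And>d. h d sums G d" "G sums S"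
  shows "(\<lambda>n. \<Sum>d | d dvd n. h d (n div d)) sums S"
proof -
  define H where "H = (\<lambda>(d, e). h d e)"
  have in1: "((\<lambda>e. norm (h d e)) has_sum (\<Sum>e. norm (h d e))) UNIV" for d
    using abs(1)[of d] by (intro norm_summable_imp_has_sum) (auto simp: summable_sums)
  then have inf: "infsum (\<lambda>e. norm (h d e)) UNIV = (\<Sum>e. norm (h d e))" for d by (rule infsumI)
  have "(\<lambda>x. norm (H x)) summable_on (UNIV \<times> UNIV)"
    unfolding Infinite_Sum.abs_summable_on_Sigma_iff H_def
  proof (intro conjI ballI)
    show "(\<lambda>y. norm (case (d, y) of (d, e) \<Rightarrow> h d e)) summable_on UNIV" for d
      using in1[of d] by (auto simp: summable_on_def)
    have "((\<lambda>d. \<Sum>e. norm (h d e)) has_sum (\<Sum>d. \<Sum>e. norm (h d e))) UNIV"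
      using abs by (intro norm_summable_imp_has_sum) (auto simp: summable_sums suminf_nonneg)
    then show "(\<lambda>x. norm (infsum (\<lambda>y. norm (case (x, y) of (d, e) \<Rightarrow> h d e)) UNIV)) summable_on UNIV"
      using abs(1) by (auto simp: inf summable_on_def suminf_nonneg)
  qed
  then obtain T where T: "(H has_sum T) (UNIV \<times> UNIV)"
    using abs_summable_summable by (auto simp: summable_on_def)
  have "(G has_sum T) UNIV"
    by (rule has_sum_SigmaD[OF T]) (use norm_summable_imp_has_sum[OF abs(1) G(1)] in \<open>auto simp: H_def\<close>)
  then have TS: "T = S" using has_sum_imp_sums G(2) sums_unique2 by blast
  have nz: "1 \<le> d \<and> 1 \<le> e" if "h d e \<noteq> 0" for d e
    using that z by (metis less_one linorder_le_less_linear)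
  have "(H has_sum S) ({1..} \<times> {1..})"
    using T unfolding TS by (subst (asm) has_sum_cong_neutral[where T = "{1..} \<times> {1..}" and g = H])
      (use nz in \<open>auto simp: H_def\<close>)
  also have "?this \<longleftrightarrow> ((\<lambda>(n, d). h d (n div d)) has_sum S) (SIGMA n:{1..}. {d. d dvd n})"
    by (rule has_sum_reindex_bij_witness[where i = "\<lambda>(n, d). (d, n div d)" and j = "\<lambda>(d, e). (d * e, d)"])
       (auto simp: H_def Suc_le_eq intro!: Nat.gr0I elim!: dvdE)
  finally have "((\<lambda>n. \<Sum>d | d dvd n. h d (n div d)) has_sum S) {1..}"
    by (rule has_sum_SigmaD) (auto intro!: has_sum_finite)
  then have "((\<lambda>n. \<Sum>d | d dvd n. h d (n div d)) has_sum S) UNIV"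
    by (subst (asm) has_sum_cong_neutral[where T = UNIV and g = "\<lambda>n. \<Sum>d | d dvd n. h d (n div d)"])
       (auto simp: not_less_eq_eq z)
  then show ?thesis by (rule has_sum_imp_sums)
qed

lemma nat_powr_mult: "of_nat m powr z * of_nat n powr z = (of_nat (m * n) powr z :: complex)"
  using powr_times_real[of "of_nat m" "of_nat n" z] by simp

lemma dirichlet_product:
  fixes a b :: "nat \<Rightarrow> complex"
  assumes a: "summable (\<lambda>n. norm (a n * of_nat n powr (-s)))" "(\<lambda>n. a n * of_nat n powr (-s)) sums A"
    and b: "summable (\<lambda>n. norm (b n * of_nat n powr (-s)))" "(\<lambda>n. b n * of_nat n powr (-s)) sums B"
  shows "(\<lambda>n. (\<Sum>d | d dvd n. a d * b (n div d)) * of_nat n powr (-s)) sums (A * B)"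
proof -
  define h where "h d e = (a d * of_nat d powr (-s)) * (b e * of_nat e powr (-s))" for d e
  have "(\<lambda>n. \<Sum>d | d dvd n. h d (n div d)) sums (A * B)"
  proof (rule sums_divisor_rearrange[where G = "\<lambda>d. (a d * of_nat d powr (-s)) * B"])
    show "summable (\<lambda>e. norm (h d e))" for d
      unfolding h_def norm_mult[of "a d * _"] by (intro summable_mult b)
    have "(\<Sum>e. norm (h d e)) = norm (a d * of_nat d powr (-s)) * (\<Sum>e. norm (b e * of_nat e powr (-s)))" for d
      unfolding h_def norm_mult[of "a d * _"] by (rule suminf_mult[OF b(1)])
    then show "summable (\<lambda>d. \<Sum>e. norm (h d e))"
      using summable_mult2[OF a(1)] by simp
    show "h d sums (a d * of_nat d powr (-s) * B)" for d
      unfolding h_def by (intro sums_mult b)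
    show "(\<lambda>d. a d * of_nat d powr (-s) * B) sums (A * B)" by (intro sums_mult2 a)
  qed (auto simp: h_def)
  moreover have "(\<Sum>d | d dvd n. h d (n div d)) = (\<Sum>d | d dvd n. a d * b (n div d)) * of_nat n powr (-s)" for n
    unfolding sum_distrib_right
  proof (rule sum.cong)
    fix d assume "d \<in> {d. d dvd n}"
    then have "h d (n div d) = a d * b (n div d) * (of_nat d powr (-s) * of_nat (n div d) powr (-s))"
      by (simp add: h_def)
    then show "h d (n div d) = a d * b (n div d) * of_nat n powr (-s)"
      using \<open>d \<in> _\<close> by (simp add: nat_powr_mult del: of_nat_mult)
  qed simp
  ultimately show ?thesis by simp
qed

section \<open>Chebyshev's estimate\<close>

lemma sum_ln_eq_sum_mangoldt: "(\<Sum>k=1..n. ln (real k)) = (\<Sum>d=1..n. mangoldt d * real (n div d))"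
proof -
  have "(\<Sum>k=1..n. ln (real k)) = (\<Sum>k=1..n. \<Sum>d | d dvd k. mangoldt d)"
    by (intro sum.cong) (auto simp: mangoldt_sum)
  also have "\<dots> = (\<Sum>k=1..n. \<Sum>d\<in>{d\<in>{1..n}. d dvd k}. mangoldt d)"
    by (intro sum.cong refl) (auto dest: dvd_imp_le intro!: Nat.gr0I simp: Suc_le_eq)
  also have "\<dots> = (\<Sum>d=1..n. \<Sum>k\<in>{k\<in>{1..n}. d dvd k}. mangoldt d)"
    by (rule sum.swap_restrict) auto
  also have "\<dots> = (\<Sum>d=1..n. mangoldt d * real (n div d))"
  proof (rule sum.cong)
    fix d assume d: "d \<in> {1..n}"
    have "{k\<in>{1..n}. d dvd k} = (\<lambda>j. d * j) ` {1..n div d}"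
      using d by (auto simp: image_iff div_mult_self_is_m less_eq_div_iff_mult_less_eq mult.commute elim!: dvdE intro!: Nat.gr0I)
    then have "card {k\<in>{1..n}. d dvd k} = n div d"
      using d by (simp add: card_image inj_on_def)
    then show "(\<Sum>k\<in>{k\<in>{1..n}. d dvd k}. mangoldt d) = mangoldt d * real (n div d)" by simp
  qed simp
  finally show ?thesis .
qed

text \<open>\<open>ln (2m choose m)\<close> is the sum of \<open>mangoldt d\<close> with weights
  \<open>2m div d - 2 (m div d)\<close>. These are never negative and are at least 1 for
  \<open>m < d \<le> 2m\<close>, while the binomial coefficient is at most
  \<open>4 ^ m\<close>.\<close>

lemma chebyshev_step: "(\<Sum>d=Suc m..2*m. mangoldt d) \<le> real m * ln 4"
proof -
  have cong: "(\<Sum>d=1..m. mangoldt d * real (m div d)) = (\<Sum>d=1..2*m. mangoldt d * real (m div d))"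
    by (rule sum.mono_neutral_left) auto
  have "(\<Sum>d=Suc m..2*m. mangoldt d) \<le> (\<Sum>d=Suc m..2*m. mangoldt d * (real (2*m div d) - 2 * real (m div d)))"
  proof (rule sum_mono)
    fix d assume "d \<in> {Suc m..2*m}"
    then have "2*m div d \<ge> 1" "m div d = 0" by (auto simp: Suc_le_eq div_greater_zero_iff)
    then show "mangoldt d \<le> mangoldt d * (real (2*m div d) - 2 * real (m div d))"
      using mult_left_mono[of 1 "real (2*m div d)" "mangoldt d"] mangoldt_nonneg[of d] by simp
  qed
  also have "\<dots> \<le> (\<Sum>d=1..2*m. mangoldt d * (real (2*m div d) - 2 * real (m div d)))"
  proof (rule sum_mono2)
    fix d
    have "2 * (m div d) \<le> 2 * m div d" by (cases "d = 0") (auto simp: less_eq_div_iff_mult_less_eq)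
    then show "mangoldt d * (real (2*m div d) - 2 * real (m div d)) \<ge> 0"
      by (intro mult_nonneg_nonneg mangoldt_nonneg) linarith
  qed auto
  also have "\<dots> = (\<Sum>k=1..2*m. ln (real k)) - 2 * (\<Sum>k=1..m. ln (real k))"
    unfolding sum_ln_eq_sum_mangoldt cong
    by (simp add: algebra_simps sum_subtractf sum_distrib_left)
  also have "\<dots> = ln (fact (2*m)) - 2 * ln (fact m)"
  proof -
    have "ln (fact n) = (\<Sum>k=1..n. ln (real k))" for n
      unfolding fact_prod of_nat_prod by (subst ln_prod) auto
    then show ?thesis by simp
  qed
  also have "\<dots> = ln (fact (2*m) / (fact m * fact m))"
    by (simp add: ln_div ln_mult)
  also have "(fact (2*m) / (fact m * fact m) :: real) = real ((2*m) choose m)"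
    by (simp add: binomial_fact mult_2)
  also have "ln \<dots> \<le> ln (4 ^ m)"
  proof -
    have "(2*m) choose m \<le> 2 ^ (2*m)" by (rule binomial_le_pow2)
    then have "real ((2*m) choose m) \<le> 4 ^ m" by (metis of_nat_le_iff of_nat_numeral of_nat_power power_mult power2_eq_square num_double numeral_times_numeral)
    then show ?thesis by (subst ln_le_cancel_iff) auto
  qed
  finally show ?thesis by (simp add: ln_realpow)
qed

lemma chebyshev_psi_le: "(\<Sum>d=1..n. mangoldt d :: real) \<le> 5 * real n"
proof (induction n rule: less_induct)
  case (less n)
  show ?case
  proof (cases "n \<le> 1")
    case True then show ?thesis by (cases "n = 0") (auto simp: le_Suc_eq)
  next
    case False
    define m where "m = n div 2"
    have m: "m < n" "n = 2 * m \<or> n = 2 * m + 1" using False by (auto simp: m_def)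
    have "{1..2*m} = {1..m} \<union> {Suc m..2*m}" by auto
    then have "(\<Sum>d=1..2*m. mangoldt d :: real) = (\<Sum>d=1..m. mangoldt d) + (\<Sum>d=Suc m..2*m. mangoldt d)"
      by (simp add: sum.union_disjoint)
    also have "\<dots> \<le> 5 * real m + real m * ln 4"
      using less[OF m(1)] chebyshev_step[of m] by (intro add_mono)
    \<comment> \<open>The constant 5 closes the induction: \<open>5 m + 3 m = 8 m\<close> for even
      \<open>n = 2 m\<close>, and the slack of \<open>2 m\<close> absorbs the additional term of an
      odd \<open>n\<close>.\<close>
    also have "real m * ln 4 \<le> real m * 3" using ln_le_minus_one[of 4] by (intro mult_left_mono) auto
    finally have even: "(\<Sum>d=1..2*m. mangoldt d :: real) \<le> 8 * real m" by simp
    have "mangoldt (2*m+1) \<le> ln (real (2*m+1))" by (rule mangoldt_le) simp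
    also have "\<dots> \<le> real (2*m)" using ln_le_minus_one[of "real (2*m+1)"] by simp
    finally have "mangoldt (2*m+1) \<le> 2 * real m" by simp
    then show ?thesis using m(2) even by auto
  qed
qed

section \<open>L-functions\<close>

definition Lfun :: "(nat \<Rightarrow> complex) \<Rightarrow> complex \<Rightarrow> complex" where
  "Lfun \<phi> s = (\<Sum>n. \<phi> n * of_nat n powr (-s))"

text \<open>For a character this is \<open>- L'/L\<close> on \<open>Re s > 1\<close>.\<close>

definition Dfun :: "(nat \<Rightarrow> complex) \<Rightarrow> complex \<Rightarrow> complex" where
  "Dfun \<phi> s = (\<Sum>n. mangoldt n * \<phi> n * of_nat n powr (-s))"

lemma norm_nat_powr: "norm (of_nat n powr s :: complex) = real n powr Re s"
  by (cases "n = 0") (auto simp: norm_powr_real_powr)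

lemma bounded_dirichlet_abs_summable:
  fixes a :: "nat \<Rightarrow> complex"
  assumes "\<And>n. norm (a n) \<le> C" "Re s > 1"
  shows "summable (\<lambda>n. norm (a n * of_nat n powr (-s)))"
proof (rule summable_comparison_test)
  show "\<exists>N. \<forall>n\<ge>N. norm (norm (a n * of_nat n powr (-s))) \<le> C * real n powr (- Re s)"
    using assms by (auto simp: norm_mult norm_nat_powr intro!: mult_right_mono)
  show "summable (\<lambda>n. C * real n powr (- Re s))"
    using assms by (intro summable_mult) (simp add: summable_real_powr_iff)
qed

lemma mangoldt_partial_sum_le:
  assumes "\<And>n. norm (\<phi> n) \<le> 1"
  shows "norm (\<Sum>k=1..n. mangoldt k * \<phi> k :: complex) \<le> 5 * real n powr 1"
proof -
  have "norm (\<Sum>k=1..n. mangoldt k * \<phi> k :: complex) \<le> (\<Sum>k=1..n. mangoldt k)"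
    using assms by (intro sum_norm_le) (auto simp: norm_mult mult_left_le mangoldt_nonneg)
  also have "\<dots> \<le> 5 * real n" by (rule chebyshev_psi_le)
  finally show ?thesis by simp
qed

lemma Dfun_holomorphic:
  assumes "\<And>n. norm (\<phi> n) \<le> 1"
  shows "Dfun \<phi> holomorphic_on {s. Re s > 1}"
  unfolding Dfun_def
  using dirichlet_series_by_parts(2)[where a = "\<lambda>n. mangoldt n * \<phi> n" and \<kappa> = 1 and C = 5] mangoldt_partial_sum_le[OF assms]
  by auto

text \<open>Comparison with the constant coefficient 1 at the real point \<open>Re s\<close>: there
  the terms are nonnegative, so the convergence obtained by partial summation is already
  absolute.\<close>

lemma mangoldt_abs_summable:
  assumes "\<And>n. norm (\<phi> n) \<le> 1" and "Re s > 1"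
  shows "summable (\<lambda>n. norm (mangoldt n * \<phi> n * of_nat n powr (-s) :: complex))"
proof (rule summable_comparison_test)
  let ?t = "\<lambda>n. mangoldt n * 1 * of_nat n powr (- of_real (Re s)) :: complex"
  have "summable ?t"
    using dirichlet_series_by_parts(1)[where a = "\<lambda>n. mangoldt n * 1" and \<kappa> = 1 and C = 5 and s = "of_real (Re s)"]
      mangoldt_partial_sum_le[of "\<lambda>_. 1"] assms(2) by (auto simp: sums_iff)
  then have "summable (\<lambda>n. Re (?t n))" by (rule summable_Re)
  moreover have "Re (?t n) = mangoldt n * real n powr (- Re s)" for n
    using powr_of_real[of "real n" "- Re s"] Re_mangoldt[of n]
    by (metis (no_types, lifting) Re_complex_of_real mult.right_neutral of_real_mangoldt of_real_minus of_real_mult of_real_of_nat_eq of_nat_0_le_iff)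
  ultimately show "summable (\<lambda>n. mangoldt n * real n powr (- Re s))" by (simp only:)
  show "\<exists>N. \<forall>n\<ge>N. norm (norm (mangoldt n * \<phi> n * of_nat n powr (-s) :: complex)) \<le> mangoldt n * real n powr (- Re s)"
    using assms(1) by (auto simp: norm_mult norm_nat_powr mangoldt_nonneg intro!: mult_right_mono mult_left_le)
qed

text \<open>Termwise differentiation brings out \<open>ln n\<close>, the divisor sum of
  \<open>mangoldt\<close>. Complete multiplicativity turns \<open>\<phi> n * ln n\<close> into the
  Dirichlet convolution of \<open>mangoldt * \<phi>\<close> with \<phi>.\<close>

lemma Lfun_derivative:
  assumes \<phi>: "\<phi> \<in> dchars g" and g: "g > 0" and s: "Re s > 1"
  shows "(Lfun \<phi> has_field_derivative - Lfun \<phi> s * Dfun \<phi> s) (at s)"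
proof -
  note bd = norm_dchars_le[OF \<phi> g]
  let ?f' = "\<lambda>n s. - (\<phi> n * of_real (ln (real n))) * of_nat n powr (-s)"
  have der: "((\<lambda>s. \<phi> n * of_nat n powr (-s)) has_field_derivative ?f' n s) (at s)" for n s
  proof (cases "n = 0")
    case False
    then show ?thesis
      using DERIV_cmult[OF has_field_derivative_nat_powr[of n s], of "\<phi> n"] by (simp add: mult_ac)
  qed simp
  have le: "norm (\<phi> n * of_nat n powr (-s)) \<le> 1 * (1 + norm s)^2 * real n powr (1 - 1 - Re s)" for n s
  proof -
    have "norm (\<phi> n) \<le> (1 + norm s)^2" using bd[of n] by (simp add: power2_eq_square algebra_simps add_increasing2)
    then show ?thesis by (auto simp: norm_mult norm_nat_powr intro!: mult_right_mono)
  qed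
  note ser = holomorphic_powr_series[where \<kappa> = 1 and M = 1 and f = "\<lambda>n s. \<phi> n * of_nat n powr (-s)" and f' = ?f', OF der le]
  have D: "(Lfun \<phi> has_field_derivative (\<Sum>n. ?f' n s)) (at s)"
    unfolding Lfun_def using ser(3) s by simp
  have sL: "summable (\<lambda>n. norm (\<phi> n * of_nat n powr (-s)))"
    by (rule bounded_dirichlet_abs_summable[OF bd s])
  have sD: "summable (\<lambda>n. norm (mangoldt n * \<phi> n * of_nat n powr (-s) :: complex))"
    by (rule mangoldt_abs_summable[OF bd s])
  have "(\<lambda>n. (\<Sum>d | d dvd n. (mangoldt d * \<phi> d) * \<phi> (n div d)) * of_nat n powr (-s)) sums (Dfun \<phi> s * Lfun \<phi> s)"
    using sL sD summable_norm_cancel[OF sL] summable_norm_cancel[OF sD]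
    by (intro dirichlet_product) (auto simp: Lfun_def Dfun_def summable_sums)
  moreover have "(\<Sum>d | d dvd n. (mangoldt d * \<phi> d) * \<phi> (n div d)) * of_nat n powr (-s) = - ?f' n s" for n
  proof (cases "n = 0")
    case False
    have "(\<Sum>d | d dvd n. (mangoldt d * \<phi> d) * \<phi> (n div d)) = (\<Sum>d | d dvd n. mangoldt d * \<phi> n)"
    proof (rule sum.cong)
      fix d assume "d \<in> {d. d dvd n}"
      then have "\<phi> n = \<phi> d * \<phi> (n div d)" using dcharsD(3)[OF \<phi>, of d "n div d"] by simp
      then show "mangoldt d * \<phi> d * \<phi> (n div d) = mangoldt d * \<phi> n" by simp
    qed simp
    then show ?thesis using False mangoldt_sum[of n, where ?'a = complex] by (simp flip: sum_distrib_right)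
  qed simp
  ultimately have "(\<lambda>n. - ?f' n s) sums (Dfun \<phi> s * Lfun \<phi> s)" by simp
  from sums_minus[OF this] have "(\<Sum>n. ?f' n s) = - (Dfun \<phi> s * Lfun \<phi> s)" by (simp add: sums_iff)
  with D show ?thesis by (simp add: mult_ac)
qed

text \<open>An argument without Euler products: \<open>L' = - L D\<close> makes
  \<open>L * exp P\<close> constant for a primitive \<open>P\<close> of \<open>D\<close>, so a
  single zero would make \<open>L\<close> vanish on the whole half-plane. But the tail bound with
  \<open>N = 1\<close> gives \<open>|L(3) - 1| \<le> 1/2\<close>.\<close>

lemma Lfun_nonzero:
  assumes \<phi>: "\<phi> \<in> dchars g" and g: "g > 0" and s: "Re s > 1"
  shows "Lfun \<phi> s \<noteq> 0"
proof
  assume z: "Lfun \<phi> s = 0"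
  note bd = norm_dchars_le[OF \<phi> g]
  let ?S = "{s. Re s > 1}"
  have conv: "convex ?S" "open ?S" by (auto intro: convex_halfspace_Re_gt open_halfspace_Re_gt)
  obtain P where P: "\<And>x. x \<in> ?S \<Longrightarrow> (P has_field_derivative Dfun \<phi> x) (at x within ?S)"
    by (rule holomorphic_convex_primitive'[OF conv Dfun_holomorphic[of \<phi>, OF bd]]) (rule that, blast)
  have "((\<lambda>x. Lfun \<phi> x * exp (P x)) has_field_derivative 0) (at x within ?S)" if "x \<in> ?S" for x
  proof -
    have "(Lfun \<phi> has_field_derivative - Lfun \<phi> x * Dfun \<phi> x) (at x within ?S)"
      using Lfun_derivative[OF \<phi> g] that by (auto intro: has_field_derivative_at_within)
    then show ?thesis by (auto intro!: derivative_eq_intros P[OF that])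
  qed
  then obtain c where c: "\<And>x. x \<in> ?S \<Longrightarrow> Lfun \<phi> x * exp (P x) = c"
    using has_field_derivative_zero_constant[OF conv(1), of "\<lambda>x. Lfun \<phi> x * exp (P x)"] by blast
  have "c = 0" using c[of s] s z by simp
  then have "Lfun \<phi> 3 = 0" using c[of 3] by simp
  moreover have "norm (Lfun \<phi> (1+2) - (\<Sum>n=1..1. \<phi> n * of_nat n powr (-1-2))) \<le> 1 * real 1 powr (- Re 2) / Re 2"
    using summable_norm_cancel[OF bounded_dirichlet_abs_summable[of \<phi> 1 "1+2", OF bd]]
    by (intro norm_powr_tail_le[where a = \<phi>, OF bd]) (auto simp: Lfun_def summable_sums)
  ultimately show False using dcharsD(2)[OF \<phi>] by simp
qed

section \<open>Continuation to Re s > 0\<close>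

lemma Lfun_nonprincipal:
  assumes \<phi>: "\<phi> \<in> dchars g" "\<phi> \<noteq> principal_char g" and g: "g > 0"
  shows "Lfun \<phi> holomorphic_on {s. Re s > 0}" "Re s > 0 \<Longrightarrow> (\<lambda>n. \<phi> n * of_nat n powr (-s)) sums Lfun \<phi> s"
proof -
  have b: "norm (\<Sum>k=1..n. \<phi> k) \<le> (real g + 1) * real n powr 0" if "n > 0" for n
    using periodic_sum_bounded[OF dcharsD(4)[OF \<phi>(1)] dchars_nonprincipal_sum[OF \<phi> g] norm_dchars_le[OF \<phi>(1) g] g, of n] that by simp
  show "Lfun \<phi> holomorphic_on {s. Re s > 0}"
    unfolding Lfun_def using dirichlet_series_by_parts(2)[OF b] by simp
  show "Re s > 0 \<Longrightarrow> (\<lambda>n. \<phi> n * of_nat n powr (-s)) sums Lfun \<phi> s"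
    unfolding Lfun_def using dirichlet_series_by_parts(1)[OF b] by (simp add: sums_iff)
qed

text \<open>\<open>xi_zeta s = (s - 1) \<zeta>(s)\<close>; the summand for \<open>n = 0\<close> is \<open>1\<close>.\<close>

definition xi_zeta :: "complex \<Rightarrow> complex" where
  "xi_zeta s = (\<Sum>n. powr_err n (s - 1))"

lemma xi_zeta_holomorphic: "xi_zeta holomorphic_on {s. Re s > 0}"
proof -
  have hol: "(\<lambda>s. powr_err n (s - 1)) holomorphic_on {s. Re s > 0}" for n by (intro holomorphic_intros)
  have le: "norm (powr_err n (s - 1)) \<le> 1 * (1 + norm s)^2 * real n powr (0 - 1 - Re s)" if "n > 0" "Re s > 0" for n s
  proof -
    have "norm (powr_err n (s - 1)) \<le> norm (s - 1) * norm (s - 1 + 1) * real n powr (- Re (s - 1) - 2)"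
      using that by (intro norm_powr_err_le) auto
    also have "\<dots> = norm (s - 1) * norm s * real n powr (0 - 1 - Re s)" by (simp add: algebra_simps)
    also have "\<dots> \<le> ((1 + norm s) * (1 + norm s)) * real n powr (0 - 1 - Re s)"
      using norm_triangle_ineq4[of s 1] by (intro mult_mono) auto
    finally show ?thesis by (simp add: power2_eq_square)
  qed
  show ?thesis unfolding xi_zeta_def
    using holomorphic_powr_series(1)[where \<kappa> = 0 and M = 1 and f = "\<lambda>n s. powr_err n (s - 1)", OF deriv_if_holomorphic_halfplane[OF hol] le] by auto
qed

text \<open>The residue of zeta: at \<open>s = 1\<close> every term with \<open>n > 0\<close>
  vanishes, and the term at \<open>n = 0\<close> is \<open>1\<close>.\<close>

lemma xi_zeta_1: "xi_zeta 1 = 1"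
proof -
  have "(\<lambda>n. powr_err n (1 - 1)) = (\<lambda>n. if n = 0 then 1 else 0)"
    by (auto simp: powr_err_def fun_eq_iff of_nat_neq_0[simplified])
  then show ?thesis unfolding xi_zeta_def using sums_single[of 0 "\<lambda>_. 1::complex"] by (simp add: sums_iff)
qed

lemma xi_zeta_eq:
  assumes s: "Re s > 1"
  shows "xi_zeta s = (s - 1) * Lfun (\<lambda>_. 1) s"
proof -
  have "summable (\<lambda>n. 1 * of_nat n powr (-s) :: complex)"
    by (rule summable_norm_cancel[OF bounded_dirichlet_abs_summable[of "\<lambda>_. 1" 1]]) (use s in auto)
  then have "(\<lambda>N. (s - 1) * (\<Sum>n<N. 1 * of_nat n powr (-s)) + of_nat N powr (1 - s)) \<longlonglongrightarrow> (s - 1) * Lfun (\<lambda>_. 1) s + 0"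
  proof (intro tendsto_intros)
    show "(\<lambda>N. of_nat N powr (1 - s) :: complex) \<longlonglongrightarrow> 0"
    proof (rule tendsto_norm_zero_cancel)
      show "(\<lambda>N. norm (of_nat N powr (1 - s) :: complex)) \<longlonglongrightarrow> 0"
        unfolding norm_nat_powr using s by (intro tendsto_neg_powr filterlim_real_sequentially) auto
    qed
  qed (simp add: Lfun_def summable_LIMSEQ)
  moreover have "(s - 1) * (\<Sum>n<N. 1 * of_nat n powr (-s)) + of_nat N powr (1 - s) = (\<Sum>n<N. powr_err n (s - 1))" for N
    by (induction N) (simp_all add: powr_err_def algebra_simps)
  ultimately have "(\<lambda>n. powr_err n (s - 1)) sums ((s - 1) * Lfun (\<lambda>_. 1) s)" unfolding sums_def by simp
  then show ?thesis unfolding xi_zeta_def by (simp add: sums_iff)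
qed

text \<open>The density of the integers prime to \<open>g\<close>. Once it is subtracted, the
  principal character has sum zero over a period; its L-series thus splits into a multiple of zeta
  and a series convergent for \<open>Re s > 0\<close>.\<close>

definition prin_mean :: "nat \<Rightarrow> complex" where
  "prin_mean g = (\<Sum>k<g. principal_char g k) / of_nat g"

lemma prin_mean_nonzero: "g > 0 \<Longrightarrow> prin_mean g \<noteq> 0"
proof -
  assume g: "g > 0"
  have "(\<Sum>k<g. principal_char g k) = of_nat (card {k\<in>{..<g}. coprime k g})"
    by (simp add: principal_char_def sum.If_cases Int_def)
  moreover have "\<exists>x<g. coprime x g" using g by (intro exI[of _ "1 mod g"]) (auto simp: coprime_mod_left_iff)
  ultimately show ?thesis using g by (simp add: prin_mean_def)
qed

text \<open>\<open>L(s)\<close>, multiplied by \<open>s - 1\<close> for the principal character to remove the pole.\<close>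

definition Efun :: "nat \<Rightarrow> (nat \<Rightarrow> complex) \<Rightarrow> complex \<Rightarrow> complex" where
  "Efun g \<phi> s = (if \<phi> = principal_char g
     then prin_mean g * xi_zeta s + (s - 1) * Lfun (\<lambda>n. principal_char g n - prin_mean g) s else Lfun \<phi> s)"

lemma Lfun_centered:
  assumes g: "g > 0"
  shows "Lfun (\<lambda>n. principal_char g n - prin_mean g) holomorphic_on {s. Re s > 0}"
    and "Re s > 0 \<Longrightarrow> (\<lambda>n. (principal_char g n - prin_mean g) * of_nat n powr (-s)) sums Lfun (\<lambda>n. principal_char g n - prin_mean g) s"
proof -
  let ?f = "\<lambda>n. principal_char g n - prin_mean g"
  have z: "(\<Sum>k<g. ?f k) = 0" using g by (simp add: sum_subtractf prin_mean_def)
  have bd: "norm (?f n) \<le> 1 + norm (prin_mean g)" for n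
    using norm_triangle_ineq4[of "principal_char g n" "prin_mean g"] norm_dchars_le[OF principal_dchars g, of n] by linarith
  have b: "norm (\<Sum>k=1..n. ?f k) \<le> ((1 + norm (prin_mean g)) * (real g + 1)) * real n powr 0" if "n > 0" for n
    using periodic_sum_bounded[of ?f g, OF _ z bd g, of n] dcharsD(4)[OF principal_dchars] that by simp
  show "Lfun ?f holomorphic_on {s. Re s > 0}"
    unfolding Lfun_def using dirichlet_series_by_parts(2)[OF b] by simp
  show "Re s > 0 \<Longrightarrow> (\<lambda>n. ?f n * of_nat n powr (-s)) sums Lfun ?f s"
    unfolding Lfun_def using dirichlet_series_by_parts(1)[OF b] by (simp add: sums_iff)
qed

lemma Efun_holomorphic:
  assumes "g > 0" "\<phi> \<in> dchars g"
  shows "Efun g \<phi> holomorphic_on {s. Re s > 0}"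
proof (cases "\<phi> = principal_char g")
  case True
  have "(\<lambda>s. prin_mean g * xi_zeta s + (s - 1) * Lfun (\<lambda>n. principal_char g n - prin_mean g) s) holomorphic_on {s. Re s > 0}"
    by (intro holomorphic_intros xi_zeta_holomorphic Lfun_centered assms)
  then show ?thesis unfolding Efun_def using True by simp
next
  case False
  then show ?thesis using Lfun_nonprincipal(1)[OF assms(2) False assms(1)] by (simp add: Efun_def[abs_def])
qed

lemma Efun_principal_eq:
  assumes g: "g > 0" and s: "Re s > 1"
  shows "Efun g (principal_char g) s = (s - 1) * Lfun (principal_char g) s"
proof -
  have "summable (\<lambda>n. 1 * of_nat n powr (-s) :: complex)"
    by (rule summable_norm_cancel[OF bounded_dirichlet_abs_summable[of "\<lambda>_. 1" 1]]) (use s in auto)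
  then have "(\<lambda>n. prin_mean g * (1 * of_nat n powr (-s)) + (principal_char g n - prin_mean g) * of_nat n powr (-s))
      sums (prin_mean g * Lfun (\<lambda>_. 1) s + Lfun (\<lambda>n. principal_char g n - prin_mean g) s)"
    using Lfun_centered(2)[OF g, of s] s by (intro sums_add sums_mult) (auto simp: Lfun_def summable_sums)
  then have "Lfun (principal_char g) s = prin_mean g * Lfun (\<lambda>_. 1) s + Lfun (\<lambda>n. principal_char g n - prin_mean g) s"
    unfolding Lfun_def[of "principal_char g"] by (simp add: sums_iff algebra_simps)
  then show ?thesis unfolding Efun_def xi_zeta_eq[OF s] by (simp add: algebra_simps)
qed

lemma Efun_principal_1: "g > 0 \<Longrightarrow> Efun g (principal_char g) 1 \<noteq> 0"
  by (simp add: Efun_def xi_zeta_1 prin_mean_nonzero)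

lemma Efun_nonzero:
  assumes "g > 0" "\<phi> \<in> dchars g" "Re s > 1"
  shows "Efun g \<phi> s \<noteq> 0"
proof (cases "\<phi> = principal_char g")
  case True
  then show ?thesis using Efun_principal_eq[of g s] Lfun_nonzero[of \<phi> g s] assms by auto
next
  case False
  then show ?thesis using Lfun_nonzero[of \<phi> g s] assms by (simp add: Efun_def)
qed

lemma Efun_logderiv:
  assumes g: "g > 0" and \<phi>: "\<phi> \<in> dchars g" and s: "Re s > 1"
  shows "deriv (Efun g \<phi>) s / Efun g \<phi> s = (if \<phi> = principal_char g then 1 / (s - 1) else 0) - Dfun \<phi> s"
proof (cases "\<phi> = principal_char g")
  case True
  have "((\<lambda>s. (s - 1) * Lfun \<phi> s) has_field_derivative (s - 1) * (- Lfun \<phi> s * Dfun \<phi> s) + 1 * Lfun \<phi> s) (at s)"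
    by (rule derivative_eq_intros Lfun_derivative[OF \<phi> g s] refl | simp)+
  then have "(Efun g \<phi> has_field_derivative (s - 1) * (- Lfun \<phi> s * Dfun \<phi> s) + 1 * Lfun \<phi> s) (at s)"
    by (rule has_field_derivative_transform_within_open[OF _ open_halfspace_Re_gt[of 1]])
       (use s Efun_principal_eq[OF g] True in auto)
  then have eq1: "deriv (Efun g \<phi>) s = Lfun \<phi> s * (1 - (s - 1) * Dfun \<phi> s)" by (simp add: DERIV_imp_deriv algebra_simps)
  have eq2: "Efun g \<phi> s = (s - 1) * Lfun \<phi> s" using Efun_principal_eq[OF g s] True by simp
  have s1: "s \<noteq> 1" using s by auto
  have "(L * (1 - x * D)) / (x * L) = 1 / x - D" if "L \<noteq> 0" "x \<noteq> 0" for L D x :: complex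
    using that by (simp add: field_simps)
  from this[of "Lfun \<phi> s" "s - 1" "Dfun \<phi> s", OF Lfun_nonzero[OF \<phi> g s]]
  show ?thesis unfolding eq1 eq2 using True s1 by simp
next
  case False
  then have "Efun g \<phi> = Lfun \<phi>" by (intro ext) (simp add: Efun_def)
  then show ?thesis using False Lfun_derivative[OF \<phi> g s] Lfun_nonzero[OF \<phi> g s] by (simp add: DERIV_imp_deriv)
qed

section \<open>Real characters\<close>

lemma abel_sum_bound:
  fixes a :: "nat \<Rightarrow> complex" and b :: "nat \<Rightarrow> real"
  assumes S: "\<And>n. norm (\<Sum>k=1..n. a k) \<le> C" and b: "\<And>n. n \<ge> 1 \<Longrightarrow> b (Suc n) \<le> b n" "\<And>n. n \<ge> 1 \<Longrightarrow> b n \<ge> 0"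
  shows "norm (\<Sum>n=1..N. a n * of_real (b n)) \<le> C * b 1"
proof -
  have tel: "(\<Sum>n=1..N. b n - b (Suc n)) + b (Suc N) = b 1" by (induction N) auto
  have "(\<Sum>n=1..N. a n * of_real (b n)) = (\<Sum>n=1..N. (\<Sum>k=1..n. a k) * of_real (b n - b (Suc n))) + (\<Sum>k=1..N. a k) * of_real (b (Suc N))"
    by (induction N) (simp_all add: algebra_simps)
  also have "norm \<dots> \<le> norm (\<Sum>n=1..N. (\<Sum>k=1..n. a k) * of_real (b n - b (Suc n))) + norm ((\<Sum>k=1..N. a k) * of_real (b (Suc N)))"
    by (rule norm_triangle_ineq)
  also have "\<dots> \<le> (\<Sum>n=1..N. C * (b n - b (Suc n))) + C * b (Suc N)"
  proof (intro add_mono sum_norm_le)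
    fix n assume "n \<in> {1..N}"
    then have "b n - b (Suc n) \<ge> 0" using b(1)[of n] by auto
    then show "norm ((\<Sum>k=1..n. a k) * of_real (b n - b (Suc n))) \<le> C * (b n - b (Suc n))"
      unfolding norm_mult norm_of_real using S[of n] by (simp add: mult_right_mono)
  next
    show "norm ((\<Sum>k=1..N. a k) * of_real (b (Suc N))) \<le> C * b (Suc N)"
      unfolding norm_mult norm_of_real using S[of N] b(2)[of "Suc N"] by (simp add: mult_right_mono)
  qed
  also have "\<dots> = C * b 1" unfolding tel[symmetric] by (simp add: sum_distrib_left algebra_simps)
  finally show ?thesis .
qed

text \<open>Arithmetic-geometric mean for the terms with indices \<open>i\<close> and
  \<open>n - 1 - i\<close>, whose product is \<open>u ^ (2 * (n - 1))\<close>.\<close>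

lemma geometric_sum_ge:
  fixes u :: real
  assumes "u \<ge> 0"
  shows "real n * u ^ (n - 1) \<le> (\<Sum>i<n. (u^2) ^ i)"
proof -
  have "(\<Sum>i<n. 2 * u ^ (n - 1)) \<le> (\<Sum>i<n. (u^2) ^ i + (u^2) ^ (n - Suc i))"
  proof (rule sum_mono)
    fix i assume "i \<in> {..<n}"
    then have "u ^ (n - 1) = u ^ i * u ^ (n - Suc i)" by (simp flip: power_add)
    moreover have "0 \<le> (u ^ i - u ^ (n - Suc i))^2" by simp
    ultimately show "2 * u ^ (n - 1) \<le> (u^2) ^ i + (u^2) ^ (n - Suc i)"
      by (simp add: power2_diff power_mult[symmetric] mult_ac)
  qed
  also have "\<dots> = (\<Sum>i<n. (u^2) ^ i) + (\<Sum>i<n. (u^2) ^ i)"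
    unfolding sum.distrib sum.nat_diff_reindex[of "\<lambda>i. (u^2) ^ i"] ..
  finally show ?thesis by simp
qed

text \<open>Monsky's proof that \<open>L(1) \<noteq> 0\<close> for real characters: if \<open>L(1) = 0\<close>, the Lambert series of the character
  equals minus the sum of the character against these decreasing weights, hence stays bounded as \<open>t\<close> tends to
  \<open>1\<close>; but its coefficients are nonnegative and infinitely many of them are \<open>1\<close>.\<close>

definition monsky_b :: "real \<Rightarrow> nat \<Rightarrow> real" where
  "monsky_b t n = 1 / (real n * (1 - t)) - t ^ n / (1 - t ^ n)"

text \<open>With \<open>q n = 1 + t + ... + t ^ (n - 1)\<close> the weight is
  \<open>(1 / n - t ^ n / q n) / (1 - t)\<close>, and \<open>q (n + 1) = 1 + t * q n\<close> reduces
  its decrease to \<open>n (n + 1) t ^ n \<le> q n * q (n + 1)\<close>. The bound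
  \<open>geometric_sum_ge\<close> at \<open>u = sqrt t\<close> gives this even with
  \<open>u ^ (2n - 1)\<close> in place of \<open>t ^ n = u ^ (2n)\<close>.\<close>

lemma monsky_b_props:
  assumes t: "0 < t" "t < 1" and n: "n \<ge> 1"
  shows "monsky_b t (Suc n) \<le> monsky_b t n" "monsky_b t n \<ge> 0" "monsky_b t 1 = 1"
proof -
  define q where "q n = (\<Sum>i<n. t ^ i)" for n
  have q: "1 - t ^ n = (1 - t) * q n" for n unfolding q_def by (rule one_diff_power_eq)
  have qpos: "q n > 0" if "n \<ge> 1" for n
  proof -
    have "1 - t ^ n > 0" using t that by (simp add: power_less_one_iff)
    then show ?thesis using q[of n] t by (simp add: zero_less_mult_iff)
  qed
  define u where "u = sqrt t"
  have u: "0 < u" "u < 1" "u^2 = t" using t by (auto simp: u_def)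
  have "real n * u ^ (n - 1) \<le> q n" "real (Suc n) * u ^ n \<le> q (Suc n)"
    using geometric_sum_ge[of u n] geometric_sum_ge[of u "Suc n"] u by (auto simp: q_def)
  then have "(real n * u ^ (n - 1)) * (real (Suc n) * u ^ n) \<le> q n * q (Suc n)"
    using u n qpos[of n] by (intro mult_mono) auto
  moreover have "real n * real (Suc n) * t ^ n \<le> (real n * u ^ (n - 1)) * (real (Suc n) * u ^ n)"
  proof -
    have "t ^ n = u ^ (2 * n)" unfolding u(3)[symmetric] by (simp add: power_mult)
    also have "\<dots> \<le> u ^ (n - 1 + n)" using u by (intro power_decreasing) auto
    finally show ?thesis by (simp add: power_add mult_ac mult_left_mono)
  qed
  ultimately have key: "real n * real (Suc n) * t ^ n \<le> q n * q (Suc n)" by linarith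
  have qS: "q (Suc n) = 1 + t * q n"
    unfolding q_def by (subst sum.lessThan_Suc_shift) (simp add: sum_distrib_left)
  have qn: "q n > 0" "q (Suc n) > 0" using qpos n by auto
  have e: "monsky_b t m = (1 / (1 - t)) * (1 / real m - t ^ m / q m)" for m
    
  proof -
    have "1 / (a * x) - T / (x * y) = (1 / x) * (1 / a - T / y)" for a x y T :: real
      by (simp add: right_diff_distrib mult.commute)
    then show ?thesis unfolding monsky_b_def q .
  qed
  have "1 / real n - t ^ n / q n - (1 / real (Suc n) - t ^ Suc n / q (Suc n)) = 1 / (real n * real (Suc n)) - t ^ n / (q n * q (Suc n))"
  proof -
    have "1 / real n - 1 / real (Suc n) = 1 / (real n * real (Suc n))" using n by (simp add: field_simps)
    moreover have "t ^ n / q n - t ^ Suc n / q (Suc n) = t ^ n * (q (Suc n) - t * q n) / (q n * q (Suc n))"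
      using qn by (simp add: field_simps)
    ultimately show ?thesis using qS by simp
  qed
  also have "\<dots> \<ge> 0"
  proof -
    have "T / Q \<le> 1 / a" if "a * T \<le> Q" "a > 0" "Q > 0" for a T Q :: real
      using that by (simp add: field_simps)
    from this[OF key] show ?thesis using qn n by simp
  qed
  finally have "1 / real (Suc n) - t ^ Suc n / q (Suc n) \<le> 1 / real n - t ^ n / q n" by simp
  then show "monsky_b t (Suc n) \<le> monsky_b t n" unfolding e using t by (intro mult_left_mono) auto
  have "real n * t ^ n = (\<Sum>i<n. t ^ n)" by simp
  also have "\<dots> \<le> q n" unfolding q_def using t by (intro sum_mono power_decreasing) auto
  finally show "monsky_b t n \<ge> 0" unfolding e using t qn n by (simp add: field_simps)
  show "monsky_b t 1 = 1" unfolding monsky_b_def using t by (simp add: field_simps)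
qed

locale real_char =
  fixes g :: nat and rr :: "nat \<Rightarrow> real"
  assumes g: "g > 0" and \<phi>: "(\<lambda>n. complex_of_real (rr n)) \<in> dchars g" "(\<lambda>n. complex_of_real (rr n)) \<noteq> principal_char g"
begin

abbreviation \<phi> :: "nat \<Rightarrow> complex" where "\<phi> \<equiv> \<lambda>n. complex_of_real (rr n)"

text \<open>The Dirichlet coefficients of the product of zeta with the L-series of the
  character.\<close>

definition cc :: "nat \<Rightarrow> real" where "cc n = (\<Sum>d | d dvd n. rr d)"

lemma rr_mult: "rr (m * n) = rr m * rr n"
  using dcharsD(3)[OF \<phi>(1), of m n] by (simp flip: of_real_mult)

lemma rr_1: "rr (Suc 0) = 1"
  using dcharsD(2)[OF \<phi>(1)] by simp

lemma rr_cases: "rr n = 1 \<or> rr n = 0 \<or> rr n = -1"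
proof (cases "coprime n g")
  case True
  then have "\<bar>rr n\<bar> = 1" using norm_dchars_coprime[OF \<phi>(1) True g] by simp
  then show ?thesis by linarith
next
  case False
  then show ?thesis using dcharsD(5)[OF \<phi>(1) False] by simp
qed

text \<open>A divisor of \<open>p ^ (k + 1) * m\<close> either is prime to \<open>p\<close> and
  divides \<open>m\<close>, or is \<open>p\<close> times a divisor of
  \<open>p ^ k * m\<close>.\<close>

lemma cc_prime_power_mult:
  assumes p: "prime p" and m: "\<not> p dvd m" "m > 0"
  shows "cc (p ^ k * m) = (\<Sum>i\<le>k. rr p ^ i) * cc m"
proof (induction k)
  case (Suc k)
  have split: "{d. d dvd p ^ Suc k * m} = {d. d dvd m} \<union> (\<lambda>d. p * d) ` {d. d dvd p ^ k * m}"
  proof (intro equalityI subsetI)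
    fix d assume "d \<in> {d. d dvd p ^ Suc k * m}"
    then have d: "d dvd p ^ Suc k * m" by simp
    show "d \<in> {d. d dvd m} \<union> (\<lambda>d. p * d) ` {d. d dvd p ^ k * m}"
    proof (cases "p dvd d")
      case True
      then obtain e where "d = p * e" by auto
      then have "e dvd p ^ k * m" using d p by (simp add: mult.assoc prime_gt_0_nat)
      then show ?thesis using \<open>d = p * e\<close> by blast
    next
      case False
      then have "coprime d (p ^ Suc k)" using p by (metis coprime_commute coprime_power_right_iff prime_imp_coprime_nat)
      then have "d dvd m" using d by (simp add: coprime_dvd_mult_right_iff)
      then show ?thesis by simp
    qed
  next
    fix d assume "d \<in> {d. d dvd m} \<union> (\<lambda>d. p * d) ` {d. d dvd p ^ k * m}"
    then show "d \<in> {d. d dvd p ^ Suc k * m}" by (auto simp: mult.assoc)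
  qed
  have fin: "finite {d. d dvd m}" "finite {d. d dvd p ^ k * m}" using m p by (auto simp: prime_gt_0_nat)
  have "{d. d dvd m} \<inter> (\<lambda>d. p * d) ` {d. d dvd p ^ k * m} = {}" using m by (auto dest: dvd_mult_left)
  then have "cc (p ^ Suc k * m) = cc m + (\<Sum>d\<in>(\<lambda>d. p * d) ` {d. d dvd p ^ k * m}. rr d)"
    unfolding cc_def split using fin by (subst sum.union_disjoint) auto
  also have "(\<Sum>d\<in>(\<lambda>d. p * d) ` {d. d dvd p ^ k * m}. rr d) = rr p * cc (p ^ k * m)"
    unfolding cc_def using p by (subst sum.reindex) (auto simp: inj_on_def rr_mult sum_distrib_left prime_gt_0_nat)
  also have "cc m + \<dots> = (1 + rr p * (\<Sum>i\<le>k. rr p ^ i)) * cc m" unfolding Suc by (simp add: algebra_simps)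
  also have "1 + rr p * (\<Sum>i\<le>k. rr p ^ i) = (\<Sum>i\<le>Suc k. rr p ^ i)"
    by (subst sum.atMost_Suc_shift) (simp add: sum_distrib_left)
  finally show ?case .
qed simp

lemma cc_1: "cc (Suc 0) = 1" unfolding cc_def by (simp add: rr_1)

lemma sum_rr_power_nonneg: "(\<Sum>i\<le>k. rr p ^ i) \<ge> 0"
proof -
  consider "rr p \<ge> 0" | "rr p = -1" using rr_cases[of p] by linarith
  then show ?thesis
  proof cases
    case 2
    have "(\<Sum>i\<le>k. (-1::real) ^ i) = (if even k then 1 else 0)" by (induction k) auto
    then show ?thesis using 2 by simp
  qed (simp add: sum_nonneg)
qed

lemma cc_nonneg: "n > 0 \<Longrightarrow> cc n \<ge> 0"
proof (induction n rule: less_induct)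
  case (less n)
  show ?case
  proof (cases "n = 1")
    case True then show ?thesis using cc_1 by simp
  next
    case False
    then obtain p where p: "prime p" "p dvd n" using prime_factor_nat by blast
    obtain m where m: "n = p ^ multiplicity p n * m" "\<not> p dvd m"
      using multiplicity_decompose'[of n p] p less.prems by (auto simp: prime_nat_iff)
    have "m > 0" "multiplicity p n > 0" using m less.prems p by (auto intro!: Nat.gr0I simp: prime_multiplicity_gt_zero_iff)
    then have "1 * m < p ^ multiplicity p n * m" using p(1) by (intro mult_strict_right_mono one_less_power) (auto simp: prime_gt_Suc_0_nat)
    then have "m < n" using m(1) by simp
    then have "cc m \<ge> 0" using less.IH[OF _ \<open>m > 0\<close>] by simp
    then show ?thesis using cc_prime_power_mult[OF p(1) m(2) \<open>m > 0\<close>, of "multiplicity p n"] sum_rr_power_nonneg m(1)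
      by (metis mult_nonneg_nonneg)
  qed
qed

lemma ex_prime_dvd_modulus: "\<exists>p. prime p \<and> p dvd g"
proof (rule ccontr)
  assume "\<not> ?thesis"
  then have "g = 1" using prime_factor_nat by blast
  have "\<phi> n = principal_char g n" for n
    using dchars_cong[OF \<phi>(1), of n 1] dcharsD(2)[OF \<phi>(1)] \<open>g = 1\<close> by (simp add: principal_char_def)
  then show False using \<phi>(2) by blast
qed

text \<open>The character vanishes at a prime dividing the modulus, so only the divisor 1 counts.
  The powers of such a prime are the infinitely many indices with coefficient 1.\<close>

lemma cc_ramified_power:
  assumes "prime p" "p dvd g"
  shows "cc (p ^ k) = 1"
proof -
  have "\<not> coprime p g" using assms by (metis coprime_absorb_left not_prime_unit)
  then have "rr p = 0" using dcharsD(5)[OF \<phi>(1)] by simp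
  moreover have "(\<Sum>i\<le>k. (0::real) ^ i) = 1" by (induction k) auto
  ultimately show ?thesis using cc_prime_power_mult[of p 1 k] prime_gt_Suc_0_nat[OF assms(1)] assms(1) cc_1 by simp
qed

text \<open>Each \<open>t ^ n / (1 - t ^ n)\<close> is a geometric series, and the double series is
  regrouped by products. At \<open>n = 0\<close> the quotient is \<open>1 / 0 = 0\<close>, so that
  term drops out.\<close>

lemma lambert_sums:
  assumes t: "0 < t" "t < 1"
  defines "S \<equiv> \<Sum>n. \<phi> n * of_real (t ^ n / (1 - t ^ n))"
  shows "(\<lambda>n. \<phi> n * of_real (t ^ n / (1 - t ^ n))) sums S"
    and "(\<lambda>n. of_real (cc n * (if n = 0 then 0 else t ^ n))) sums S"
proof -
  let ?l = "\<lambda>n. t ^ n / (1 - t ^ n)"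
  have l: "0 \<le> ?l n" "?l n \<le> t ^ n / (1 - t)" for n
  proof -
    have "1 - t \<le> 1 - t ^ n" if "n \<ge> 1" using power_decreasing[of 1 n t] t that by simp
    then show "?l n \<le> t ^ n / (1 - t)" using t by (cases "n = 0") (auto intro!: divide_left_mono simp: power_less_one_iff)
    show "0 \<le> ?l n" using t by (simp add: power_le_one)
  qed
  have sl: "summable ?l"
  proof (rule summable_comparison_test[of _ "\<lambda>n. t ^ n / (1 - t)"])
    show "\<exists>N. \<forall>n\<ge>N. norm (?l n) \<le> t ^ n / (1 - t)" 
      using l(2) unfolding real_norm_def abs_of_nonneg[OF l(1)] by blast
    show "summable (\<lambda>n. t ^ n / (1 - t))" using t by (intro summable_divide summable_geometric) auto
  qed
  have sl': "summable (\<lambda>n. norm (\<phi> n * of_real (?l n)))"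
  proof (rule summable_comparison_test[OF _ sl])
    have "norm (norm (z * of_real x)) \<le> x" if "norm z \<le> 1" "0 \<le> x" for z :: complex and x
      using that by (simp add: norm_mult mult_left_le_one_le)
    from this[OF norm_dchars_le[OF \<phi>(1) g] l(1)] have "norm (norm (\<phi> n * of_real (?l n))) \<le> ?l n" for n .
    then show "\<exists>N. \<forall>n\<ge>N. norm (norm (\<phi> n * of_real (?l n))) \<le> ?l n" by blast
  qed
  show G: "(\<lambda>n. \<phi> n * of_real (?l n)) sums S"
    unfolding S_def using summable_norm_cancel[OF sl'] by (rule summable_sums)
  define h where "h d e = (if d = 0 \<or> e = 0 then 0 else \<phi> d * of_real (t ^ (d * e)))" for d e
  have hs: "(\<lambda>e. if d = 0 \<or> e = 0 then 0 else t ^ (d * e)) sums ?l d" for d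
  proof (cases "d = 0")
    case False
    have "(\<lambda>e. (t ^ d) ^ e) sums (1 / (1 - t ^ d))" using t False by (intro geometric_sums) (simp add: power_less_one_iff)
    then have "(\<lambda>e. t ^ d * (t ^ d) ^ e) sums (t ^ d * (1 / (1 - t ^ d)))" by (rule sums_mult)
    then have "(\<lambda>e. (\<lambda>e. if d = 0 \<or> e = 0 then 0 else t ^ (d * e)) (Suc e)) sums (?l d)"
      using False by (simp add: power_mult power_add)
    then show ?thesis by (subst (asm) sums_Suc_iff) simp
  qed simp
  have hs1: "h d sums (\<phi> d * of_real (?l d))" for d
    using sums_mult[OF sums_of_real[OF hs[of d]], of "\<phi> d"] by (auto simp: h_def[abs_def] if_distrib cong: if_cong)
  have hs2: "(\<lambda>e. norm (h d e)) sums (norm (\<phi> d) * ?l d)" for d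
    using sums_mult[OF hs[of d], of "norm (\<phi> d)"] t by (auto simp: h_def norm_mult if_distrib norm_power cong: if_cong)
  have "(\<lambda>n. \<Sum>d | d dvd n. h d (n div d)) sums S"
  proof (rule sums_divisor_rearrange[OF _ _ _ _ hs1 G])
    show "summable (\<lambda>e. norm (h d e))" for d using hs2[of d] by (simp add: sums_iff)
    have "(\<Sum>e. norm (h d e)) = norm (\<phi> d * of_real (?l d))" for d
      unfolding norm_mult norm_of_real[of "?l d"] abs_of_nonneg[OF l(1)] using hs2[of d] by (simp add: sums_iff)
    then show "summable (\<lambda>d. \<Sum>e. norm (h d e))" using sl' by simp
  qed (auto simp: h_def)
  moreover have "(\<Sum>d | d dvd n. h d (n div d)) = of_real (cc n * (if n = 0 then 0 else t ^ n))" for n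
  proof (cases "n = 0")
    case False
    have "(\<Sum>d | d dvd n. h d (n div d)) = (\<Sum>d | d dvd n. of_real (rr d * t ^ n))"
      using False by (intro sum.cong refl) (auto simp: h_def elim!: dvdE)
    then show ?thesis using False by (simp add: cc_def sum_distrib_right)
  qed simp
  ultimately show "(\<lambda>n. of_real (cc n * (if n = 0 then 0 else t ^ n))) sums S" by simp
qed

lemma harmonic_char_sum_nonzero:
  assumes lim: "(\<lambda>N. \<Sum>n=1..N. \<phi> n / of_nat n) \<longlonglongrightarrow> 0"
  shows False
proof -
  define C where "C = 1 * (real g + 1)"
  have C: "norm (\<Sum>k=1..n. \<phi> k) \<le> C" for n
    unfolding C_def by (rule periodic_sum_bounded[OF dcharsD(4)[OF \<phi>(1)] dchars_nonprincipal_sum[OF \<phi> g] norm_dchars_le[OF \<phi>(1) g] g])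
  have bound: "(\<Sum>n\<in>F. cc n * t ^ n) \<le> C" if t: "0 < t" "t < 1" and F: "finite F" "0 \<notin> F" for t F
  proof -
    define S where "S = (\<Sum>n. \<phi> n * of_real (t ^ n / (1 - t ^ n)))"
    note ls = lambert_sums[OF t, folded S_def]
    have "(\<lambda>N. \<Sum>n<Suc N. \<phi> n * of_real (t ^ n / (1 - t ^ n))) \<longlonglongrightarrow> S"
      using ls(1) unfolding sums_def by (rule LIMSEQ_Suc)
    moreover have "(\<Sum>n<Suc N. \<phi> n * of_real (t ^ n / (1 - t ^ n))) = (\<Sum>n=1..N. \<phi> n * of_real (t ^ n / (1 - t ^ n)))" for N
    proof -
      have "{..<Suc N} = insert 0 {1..N}" by auto
      then show ?thesis by simp
    qed
    \<comment> \<open>By assumption the series of \<open>\<phi> n / n\<close> sums to 0, so adding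
      \<open>1 / (1 - t)\<close> times it changes nothing but turns the Lambert weights into
      \<open>monsky_b t\<close>. These decrease from 1, so the bound \<open>C\<close> does not
      depend on \<open>t\<close>.\<close>
    ultimately have "(\<lambda>N. (1 / of_real (1 - t)) * (\<Sum>n=1..N. \<phi> n / of_nat n) - (\<Sum>n=1..N. \<phi> n * of_real (t ^ n / (1 - t ^ n)))) \<longlonglongrightarrow> (1 / of_real (1 - t)) * 0 - S"
      by (intro tendsto_diff tendsto_mult tendsto_const lim) simp
    moreover have "(1 / of_real (1 - t)) * (\<Sum>n=1..N. \<phi> n / of_nat n) - (\<Sum>n=1..N. \<phi> n * of_real (t ^ n / (1 - t ^ n)))
       = (\<Sum>n=1..N. \<phi> n * of_real (monsky_b t n))" for N
    proof -
      have "(1 / of_real w) * (\<phi> n / of_nat n) - \<phi> n * of_real X = \<phi> n * of_real (1 / (real n * w) - X)" for w X n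
        by (simp add: right_diff_distrib mult.commute)
      then show ?thesis unfolding monsky_b_def sum_distrib_left sum_subtractf[symmetric] by (simp only:)
    qed
    ultimately have "(\<lambda>N. \<Sum>n=1..N. \<phi> n * of_real (monsky_b t n)) \<longlonglongrightarrow> - S" by simp
    then have "norm (- S) \<le> C"
    proof (rule Lim_norm_ubound[rotated])
      have "norm (\<Sum>n=1..N. \<phi> n * of_real (monsky_b t n)) \<le> C * monsky_b t 1" for N
        using monsky_b_props[OF t] by (intro abel_sum_bound C)
      then show "\<forall>\<^sub>F N in sequentially. norm (\<Sum>n=1..N. \<phi> n * of_real (monsky_b t n)) \<le> C"
        using monsky_b_props(3)[OF t, of 1] by simp
    qed simp
    then have "Re S \<le> C" using complex_Re_le_cmod[of S] by simp
    moreover have cs: "(\<lambda>n. cc n * (if n = 0 then 0 else t ^ n)) sums Re S"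
      using sums_Re[OF ls(2)] by (simp del: of_real_mult)
    have "(\<Sum>n\<in>F. cc n * (if n = 0 then 0 else t ^ n)) \<le> Re S"
    proof -
      have "(\<Sum>n\<in>F. cc n * (if n = 0 then 0 else t ^ n)) \<le> (\<Sum>n. cc n * (if n = 0 then 0 else t ^ n))"
        using cs cc_nonneg t by (intro sum_le_suminf F(1)) (auto simp: sums_iff)
      also have "\<dots> = Re S" using cs by (rule sums_unique[symmetric])
      finally show ?thesis .
    qed
    moreover have "(\<Sum>n\<in>F. cc n * (if n = 0 then 0 else t ^ n)) = (\<Sum>n\<in>F. cc n * t ^ n)"
      using F(2) by (intro sum.cong) auto
    ultimately show ?thesis by linarith
  qed
  obtain p where p: "prime p" "p dvd g" using ex_prime_dvd_modulus by blast
  obtain K :: nat where K: "real K > 2 * C" using reals_Archimedean2 by blast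
  \<comment> \<open>With this \<open>t\<close> every \<open>t ^ (p ^ k)\<close> with
    \<open>k < K\<close> is at least 1/2, so the coefficients at these powers alone contribute
    \<open>K / 2 > C\<close>.\<close>
  define t where "t = root (p ^ K) (1/2)"
  have pK: "p ^ K > 0" using p by (simp add: prime_gt_0_nat)
  have t: "0 < t" "t < 1" "t ^ (p ^ K) = 1/2"
    using pK by (auto simp: t_def)
  have inj: "inj_on (\<lambda>k. p ^ k) {..<K}" using prime_gt_Suc_0_nat[OF p(1)] by (auto simp: inj_on_def)
  have "(\<Sum>n\<in>(\<lambda>k. p ^ k) ` {..<K}. cc n * t ^ n) = (\<Sum>k<K. t ^ (p ^ k))"
    by (simp add: sum.reindex[OF inj] cc_ramified_power[OF p])
  also have "\<dots> \<ge> (\<Sum>k<K. 1/2)"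
  proof (rule sum_mono)
    fix k assume "k \<in> {..<K}"
    then have "p ^ k \<le> p ^ K" using prime_gt_0_nat[OF p(1)] by (intro power_increasing) auto
    then show "1/2 \<le> t ^ (p ^ k)" using power_decreasing[of "p ^ k" "p ^ K" t] t by simp
  qed
  finally have "real K / 2 \<le> (\<Sum>n\<in>(\<lambda>k. p ^ k) ` {..<K}. cc n * t ^ n)" by simp
  also have "\<dots> \<le> C" using t p(1) by (intro bound) (auto simp: prime_gt_0_nat)
  finally show False using K by simp
qed

end

section \<open>Nonvanishing on the line\<close>

text \<open>The limit \<open>m\<close> is the order of vanishing at \<open>z0\<close>, finite
  because the value at \<open>w\<close> excludes the zero function on the connected set.\<close>

lemma logderiv_limit:
  assumes f: "f holomorphic_on S" and S: "open S" "connected S" "z0 \<in> S" and nz: "w \<in> S" "f w \<noteq> 0"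
  shows "\<exists>m::nat. ((\<lambda>z. (z - z0) * (deriv f z / f z)) \<longlongrightarrow> of_nat m) (at z0) \<and> (m = 0 \<longleftrightarrow> f z0 \<noteq> 0)"
proof (cases "f z0 = 0")
  case False
  have "isCont f z0" using f S by (meson continuous_on_eq_continuous_at holomorphic_on_imp_continuous_on)
  moreover have "isCont (deriv f) z0"
    using holomorphic_deriv[OF f S(1)] S by (meson continuous_on_eq_continuous_at holomorphic_on_imp_continuous_on)
  ultimately have "((\<lambda>z. (z - z0) * (deriv f z / f z)) \<longlongrightarrow> (z0 - z0) * (deriv f z0 / f z0)) (at z0)"
    using False by (intro tendsto_intros) (auto simp: isCont_def)
  then show ?thesis using False by (intro exI[of _ 0]) simp
next
  case True
  have nc: "\<not> f constant_on S"
  proof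
    assume "f constant_on S"
    then obtain c where "\<And>x. x \<in> S \<Longrightarrow> f x = c" by (auto simp: constant_on_def)
    then show False using nz True S(3) by auto
  qed
  show ?thesis
  proof (rule holomorphic_factor_zero_nonconstant[OF f S True nc])
    fix h r n assume h: "0 < n" "0 < r" "ball z0 r \<subseteq> S" "h holomorphic_on ball z0 r"
        "\<And>w. w \<in> ball z0 r \<Longrightarrow> f w = (w - z0) ^ n * h w" "\<And>w. w \<in> ball z0 r \<Longrightarrow> h w \<noteq> 0"
    have z0: "z0 \<in> ball z0 r" using h by simp
    have "isCont h z0" "isCont (deriv h) z0"
      using h(4) holomorphic_deriv[OF h(4)] z0 by (meson continuous_on_eq_continuous_at holomorphic_on_imp_continuous_on open_ball)+
    then have "((\<lambda>z. of_nat n + (z - z0) * (deriv h z / h z)) \<longlongrightarrow> of_nat n + (z0 - z0) * (deriv h z0 / h z0)) (at z0)"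
      using h(6)[OF z0] by (intro tendsto_intros) (auto simp: isCont_def)
    moreover have "\<forall>\<^sub>F z in at z0. of_nat n + (z - z0) * (deriv h z / h z) = (z - z0) * (deriv f z / f z)"
      unfolding eventually_at
    proof (intro exI[of _ r] conjI ballI impI h(2))
      fix z assume z: "z \<noteq> z0 \<and> dist z z0 < r"
      then have zb: "z \<in> ball z0 r" by (simp add: dist_commute)
      have "((\<lambda>w. (w - z0) ^ n * h w) has_field_derivative (of_nat n * (z - z0) ^ (n - 1)) * h z + (z - z0) ^ n * deriv h z) (at z)"
        by (rule derivative_eq_intros holomorphic_derivI[OF h(4) open_ball zb] refl | simp)+
      then have "(f has_field_derivative (of_nat n * (z - z0) ^ (n - 1)) * h z + (z - z0) ^ n * deriv h z) (at z)"
        by (rule has_field_derivative_transform_within_open[OF _ open_ball zb]) (use h(5) in auto)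
      then have "deriv f z = (of_nat n * (z - z0) ^ (n - 1)) * h z + (z - z0) ^ n * deriv h z" by (rule DERIV_imp_deriv)
      moreover have "(z - z0) ^ n = (z - z0) * (z - z0) ^ (n - 1)" using h(1) by (cases n) auto
      moreover have "x * ((of_nat n * X) * H + (x * X) * H') / ((x * X) * H) = of_nat n + x * (H' / H)" if "x \<noteq> 0" "X \<noteq> 0" "H \<noteq> 0" for x X H H' :: complex
        using that by (simp add: field_simps)
      ultimately show "of_nat n + (z - z0) * (deriv h z / h z) = (z - z0) * (deriv f z / f z)"
        using h(5,6)[OF zb] z by simp
    qed
    ultimately have "((\<lambda>z. (z - z0) * (deriv f z / f z)) \<longlongrightarrow> of_nat n + (z0 - z0) * (deriv h z0 / h z0)) (at z0)"
      by (rule Lim_transform_eventually)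
    then show ?thesis using True h(1) by (intro exI[of _ n]) simp
  qed
qed

section \<open>The series over the class of 1 and its residues\<close>

definition mangoldt1 :: "nat \<Rightarrow> nat \<Rightarrow> real" where
  "mangoldt1 g n = (if [n = 1] (mod g) then mangoldt n else 0)"

definition Fone :: "nat \<Rightarrow> complex \<Rightarrow> complex" where
  "Fone g s = (\<Sum>n. of_real (mangoldt1 g n) * of_nat n powr (-s))"

lemma mangoldt1_nonneg: "mangoldt1 g n \<ge> 0"
  by (simp add: mangoldt1_def mangoldt_nonneg)

lemma Fone_sums:
  assumes "Re s > 1"
  shows "(\<lambda>n. of_real (mangoldt1 g n) * of_nat n powr (-s)) sums Fone g s"
proof -
  have "summable (\<lambda>n. norm (mangoldt n * (if [n = 1] (mod g) then 1 else 0) * of_nat n powr (-s) :: complex))"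
    by (rule mangoldt_abs_summable[OF _ assms]) auto
  from summable_norm_cancel[OF this] show ?thesis
    unfolding Fone_def by (intro summable_sums) (simp add: mangoldt1_def if_distrib cong: if_cong)
qed

lemma Fone_eq:
  assumes g: "g > 0" and s: "Re s > 1"
  shows "of_nat (card (dchars g)) * Fone g s = (\<Sum>\<phi>\<in>dchars g. Dfun \<phi> s)"
proof -
  have "(\<lambda>n. mangoldt n * \<phi> n * of_nat n powr (-s)) sums Dfun \<phi> s" if "\<phi> \<in> dchars g" for \<phi>
    unfolding Dfun_def
    by (intro summable_sums summable_norm_cancel[OF mangoldt_abs_summable[of \<phi>, OF _ s]] norm_dchars_le[OF that g])
  then have "(\<lambda>n. \<Sum>\<phi>\<in>dchars g. mangoldt n * \<phi> n * of_nat n powr (-s)) sums (\<Sum>\<phi>\<in>dchars g. Dfun \<phi> s)"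
    by (intro sums_sum)
  moreover have "(\<Sum>\<phi>\<in>dchars g. mangoldt n * \<phi> n * of_nat n powr (-s))
     = of_nat (card (dchars g)) * (of_real (mangoldt1 g n) * of_nat n powr (-s))" for n
  proof -
    have "(\<Sum>\<phi>\<in>dchars g. mangoldt n * \<phi> n * of_nat n powr (-s)) = mangoldt n * of_nat n powr (-s) * (\<Sum>\<phi>\<in>dchars g. \<phi> n)"
      by (simp add: sum_distrib_left mult_ac)
    then show ?thesis unfolding dchars_orthogonal[OF g] by (simp add: mangoldt1_def)
  qed
  moreover have "(\<lambda>n. of_nat (card (dchars g)) * (of_real (mangoldt1 g n) * of_nat n powr (-s))) sums (of_nat (card (dchars g)) * Fone g s)"
    using Fone_sums[OF s] by (rule sums_mult)
  ultimately show ?thesis using sums_unique2 by simp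
qed

lemma Fone_341:
  assumes "\<sigma> > 1"
  shows "Re (3 * Fone g (of_real \<sigma>) + 4 * Fone g (of_real \<sigma> + \<i> * of_real t) + Fone g (of_real \<sigma> + \<i> * of_real (2 * t))) \<ge> 0"
proof -
  let ?p = "\<lambda>n t. of_nat n powr (-(of_real \<sigma> + \<i> * of_real t)) :: complex"
  let ?T = "\<lambda>n. 3 * (of_real (mangoldt1 g n) * ?p n 0) + 4 * (of_real (mangoldt1 g n) * ?p n t) + of_real (mangoldt1 g n) * ?p n (2 * t)"
  have "?T sums (3 * Fone g (of_real \<sigma> + \<i> * of_real 0) + 4 * Fone g (of_real \<sigma> + \<i> * of_real t) + Fone g (of_real \<sigma> + \<i> * of_real (2 * t)))"
    using assms by (intro sums_add sums_mult Fone_sums) auto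
  from sums_Re[OF this] have sums: "(\<lambda>n. Re (?T n)) sums Re (3 * Fone g (of_real \<sigma>) + 4 * Fone g (of_real \<sigma> + \<i> * of_real t) + Fone g (of_real \<sigma> + \<i> * of_real (2 * t)))"
    by simp
  have "Re (?T n) \<ge> 0" for n
  proof (cases "n = 0")
    case False
    have Rep: "Re (?p n t) = real n powr (-\<sigma>) * cos (t * ln (real n))" for t
      using False by (simp add: powr_def Re_exp Ln_of_nat mult_ac)
    let ?\<theta> = "t * ln (real n)"
    have "Re (?T n) = mangoldt1 g n * real n powr (-\<sigma>) * (3 + 4 * cos ?\<theta> + cos (2 * ?\<theta>))"
    proof -
      have lin: "Re (3 * (of_real c * x) + 4 * (of_real c * y) + of_real c * w) = c * (3 * Re x + 4 * Re y + Re w)" for c x y w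
        by (simp add: algebra_simps)
      show ?thesis by (simp only: lin Rep) (simp add: algebra_simps)
    qed
    also have "3 + 4 * cos ?\<theta> + cos (2 * ?\<theta>) = 2 * (1 + cos ?\<theta>)^2"
      unfolding cos_double_cos by (simp add: power2_eq_square algebra_simps)
    finally show ?thesis using mangoldt1_nonneg[of g n] by simp
  qed simp
  then show ?thesis using sums by (rule sums_le[OF _ sums_zero])
qed

text \<open>Each logarithmic derivative of \<open>Efun\<close> has the order of vanishing
  \<open>m\<close> as its residue, and \<open>card (dchars g) * Fone g\<close> is the sum of
  \<open>- L'/L\<close> over all characters. The \<open>1\<close> at \<open>t = 0\<close> is the
  pole of the principal series.\<close>

lemma Efun_limits:
  assumes g: "g > 0"
  shows "\<exists>m :: (nat \<Rightarrow> complex) \<Rightarrow> real \<Rightarrow> nat. (\<forall>\<phi>\<in>dchars g. \<forall>t. m \<phi> t = 0 \<longleftrightarrow> Efun g \<phi> (1 + \<i> * of_real t) \<noteq> 0) \<and>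
    (\<forall>t. ((\<lambda>x. of_real x * (of_nat (card (dchars g)) * Fone g (of_real (1 + x) + \<i> * of_real t)))
            \<longlongrightarrow> of_real ((if t = 0 then 1 else 0) - real (\<Sum>\<phi>\<in>dchars g. m \<phi> t))) (at_right 0))"
proof -
  let ?S = "{s. Re s > 0}"
  have S: "open ?S" "connected ?S"
    by (auto intro: open_halfspace_Re_gt convex_connected convex_halfspace_Re_gt)
  have ex: "\<exists>m::nat. ((\<lambda>z. (z - (1 + \<i> * of_real t)) * (deriv (Efun g \<phi>) z / Efun g \<phi> z)) \<longlongrightarrow> of_nat m) (at (1 + \<i> * of_real t))
      \<and> (m = 0 \<longleftrightarrow> Efun g \<phi> (1 + \<i> * of_real t) \<noteq> 0)" if "\<phi> \<in> dchars g" for \<phi> t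
    by (rule logderiv_limit[OF Efun_holomorphic[OF g that] S, of _ 2]) (use Efun_nonzero[OF g that, of 2] in auto)
  define m :: "(nat \<Rightarrow> complex) \<Rightarrow> real \<Rightarrow> nat" where "m \<phi> t = (SOME m.
      ((\<lambda>z. (z - (1 + \<i> * of_real t)) * (deriv (Efun g \<phi>) z / Efun g \<phi> z)) \<longlongrightarrow> of_nat m) (at (1 + \<i> * of_real t))
      \<and> (m = 0 \<longleftrightarrow> Efun g \<phi> (1 + \<i> * of_real t) \<noteq> 0))" for \<phi> t
  have m1: "((\<lambda>z. (z - (1 + \<i> * of_real t)) * (deriv (Efun g \<phi>) z / Efun g \<phi> z)) \<longlongrightarrow> of_nat (m \<phi> t)) (at (1 + \<i> * of_real t))"
    and m2: "m \<phi> t = 0 \<longleftrightarrow> Efun g \<phi> (1 + \<i> * of_real t) \<noteq> 0" if "\<phi> \<in> dchars g" for \<phi> t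
    using someI_ex[OF ex[OF that, of t]] unfolding m_def[symmetric] by (rule conjunct1, rule conjunct2)
  have "((\<lambda>x. of_real x * (of_nat (card (dchars g)) * Fone g (of_real (1 + x) + \<i> * of_real t)))
            \<longlongrightarrow> of_real ((if t = 0 then 1 else 0) - real (\<Sum>\<phi>\<in>dchars g. m \<phi> t))) (at_right 0)" for t
  proof -
    let ?a = "1 + \<i> * of_real t :: complex" and ?z = "\<lambda>x::real. of_real (1 + x) + \<i> * of_real t :: complex"
    have "(?z \<longlongrightarrow> ?z 0) (at_right 0)" by (intro tendsto_intros)
    then have fl: "filterlim ?z (at ?a) (at_right 0)"
      unfolding filterlim_at by (auto simp: eventually_at_filter complex_eq_iff)
    have L: "((\<lambda>x. of_real x * (deriv (Efun g \<phi>) (?z x) / Efun g \<phi> (?z x))) \<longlongrightarrow> of_nat (m \<phi> t)) (at_right 0)" if "\<phi> \<in> dchars g" for \<phi>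
      using filterlim_compose[OF m1[OF that, of t] fl] by simp
    have P: "((\<lambda>x. of_real x * (1 / (?z x - 1))) \<longlongrightarrow> of_real (if t = 0 then 1 else 0)) (at_right 0)"
    proof (cases "t = 0")
      case True
      have "\<forall>\<^sub>F x in at_right (0::real). (1::complex) = of_real x * (1 / (?z x - 1))"
        using True by (simp add: eventually_at_filter)
      then show ?thesis using True by (simp add: tendsto_eventually eventually_mono)
    next
      case False
      have "((\<lambda>x. of_real x * (1 / (?z x - 1))) \<longlongrightarrow> of_real 0 * (1 / (?z 0 - 1))) (at_right 0)"
        using False by (intro tendsto_intros) (auto simp: complex_eq_iff)
      then show ?thesis using False by simp
    qed
    have pc: "principal_char g \<in> dchars g" by (rule principal_dchars)
    have "((\<lambda>x. of_real x * (1 / (?z x - 1)) - (\<Sum>\<phi>\<in>dchars g. of_real x * (deriv (Efun g \<phi>) (?z x) / Efun g \<phi> (?z x))))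
        \<longlongrightarrow> of_real (if t = 0 then 1 else 0) - (\<Sum>\<phi>\<in>dchars g. of_nat (m \<phi> t))) (at_right 0)"
      by (intro tendsto_diff P tendsto_sum L)
    moreover have "\<forall>\<^sub>F x in at_right 0. of_real x * (1 / (?z x - 1)) - (\<Sum>\<phi>\<in>dchars g. of_real x * (deriv (Efun g \<phi>) (?z x) / Efun g \<phi> (?z x)))
       = of_real x * (of_nat (card (dchars g)) * Fone g (?z x))"
      unfolding eventually_at_filter
    proof (intro always_eventually allI impI)
      fix x :: real assume "x \<noteq> 0" "x \<in> {0<..}"
      then have re: "Re (?z x) > 1" by simp
      have "(\<Sum>\<phi>\<in>dchars g. of_real x * (deriv (Efun g \<phi>) (?z x) / Efun g \<phi> (?z x)))
          = (\<Sum>\<phi>\<in>dchars g. of_real x * ((if \<phi> = principal_char g then 1 / (?z x - 1) else 0) - Dfun \<phi> (?z x)))"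
        by (intro sum.cong refl) (simp only: Efun_logderiv[OF g _ re])
      also have "\<dots> = of_real x * ((\<Sum>\<phi>\<in>dchars g. if \<phi> = principal_char g then 1 / (?z x - 1) else 0) - (\<Sum>\<phi>\<in>dchars g. Dfun \<phi> (?z x)))"
        by (simp only: sum_subtractf[symmetric] sum_distrib_left)
      also have "(\<Sum>\<phi>\<in>dchars g. if \<phi> = principal_char g then 1 / (?z x - 1) else 0) = 1 / (?z x - 1)"
        using finite_dchars[OF g] pc by (subst sum.delta) auto
      also have "(\<Sum>\<phi>\<in>dchars g. Dfun \<phi> (?z x)) = of_nat (card (dchars g)) * Fone g (?z x)"
        using Fone_eq[OF g re] by simp
      finally show "of_real x * (1 / (?z x - 1)) - (\<Sum>\<phi>\<in>dchars g. of_real x * (deriv (Efun g \<phi>) (?z x) / Efun g \<phi> (?z x)))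
       = of_real x * (of_nat (card (dchars g)) * Fone g (?z x))" by (simp only: right_diff_distrib) simp
    qed
    ultimately have "((\<lambda>x. of_real x * (of_nat (card (dchars g)) * Fone g (?z x))) \<longlongrightarrow> of_real (if t = 0 then 1 else 0) - (\<Sum>\<phi>\<in>dchars g. of_nat (m \<phi> t))) (at_right 0)"
      by (rule Lim_transform_eventually)
    then show ?thesis by (simp only: of_real_diff of_real_of_nat_eq of_nat_sum of_real_sum)
  qed
  then show ?thesis using m2 by (intro exI[of _ m]) simp
qed

lemma Lfun_real_1_nonzero:
  assumes g: "g > 0" and \<phi>: "\<phi> \<in> dchars g" "\<phi> \<noteq> principal_char g" and real: "\<And>n. cnj (\<phi> n) = \<phi> n"
  shows "Lfun \<phi> 1 \<noteq> 0"
proof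
  assume z: "Lfun \<phi> 1 = 0"
  define rr where "rr n = Re (\<phi> n)" for n
  have eq: "\<phi> = (\<lambda>n. complex_of_real (rr n))"
    using real by (auto simp: rr_def complex_eq_iff fun_eq_iff)
  interpret real_char g rr
    by unfold_locales (use g \<phi> in \<open>simp_all flip: eq\<close>)
  have "(\<lambda>N. \<Sum>n<Suc N. \<phi> n * of_nat n powr (-1)) \<longlonglongrightarrow> Lfun \<phi> 1"
    using Lfun_nonprincipal(2)[OF assms(2,3,1), of 1] unfolding sums_def by (intro LIMSEQ_Suc) simp
  moreover have "(\<Sum>n<Suc N. \<phi> n * of_nat n powr (-1)) = (\<Sum>n=1..N. \<phi> n / of_nat n)" for N
  proof -
    have "{..<Suc N} = insert 0 {1..N}" by auto
    moreover have "(\<Sum>n=1..N. \<phi> n * of_nat n powr (-1)) = (\<Sum>n=1..N. \<phi> n / of_nat n)"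
      by (intro sum.cong) (auto simp: powr_minus_divide)
    ultimately show ?thesis by simp
  qed
  ultimately have "(\<lambda>N. \<Sum>n=1..N. \<phi> n / of_nat n) \<longlonglongrightarrow> 0" using z by simp
  then show False using harmonic_char_sum_nonzero unfolding eq by simp
qed

lemma Efun_nonzero_on_line:
  assumes g: "g > 0" and \<phi>: "\<phi> \<in> dchars g"
  shows "Efun g \<phi> (1 + \<i> * of_real t) \<noteq> 0"
proof -
  obtain m where m0: "\<And>\<phi> t. \<phi> \<in> dchars g \<Longrightarrow> m \<phi> t = 0 \<longleftrightarrow> Efun g \<phi> (1 + \<i> * of_real t) \<noteq> 0"
    and lim: "\<And>t. ((\<lambda>x. of_real x * (of_nat (card (dchars g)) * Fone g (of_real (1 + x) + \<i> * of_real t)))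
            \<longlongrightarrow> of_real ((if t = 0 then 1 else 0) - real (\<Sum>\<phi>\<in>dchars g. m \<phi> t))) (at_right 0)"
    using Efun_limits[OF g] by blast
  define M where "M t = (\<Sum>\<phi>\<in>dchars g. m \<phi> t)" for t
  \<comment> \<open>\<open>M t\<close> counts the zeros at \<open>1 + \<i> t\<close> of all
    characters. For \<open>t \<noteq> 0\<close> the inequality says
    \<open>3 M(0) + 4 M(t) + M(2t) \<le> 3\<close>, hence \<open>M(t) = 0\<close>; at
    \<open>t = 0\<close> it says \<open>8 (1 - M(0)) \<ge> 0\<close>, hence
    \<open>M(0) \<le> 1\<close>.\<close>
  have ineq: "0 \<le> 3 * (1 - real (M 0)) + 4 * ((if t = 0 then 1 else 0) - real (M t)) + ((if t = 0 then 1 else 0) - real (M (2 * t)))" for t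
  proof (rule tendsto_lowerbound)
    let ?F = "\<lambda>t x. of_real x * (of_nat (card (dchars g)) * Fone g (of_real (1 + x) + \<i> * of_real t))"
    have "((\<lambda>x. Re (3 * ?F 0 x + 4 * ?F t x + ?F (2 * t) x)) \<longlongrightarrow>
      Re (3 * of_real ((if (0::real) = 0 then 1 else 0) - real (M 0)) + 4 * of_real ((if t = 0 then 1 else 0) - real (M t))
        + of_real ((if 2 * t = 0 then 1 else 0) - real (M (2 * t))))) (at_right 0)"
      unfolding M_def by (intro tendsto_Re tendsto_add tendsto_mult tendsto_const lim)
    then show "((\<lambda>x. Re (3 * ?F 0 x + 4 * ?F t x + ?F (2 * t) x)) \<longlongrightarrow>
       3 * (1 - real (M 0)) + 4 * ((if t = 0 then 1 else 0) - real (M t)) + ((if t = 0 then 1 else 0) - real (M (2 * t)))) (at_right 0)"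
      by simp
    show "\<forall>\<^sub>F x in at_right 0. 0 \<le> Re (3 * ?F 0 x + 4 * ?F t x + ?F (2 * t) x)"
      unfolding eventually_at_filter
    proof (intro always_eventually allI impI)
      fix x :: real assume "x \<noteq> 0" and x: "x \<in> {0<..}"
      have "3 * ?F 0 x + 4 * ?F t x + ?F (2 * t) x = of_real (x * real (card (dchars g))) *
         (3 * Fone g (of_real (1 + x)) + 4 * Fone g (of_real (1 + x) + \<i> * of_real t) + Fone g (of_real (1 + x) + \<i> * of_real (2 * t)))"
        by (simp add: algebra_simps)
      then have "Re (3 * ?F 0 x + 4 * ?F t x + ?F (2 * t) x) = (x * real (card (dchars g))) *
         Re (3 * Fone g (of_real (1 + x)) + 4 * Fone g (of_real (1 + x) + \<i> * of_real t) + Fone g (of_real (1 + x) + \<i> * of_real (2 * t)))"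
        by (simp only: Re_complex_of_real Im_complex_of_real times_complex.sel mult_zero_left diff_zero)
      then show "0 \<le> Re (3 * ?F 0 x + 4 * ?F t x + ?F (2 * t) x)"
        using Fone_341[of "1 + x" g t] x by (simp only:) (intro mult_nonneg_nonneg; simp)
    qed
  qed simp
  have Mge: "m \<psi> t \<le> M t" if "\<psi> \<in> dchars g" for \<psi> t
    unfolding M_def using finite_dchars[OF g] that by (intro member_le_sum) auto
  have "m \<phi> t = 0"
  proof (cases "t = 0")
    case False
    have "real (M t) < 1" using ineq[of t] False by simp
    then show ?thesis using Mge[OF \<phi>, of t] by simp
  next
    case True
    have M0: "M 0 \<le> 1" using ineq[of 0] by simp
    show ?thesis
    proof (rule ccontr)
      assume "m \<phi> t \<noteq> 0"
      then have z: "Efun g \<phi> 1 = 0" and m\<phi>: "m \<phi> 0 \<ge> 1" using m0[OF \<phi>, of 0] True by auto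
      then have np: "\<phi> \<noteq> principal_char g" using Efun_principal_1[OF g] by auto
      then have L: "Lfun \<phi> 1 = 0" using z by (simp add: Efun_def)
      \<comment> \<open>At the real point 1 the conjugate character has the conjugate L-value, so it
        vanishes too; were it different from \<phi>, the count \<open>M 0\<close> would be at least
        2.\<close>
      let ?\<psi> = "\<lambda>n. cnj (\<phi> n)"
      have \<psi>: "?\<psi> \<in> dchars g" using cnj_dchars[OF \<phi>] .
      have np\<psi>: "?\<psi> \<noteq> principal_char g"
      proof
        assume "?\<psi> = principal_char g"
        then have "\<phi> n = principal_char g n" for n
          by (metis complex_cnj_cnj complex_cnj_one complex_cnj_zero principal_char_def)
        then show False using np by blast
      qed
      have "(\<lambda>n. cnj (\<phi> n * of_nat n powr (-1))) sums cnj 0"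
        using Lfun_nonprincipal(2)[OF \<phi> np g, of 1] L by (subst sums_cnj) simp
      moreover have "cnj (\<phi> n * of_nat n powr (-1)) = ?\<psi> n * of_nat n powr (-1)" for n
        by (cases "n = 0") (auto simp: powr_minus_divide)
      ultimately have "(\<lambda>n. ?\<psi> n * of_nat n powr (-1)) sums cnj 0" by (simp only:)
      then have "Lfun ?\<psi> 1 = 0" unfolding Lfun_def by (simp add: sums_iff)
      then have m\<psi>: "m ?\<psi> 0 \<ge> 1" using m0[OF \<psi>, of 0] np\<psi> by (simp add: Efun_def)
      have "?\<psi> = \<phi>"
      proof (rule ccontr)
        assume ne: "?\<psi> \<noteq> \<phi>"
        have "m ?\<psi> 0 + m \<phi> 0 = (\<Sum>\<chi>'\<in>{?\<psi>, \<phi>}. m \<chi>' 0)" using ne by simp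
        also have "\<dots> \<le> M 0" unfolding M_def using finite_dchars[OF g] \<phi> \<psi> by (intro sum_mono2) auto
        finally show False using M0 m\<phi> m\<psi> by simp
      qed
      then have "cnj (\<phi> n) = \<phi> n" for n by (rule fun_cong)
      then show False using Lfun_real_1_nonzero[OF g \<phi> np] L by simp
    qed
  qed
  then show ?thesis using m0[OF \<phi>] by blast
qed

text \<open>The finitely many functions \<open>Efun\<close> have no zeros on
  \<open>Re s \<ge> 1\<close>, so the set where none of them vanishes is an open neighbourhood of
  that half-plane, and all their logarithmic derivatives are holomorphic there.\<close>

lemma Fone_extension:
  assumes g: "g > 0"
  obtains U h where "open U" "{s. Re s \<ge> 1} \<subseteq> U" "U \<subseteq> {s. Re s > 0}" "h holomorphic_on U"
    "\<And>s. Re s > 1 \<Longrightarrow> Fone g s = 1 / of_nat (card (dchars g)) / (s - 1) + h s"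
proof -
  define U where "U = {s. Re s > 0} \<inter> (\<Inter>\<phi>\<in>dchars g. {s. Re s > 0} \<inter> Efun g \<phi> -` (-{0}))"
  have "open U" unfolding U_def
    by (intro open_Int open_halfspace_Re_gt open_INT finite_dchars[OF g] ballI
        continuous_open_preimage holomorphic_on_imp_continuous_on[OF Efun_holomorphic[OF g]]) auto
  moreover have "{s. Re s \<ge> 1} \<subseteq> U"
  proof
    fix s assume "s \<in> {s. Re s \<ge> 1}"
    then consider "Re s > 1" | "Re s = 1" by force
    then have "Efun g \<phi> s \<noteq> 0" if "\<phi> \<in> dchars g" for \<phi>
    proof cases
      case 2
      then have "s = 1 + \<i> * of_real (Im s)" by (simp add: complex_eq_iff)
      then show ?thesis using Efun_nonzero_on_line[OF g that, of "Im s"] by metis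
    qed (use Efun_nonzero[OF g that] in auto)
    then show "s \<in> U" using \<open>s \<in> _\<close> by (auto simp: U_def)
  qed
  moreover have "U \<subseteq> {s. Re s > 0}" by (auto simp: U_def)
  moreover define h where "h s = - (\<Sum>\<phi>\<in>dchars g. deriv (Efun g \<phi>) s / Efun g \<phi> s) / of_nat (card (dchars g))" for s
  have cne: "card (dchars g) \<noteq> 0" using finite_dchars[OF g] principal_dchars[of g] by auto
  have Une: "Efun g \<phi> s \<noteq> 0" if "s \<in> U" "\<phi> \<in> dchars g" for s \<phi>
    using that unfolding U_def by blast
  have "h holomorphic_on U"
    unfolding h_def
    by (intro holomorphic_intros holomorphic_on_subset[OF Efun_holomorphic[OF g] \<open>U \<subseteq> _\<close>]
         holomorphic_on_subset[OF holomorphic_deriv[OF Efun_holomorphic[OF g] open_halfspace_Re_gt] \<open>U \<subseteq> _\<close>])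
      (use cne Une \<open>open U\<close> in auto)
  moreover have "Fone g s = 1 / of_nat (card (dchars g)) / (s - 1) + h s" if s: "Re s > 1" for s
  proof -
    have "(\<Sum>\<phi>\<in>dchars g. deriv (Efun g \<phi>) s / Efun g \<phi> s) = (\<Sum>\<phi>\<in>dchars g. (if \<phi> = principal_char g then 1 / (s - 1) else 0) - Dfun \<phi> s)"
      by (intro sum.cong refl) (simp only: Efun_logderiv[OF g _ s])
    also have "\<dots> = 1 / (s - 1) - of_nat (card (dchars g)) * Fone g s"
      unfolding sum_subtractf Fone_eq[OF g s] using finite_dchars[OF g] principal_dchars[of g] by (subst sum.delta) auto
    finally have eq: "(\<Sum>\<phi>\<in>dchars g. deriv (Efun g \<phi>) s / Efun g \<phi> s) = 1 / (s - 1) - of_nat (card (dchars g)) * Fone g s" .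
    have "F = 1 / c / x + - (1 / x - c * F) / c" if "c \<noteq> 0" for F c x :: complex
      using that by (simp add: diff_divide_distrib mult.commute)
    then show ?thesis unfolding h_def eq using cne by simp
  qed
  ultimately show ?thesis by (rule that)
qed

section \<open>Primes congruent to one\<close>

definition psi1 :: "nat \<Rightarrow> nat \<Rightarrow> real" where
  "psi1 g n = (\<Sum>k=1..n. mangoldt1 g k)"

lemma psi1_bounds: "0 \<le> psi1 g n" "psi1 g n \<le> 5 * real n"
proof -
  show "0 \<le> psi1 g n" unfolding psi1_def by (intro sum_nonneg mangoldt1_nonneg)
  have "psi1 g n \<le> (\<Sum>k=1..n. mangoldt k)"
    unfolding psi1_def by (intro sum_mono) (auto simp: mangoldt1_def mangoldt_nonneg)
  also have "\<dots> \<le> 5 * real n" by (rule chebyshev_psi_le)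
  finally show "psi1 g n \<le> 5 * real n" .
qed

lemma psi1_mono: "m \<le> n \<Longrightarrow> psi1 g m \<le> psi1 g n"
  unfolding psi1_def by (intro sum_mono2) (auto simp: mangoldt1_nonneg)

text \<open>\<open>s \<Sum> \<psi>(n) n\<^sup>-\<^sup>s\<^sup>-\<^sup>1 = Fone g s + Wfun g s\<close>, by partial summation.\<close>

definition Wfun :: "nat \<Rightarrow> complex \<Rightarrow> complex" where
  "Wfun g s = (\<Sum>n. of_real (psi1 g n) * powr_err n s)"

lemma Wfun_holomorphic: "Wfun g holomorphic_on {s. Re s > 0}"
  and Wfun_sums: "Re s > 0 \<Longrightarrow> (\<lambda>n. of_real (psi1 g n) * powr_err n s) sums Wfun g s"
proof -
  have hol: "(\<lambda>s. of_real (psi1 g n) * powr_err n s) holomorphic_on {s. Re s > 0}" for n by (intro holomorphic_intros)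
  have le: "norm (of_real (psi1 g n) * powr_err n s) \<le> 5 * (1 + norm s)^2 * real n powr (0 - 1 - Re s)" if "n > 0" "Re s > 0" for n s
  proof -
    have "norm (of_real (psi1 g n) * powr_err n s) \<le> (5 * real n) * (norm s * norm (s + 1) * real n powr (- Re s - 2))"
      unfolding norm_mult norm_of_real using that psi1_bounds[of g n] by (intro mult_mono norm_powr_err_le) auto
    also have "\<dots> = 5 * (norm s * norm (s + 1)) * (real n powr 1 * real n powr (- Re s - 2))" by simp
    also have "real n powr 1 * real n powr (- Re s - 2) = real n powr (0 - 1 - Re s)"
      unfolding powr_add[symmetric] by (simp add: algebra_simps)
    also have "5 * (norm s * norm (s + 1)) * \<dots> \<le> 5 * ((1 + norm s) * (1 + norm s)) * \<dots>"
      using norm_triangle_ineq[of s 1] by (intro mult_mono mult_left_mono) auto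
    finally show ?thesis by (simp only: power2_eq_square)
  qed
  note ser = holomorphic_powr_series[where \<kappa> = 0 and M = 5 and f = "\<lambda>n s. of_real (psi1 g n) * powr_err n s", OF deriv_if_holomorphic_halfplane[OF hol] le]
  show "Wfun g holomorphic_on {s. Re s > 0}" unfolding Wfun_def using ser(1) by auto
  show "Re s > 0 \<Longrightarrow> (\<lambda>n. of_real (psi1 g n) * powr_err n s) sums Wfun g s"
    unfolding Wfun_def using ser(2)[of s] by (auto intro: summable_sums)
qed

text \<open>Exchanges the unbounded coefficients \<open>mangoldt1 g n\<close> for
  \<open>psi1 g n / n\<close>, which lie between 0 and 5. By its definition \<open>powr_err\<close>
  completes the telescoping difference to exactly \<open>s * n powr (-s - 1)\<close>.\<close>

lemma psi1_dirichlet_sums: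
  assumes s: "Re s > 1"
  shows "(\<lambda>n. of_real (psi1 g n / real n) * of_nat n powr (-s)) sums ((Fone g s + Wfun g s) / s)"
proof -
  have b: "norm (\<Sum>k=1..n. of_real (mangoldt1 g k) :: complex) \<le> 5 * real n powr 1" if "n > 0" for n
    using psi1_bounds[of g n] that by (simp add: psi1_def flip: of_real_sum)
  note parts = dirichlet_series_by_parts[where a = "\<lambda>n. of_real (mangoldt1 g n)" and \<kappa> = 1 and C = 5, OF b]
  have S: "(\<Sum>k=1..n. of_real (mangoldt1 g k) :: complex) = of_real (psi1 g n)" for n by (simp add: psi1_def)
  have "(\<lambda>n. of_real (psi1 g n) * (of_nat n powr (-s) - of_nat (Suc n) powr (-s))) sums Fone g s"
    using parts(1)[where s = s] parts(3)[where s = s] s unfolding S Fone_def by (simp add: sums_iff)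
  from sums_add[OF this Wfun_sums[of s]] s
  have "(\<lambda>n. of_real (psi1 g n) * (of_nat n powr (-s) - of_nat (Suc n) powr (-s)) + of_real (psi1 g n) * powr_err n s) sums (Fone g s + Wfun g s)" by simp
  from sums_divide[OF this, of s]
  have "(\<lambda>n. (of_real (psi1 g n) * (of_nat n powr (-s) - of_nat (Suc n) powr (-s)) + of_real (psi1 g n) * powr_err n s) / s) sums ((Fone g s + Wfun g s) / s)" .
  moreover have "(of_real (psi1 g n) * (of_nat n powr (-s) - of_nat (Suc n) powr (-s)) + of_real (psi1 g n) * powr_err n s) / s = of_real (psi1 g n / real n) * of_nat n powr (-s)" for n
  proof (cases "n = 0")
    case False
    have s0: "s \<noteq> 0" using s by auto
    have "of_real (psi1 g n) * (of_nat n powr (-s) - of_nat (Suc n) powr (-s)) + of_real (psi1 g n) * powr_err n s = of_real (psi1 g n) * (s * of_nat n powr (-s - 1))"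
      by (simp add: powr_err_def algebra_simps)
    moreover have "of_nat n powr (-s - 1) = of_nat n powr (-s) / (of_nat n :: complex)" using False by (simp add: powr_diff)
    ultimately show ?thesis using s0 by simp
  qed (simp add: psi1_def)
  ultimately show ?thesis by simp
qed

lemma psi1_harmonic_convergent:
  assumes g: "g > 0"
  shows "convergent (\<lambda>N. \<Sum>n=1..N. (psi1 g n / real n - 1 / real (card (dchars g))) / real n)"
proof -
  define c where "c = 1 / real (card (dchars g))"
  obtain U h where U: "open U" "{s. Re s \<ge> 1} \<subseteq> U" "U \<subseteq> {s. Re s > 0}" "h holomorphic_on U"
    and Fo: "\<And>s. Re s > 1 \<Longrightarrow> Fone g s = 1 / of_nat (card (dchars g)) / (s - 1) + h s"
    using Fone_extension[OF g] by blast
  \<comment> \<open>The pole of \<open>Fone g s / s\<close> is split by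
    \<open>1 / (s (s - 1)) = 1 / (s - 1) - 1 / s\<close>. Subtracting \<open>c\<close> times zeta
    cancels \<open>c / (s - 1)\<close>, since \<open>xi_zeta 1 = 1\<close>, and leaves a difference
    quotient of \<open>xi_zeta\<close>, filled in at \<open>s = 1\<close>.\<close>
  define F where "F s = (h s + Wfun g s) / s - of_real c / s
     - of_real c * (if s = 1 then deriv xi_zeta 1 else (xi_zeta s - xi_zeta 1) / (s - 1))" for s
  have Fh: "F holomorphic_on U"
    unfolding F_def
    by (intro holomorphic_intros U(4) pole_lemma holomorphic_on_subset[OF Wfun_holomorphic U(3)]
         holomorphic_on_subset[OF xi_zeta_holomorphic U(3)])
       (use U in \<open>auto simp: interior_open\<close>)
  have bd: "norm (complex_of_real (psi1 g n / real n - c)) \<le> 5 + c" for n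
  proof -
    have "0 \<le> psi1 g n / real n" "psi1 g n / real n \<le> 5" using psi1_bounds[of g n] by (auto simp: divide_le_eq)
    moreover have "c \<ge> 0" by (simp add: c_def)
    ultimately show ?thesis unfolding norm_of_real by linarith
  qed
  have "(\<lambda>n. complex_of_real (psi1 g n / real n - c) * of_nat n powr (-s)) sums F s" if s: "Re s > 1" for s
  proof -
    have "summable (\<lambda>n. 1 * of_nat n powr (-s) :: complex)"
      by (rule summable_norm_cancel[OF bounded_dirichlet_abs_summable[of "\<lambda>_. 1" 1]]) (use s in auto)
    then have "(\<lambda>n. of_real c * (1 * of_nat n powr (-s))) sums (of_real c * Lfun (\<lambda>_. 1) s)"
      unfolding Lfun_def by (intro sums_mult summable_sums)
    from sums_diff[OF psi1_dirichlet_sums[OF s, of g] this]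
    have "(\<lambda>n. complex_of_real (psi1 g n / real n - c) * of_nat n powr (-s)) sums ((Fone g s + Wfun g s) / s - of_real c * Lfun (\<lambda>_. 1) s)"
      by (simp add: left_diff_distrib)
    moreover have "(Fone g s + Wfun g s) / s - of_real c * Lfun (\<lambda>_. 1) s = F s"
    proof -
      have nz: "s \<noteq> 0" "s - 1 \<noteq> 0" "s \<noteq> 1" using s by auto
      have L: "Lfun (\<lambda>_. 1) s = xi_zeta s / (s - 1)" using xi_zeta_eq[OF s] nz by simp
      have "Fone g s = of_real c / (s - 1) + h s" using Fo[OF s] by (simp add: c_def)
      moreover have "(C / (s - 1) + H + W) / s - C * (X / (s - 1)) = (H + W) / s - C / s - C * ((X - 1) / (s - 1))" for C H W X :: complex
        using nz by (simp add: divide_simps) (simp add: algebra_simps)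
      ultimately show ?thesis using nz unfolding F_def L xi_zeta_1 by simp
    qed
    ultimately show ?thesis by simp
  qed
  from newman_tauberian[where a = "\<lambda>n. complex_of_real (psi1 g n / real n - c)", OF bd U(1,2) Fh this]
  have *: "(\<lambda>N. \<Sum>n=1..N. complex_of_real (psi1 g n / real n - c) / of_nat n) \<longlonglongrightarrow> F 1" .
  have "(\<lambda>N. \<Sum>n=1..N. (psi1 g n / real n - c) / real n) \<longlonglongrightarrow> Re (F 1)"
  proof -
    have "Re (of_real x / of_nat n) = x / real n" for x n
      by (metis Re_complex_of_real of_real_divide of_real_of_nat_eq)
    then show ?thesis using tendsto_Re[OF *] by (simp only: Re_sum)
  qed
  then show ?thesis unfolding c_def convergent_def by blast
qed

text \<open>Over a window of length about \<open>n / K\<close> the sum is small by the Cauchy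
  property, while monotonicity bounds every summand by means of one end of the window. The window to
  the right of \<open>n\<close> (via \<open>A\<close>) bounds \<open>f n\<close> from above, the one
  to the left (via \<open>B\<close>) from below.\<close>

lemma harmonic_average_limit:
  fixes f :: "nat \<Rightarrow> real"
  assumes mono: "\<And>m n. m \<le> n \<Longrightarrow> f m \<le> f n" and c: "c > 0" and f0: "\<And>n. f n \<ge> 0"
    and conv: "convergent (\<lambda>N. \<Sum>n=1..N. (f n / real n - c) / real n)"
  shows "(\<lambda>n. f n / real n) \<longlonglongrightarrow> c"
proof -
  define T where "T N = (\<Sum>n=1..N. (f n / real n - c) / real n)" for N
  have Cau: "Cauchy T" using conv convergent_Cauchy unfolding T_def by blast
  have D: "T m - T n = (\<Sum>k=Suc n..m. (f k / real k - c) / real k)" if "n \<le> m" for m n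
  proof -
    have "{1..m} = {1..n} \<union> {Suc n..m}" using that by auto
    then show ?thesis unfolding T_def by (simp add: sum.union_disjoint)
  qed
  have A: "real (m - n) * (f n / real m^2 - c / real n) \<le> T m - T n" if "0 < n" "n \<le> m" for m n
  proof -
    have "(\<Sum>k=Suc n..m. f n / real m^2 - c / real n) \<le> (\<Sum>k=Suc n..m. (f k / real k - c) / real k)"
    proof (rule sum_mono)
      fix k assume k: "k \<in> {Suc n..m}"
      have "f n / real m^2 \<le> f k / real k^2"
        using k that mono[of n k] f0[of n] by (intro frac_le power_mono) auto
      moreover have "c / real k \<le> c / real n" using k that c by (intro divide_left_mono) auto
      ultimately show "f n / real m^2 - c / real n \<le> (f k / real k - c) / real k"
        by (simp add: diff_divide_distrib power2_eq_square)
    qed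
    then show ?thesis unfolding D[OF that(2)] by simp
  qed
  have B: "T m - T n \<le> real (m - n) * (f m / real n^2 - c / real m)" if "0 < n" "n \<le> m" for m n
  proof -
    have "(\<Sum>k=Suc n..m. (f k / real k - c) / real k) \<le> (\<Sum>k=Suc n..m. f m / real n^2 - c / real m)"
    proof (rule sum_mono)
      fix k assume k: "k \<in> {Suc n..m}"
      have "f k / real k^2 \<le> f m / real n^2"
        using k that mono[of k m] f0[of m] by (intro frac_le power_mono) auto
      moreover have "c / real m \<le> c / real k" using k that c by (intro divide_left_mono) auto
      ultimately show "(f k / real k - c) / real k \<le> f m / real n^2 - c / real m"
        by (simp add: diff_divide_distrib power2_eq_square)
    qed
    then show ?thesis unfolding D[OF that(2)] by simp
  qed
  have resc: "y / x = (m / x)^2 * (x * (y / m^2))" if "x \<noteq> 0" "m \<noteq> 0" for x y m :: real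
    using that by (simp add: power2_eq_square field_simps)
  have ev: "\<forall>\<^sub>F n in sequentially. f n / real n \<le> (1 + 1 / real K)^2 * (c + 1 / real K) \<and> (1 - 1 / real K)^2 * (c - 1 / real K) \<le> f n / real n"
    if K: "K > 1" "1 / real K < c" for K
  proof -
    \<comment> \<open>Division by the window length \<open>q \<ge> n / (2 K)\<close> and
      multiplication by \<open>n\<close> enlarge \<delta> at most to
      \<open>2 K * \<delta> = 1 / K\<close>.\<close>
    define \<delta> where "\<delta> = 1 / (2 * real K^2)"
    have \<delta>: "\<delta> > 0" using K by (simp add: \<delta>_def)
    obtain n0 where n0: "\<And>m n. m \<ge> n0 \<Longrightarrow> n \<ge> n0 \<Longrightarrow> dist (T m) (T n) < \<delta>"
      using Cau \<delta> unfolding Cauchy_def by metis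
    \<comment> \<open>\<open>n \<ge> 2 K\<close> limits the rounding loss in \<open>n div K\<close>
      to a factor 2, and \<open>n \<ge> 2 n0\<close> keeps the start
      \<open>n - q \<ge> n / 2\<close> of the left window beyond \<open>n0\<close>.\<close>
    show ?thesis using eventually_ge_at_top[of "2 * K + 2 * n0"]
    proof eventually_elim
      case (elim n)
      define q where "q = n div K"
      have q: "real q \<le> real n / real K" "real q \<ge> real n / (2 * real K)"
      proof -
        show "real q \<le> real n / real K" unfolding q_def by (rule of_nat_div_le_of_nat)
        have "n \<le> (n div K + 1) * K" using dividend_less_div_times[of K n] K by (simp add: algebra_simps)
        then have "real n \<le> real ((q + 1) * K)" unfolding q_def by (simp only: of_nat_le_iff)
        then have "real n / real K - 1 \<le> real q" using K by (simp add: field_simps)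
        moreover have "real n / real K \<ge> 2" using elim K by (simp add: field_simps)
        ultimately show "real q \<ge> real n / (2 * real K)" by (simp add: field_simps)
      qed
      have n: "n > 0" "real n > 0" using elim K by auto
      have qpos: "real q > 0" using q(2) n K by (intro less_le_trans[OF _ q(2)]) simp
      have nq: "real n / real q \<le> 2 * real K" using q(2) qpos K by (simp add: field_simps)
      have \<delta>K: "(2 * real K) * \<delta> = 1 / real K" using K by (simp add: \<delta>_def power2_eq_square)
      have qn2: "q \<le> n div 2" unfolding q_def using K by (intro div_le_mono2) auto
      have up: "f n / real n \<le> (1 + 1 / real K)^2 * (c + 1 / real K)"
      proof -
        let ?m = "n + q"
        have "T ?m - T n < \<delta>" using n0[of ?m n] elim by (simp add: dist_real_def)
        then have "real q * (f n / real ?m^2 - c / real n) < \<delta>" using A[of n ?m] n by simp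
        then have "f n / real ?m^2 - c / real n < \<delta> / real q" using qpos by (simp add: field_simps)
        then have "f n / real ?m^2 < c / real n + \<delta> / real q" by simp
        then have "real n * (f n / real ?m^2) < real n * (c / real n + \<delta> / real q)" using n by (intro mult_strict_left_mono)
        also have "\<dots> = c + (real n / real q) * \<delta>" using n by (simp add: distrib_left)
        also have "\<dots> \<le> c + (2 * real K) * \<delta>" using nq \<delta> by (intro add_left_mono mult_right_mono) auto
        finally have l: "real n * (f n / real ?m^2) < c + 1 / real K" unfolding \<delta>K .
        have "f n / real n = (real ?m / real n)^2 * (real n * (f n / real ?m^2))"
          using n by (intro resc) auto
        also have "\<dots> \<le> (1 + 1 / real K)^2 * (c + 1 / real K)"
        proof (intro mult_mono power_mono)
          show "real ?m / real n \<le> 1 + 1 / real K" using q(1) n K by (simp add: field_simps)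
        qed (use l f0[of n] n in auto)
        finally show ?thesis .
      qed
      have low: "(1 - 1 / real K)^2 * (c - 1 / real K) \<le> f n / real n"
      proof -
        let ?n = "n - q"
        have q2: "q \<le> n" "0 < ?n" "n0 \<le> ?n" using qn2 n elim K by linarith+
        have "- \<delta> < T n - T ?n" using n0[of n ?n] elim q2 by (simp add: dist_real_def)
        then have "- \<delta> < real q * (f n / real ?n^2 - c / real n)" using B[of ?n n] q2 by simp
        then have "c / real n - \<delta> / real q < f n / real ?n^2" using qpos by (simp add: field_simps)
        then have "real n * (c / real n - \<delta> / real q) < real n * (f n / real ?n^2)" using n by (intro mult_strict_left_mono)
        moreover have "real n * (c / real n - \<delta> / real q) = c - (real n / real q) * \<delta>" using n by (simp add: right_diff_distrib)
        moreover have "c - (2 * real K) * \<delta> \<le> c - (real n / real q) * \<delta>" using nq \<delta> by (intro diff_left_mono mult_right_mono) auto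
        ultimately have l: "c - 1 / real K < real n * (f n / real ?n^2)" unfolding \<delta>K by linarith
        have "(1 - 1 / real K)^2 * (c - 1 / real K) \<le> (real ?n / real n)^2 * (real n * (f n / real ?n^2))"
        proof (intro mult_mono power_mono)
          show "1 - 1 / real K \<le> real ?n / real n" using q(1) n K q2 by (simp add: field_simps of_nat_diff)
        qed (use l K in auto)
        also have "\<dots> = f n / real n"
          using n q2 by (intro resc[symmetric]) auto
        finally show ?thesis .
      qed
      show ?case using up low by simp
    qed
  qed
  show ?thesis
  proof (rule tendstoI)
    fix e :: real assume e: "e > 0"
    have "(\<lambda>K. (1 + 1 / real K)^2 * (c + 1 / real K)) \<longlonglongrightarrow> (1 + 0)^2 * (c + 0)"
      "(\<lambda>K. (1 - 1 / real K)^2 * (c - 1 / real K)) \<longlonglongrightarrow> (1 - 0)^2 * (c - 0)" "(\<lambda>K. 1 / real K) \<longlonglongrightarrow> 0"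
      by (intro tendsto_intros lim_1_over_n)+
    then have "\<forall>\<^sub>F K in sequentially. (1 + 1 / real K)^2 * (c + 1 / real K) < c + e"
       "\<forall>\<^sub>F K in sequentially. (1 - 1 / real K)^2 * (c - 1 / real K) > c - e" "\<forall>\<^sub>F K in sequentially. 1 / real K < c"
      using e c by (auto intro: order_tendstoD)
    then have "\<forall>\<^sub>F K in sequentially. (1 + 1 / real K)^2 * (c + 1 / real K) < c + e \<and> (1 - 1 / real K)^2 * (c - 1 / real K) > c - e \<and> 1 / real K < c \<and> K > 1"
      using eventually_gt_at_top[of 1] by (simp add: eventually_conj_iff)
    then obtain K where K: "(1 + 1 / real K)^2 * (c + 1 / real K) < c + e" "(1 - 1 / real K)^2 * (c - 1 / real K) > c - e" "1 / real K < c" "K > 1"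
      using eventually_happens'[OF sequentially_bot] by blast
    show "\<forall>\<^sub>F n in sequentially. dist (f n / real n) c < e"
      using ev[OF K(4,3)] by eventually_elim (use K in \<open>auto simp: dist_real_def abs_less_iff\<close>)
  qed
qed

theorem prime_number_theorem_one_mod:
  assumes g: "g > 0"
  shows "(\<lambda>n. psi1 g n / real n) \<longlonglongrightarrow> 1 / real (card (dchars g))"
proof (rule harmonic_average_limit[OF psi1_mono _ psi1_bounds(1) psi1_harmonic_convergent[OF g]])
  show "1 / real (card (dchars g)) > 0"
    using finite_dchars[OF g] principal_dchars[of g] by (auto simp: card_gt_0_iff)
qed

text \<open>A prime power \<open>p ^ j \<le> M\<close> with \<open>j \<ge> 2\<close> has
  \<open>p \<le> sqrt M\<close> and \<open>j \<le> log 2 M\<close>, so there are few of them, each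
  of weight at most \<open>ln M\<close>.\<close>

lemma prime_power_sum_le:
  assumes "M > 0"
  shows "(\<Sum>k\<in>{k\<in>{1..M}. \<not> prime k}. mangoldt1 g k) \<le> (sqrt (real M) + 1) * (log 2 (real M) + 1) * ln (real M)"
proof -
  define s where "s = nat \<lfloor>sqrt (real M)\<rfloor>"
  define l where "l = nat \<lfloor>log 2 (real M)\<rfloor>"
  let ?P = "{k\<in>{1..M}. \<not> prime k \<and> primepow k}"
  have "?P \<subseteq> (\<lambda>(b, j). b ^ j) ` ({..s} \<times> {..l})"
  proof
    fix k assume k: "k \<in> ?P"
    then obtain p j where pj: "prime p" "j > 0" "k = p ^ j" by (auto simp: primepow_def)
    have "j \<noteq> 1" using k pj by auto
    then have "p ^ 2 \<le> p ^ j" using pj prime_gt_0_nat[OF pj(1)] by (intro power_increasing) auto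
    then have "p ^ 2 \<le> M" using k pj by simp
    then have "real p ^ 2 \<le> real M" by (metis of_nat_le_iff of_nat_power)
    then have "real p \<le> sqrt (real M)" by (simp add: real_le_rsqrt)
    then have "p \<le> s" unfolding s_def by (simp add: le_nat_floor)
    have "2 ^ j \<le> p ^ j" using prime_ge_2_nat[OF pj(1)] by (intro power_mono) auto
    also have "\<dots> \<le> M" using k pj by simp
    finally have "2 ^ j \<le> M" .
    then have "real (2 ^ j) \<le> real M" by (simp only: of_nat_le_iff)
    then have "log 2 (2 powr real j) \<le> log 2 (real M)" using assms by (intro log_mono) (auto simp: powr_realpow)
    then have "real j \<le> log 2 (real M)" by simp
    then have "j \<le> l" unfolding l_def by (simp add: le_nat_floor)
    then show "k \<in> (\<lambda>(b, j). b ^ j) ` ({..s} \<times> {..l})" using \<open>p \<le> s\<close> pj by force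
  qed
  then have "card ?P \<le> card ((\<lambda>(b, j). b ^ j) ` ({..s} \<times> {..l}))" by (intro card_mono) auto
  also have "\<dots> \<le> card ({..s} \<times> {..l})" by (rule card_image_le) auto
  finally have card: "card ?P \<le> (s + 1) * (l + 1)" by simp
  have lg: "log 2 (real M) \<ge> 0" "ln (real M) \<ge> 0" using assms by auto
  have sl: "real (s + 1) \<le> sqrt (real M) + 1" "real (l + 1) \<le> log 2 (real M) + 1"
    using lg by (auto simp: s_def l_def)
  have "(\<Sum>k\<in>{k\<in>{1..M}. \<not> prime k}. mangoldt1 g k) = (\<Sum>k\<in>?P. mangoldt1 g k)"
    by (intro sum.mono_neutral_right) (auto simp: mangoldt1_def mangoldt_def)
  also have "\<dots> \<le> (\<Sum>k\<in>?P. ln (real M))"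
  proof (rule sum_mono)
    fix k assume k: "k \<in> ?P"
    have "mangoldt1 g k \<le> mangoldt k" by (simp add: mangoldt1_def mangoldt_nonneg)
    also have "\<dots> \<le> ln (real k)" using k by (intro mangoldt_le) auto
    also have "\<dots> \<le> ln (real M)" using k by simp
    finally show "mangoldt1 g k \<le> ln (real M)" .
  qed
  also have "\<dots> = real (card ?P) * ln (real M)" by simp
  also have "\<dots> \<le> real ((s + 1) * (l + 1)) * ln (real M)"
    using card lg by (intro mult_right_mono) (simp_all only: of_nat_le_iff)
  also have "\<dots> \<le> (sqrt (real M) + 1) * (log 2 (real M) + 1) * ln (real M)"
    unfolding of_nat_mult using sl lg by (intro mult_right_mono mult_mono) auto
  finally show ?thesis .
qed

text \<open>Between \<open>\<alpha> M\<close> and \<open>M\<close> the function \<open>psi1\<close>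
  grows by about \<open>c (1 - \<alpha>) M\<close>, whereas nonprimes account only for
  \<open>o(M)\<close>; a prime must therefore lie in between.\<close>

theorem primes_one_mod_dense:
  assumes g: "g > 0" and \<alpha>: "0 < \<alpha>" "\<alpha> < 1"
  shows "\<forall>\<^sub>F M in sequentially. \<exists>p. prime p \<and> [p = 1] (mod g) \<and> \<alpha> * real M < real p \<and> p \<le> M"
proof -
  define c where "c = 1 / real (card (dchars g))"
  have c: "c > 0" unfolding c_def
    using finite_dchars[OF g] principal_dchars[of g] by (auto simp: card_gt_0_iff)
  define L where "L M = nat \<lfloor>\<alpha> * real M\<rfloor>" for M
  have pnt: "(\<lambda>n. psi1 g n / real n) \<longlonglongrightarrow> c" unfolding c_def by (rule prime_number_theorem_one_mod[OF g])
  have L1: "filterlim L at_top sequentially"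
    unfolding L_def using \<alpha> by real_asymp
  have L2: "(\<lambda>M. real (L M) / real M) \<longlonglongrightarrow> \<alpha>"
    unfolding L_def using \<alpha> by real_asymp
  have "(\<lambda>M. psi1 g M / real M - (psi1 g (L M) / real (L M)) * (real (L M) / real M)) \<longlonglongrightarrow> c - c * \<alpha>"
    by (intro tendsto_intros pnt L2 filterlim_compose[OF pnt L1])
  moreover have "(\<lambda>M. (sqrt (real M) + 1) * (log 2 (real M) + 1) * ln (real M) / real M) \<longlonglongrightarrow> 0"
    by real_asymp
  ultimately have "(\<lambda>M. psi1 g M / real M - (psi1 g (L M) / real (L M)) * (real (L M) / real M)
      - (sqrt (real M) + 1) * (log 2 (real M) + 1) * ln (real M) / real M) \<longlonglongrightarrow> (c - c * \<alpha>) - 0"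
    by (rule tendsto_diff)
  moreover have "(c - c * \<alpha>) - 0 > 0" using c \<alpha> by simp
  ultimately have "\<forall>\<^sub>F M in sequentially. 0 < psi1 g M / real M - (psi1 g (L M) / real (L M)) * (real (L M) / real M)
      - (sqrt (real M) + 1) * (log 2 (real M) + 1) * ln (real M) / real M"
    by (rule order_tendstoD(1))
  then show ?thesis using eventually_gt_at_top[of 0]
  proof eventually_elim
    case (elim M)
    have LM: "L M \<le> M" unfolding L_def using \<alpha>
      by (metis floor_mono floor_of_nat mult_left_le_one_le nat_mono nat_int of_nat_0_le_iff less_imp_le)
    \<comment> \<open>Covers the division by zero: for \<open>L M = 0\<close> the quotient is 0, and
      so is \<open>psi1 g 0\<close>.\<close>
    have "psi1 g (L M) = 0" if "L M = 0" using that by (simp add: psi1_def)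
    then have "(psi1 g (L M) / real (L M)) * (real (L M) / real M) = psi1 g (L M) / real M" by simp
    with elim have "0 < (psi1 g M - psi1 g (L M) - (sqrt (real M) + 1) * (log 2 (real M) + 1) * ln (real M)) / real M"
      by (simp add: diff_divide_distrib)
    then have big: "(sqrt (real M) + 1) * (log 2 (real M) + 1) * ln (real M) < psi1 g M - psi1 g (L M)"
      using elim by (simp add: zero_less_divide_iff)
    have "{1..M} = {1..L M} \<union> {Suc (L M)..M}" using LM by auto
    then have df: "psi1 g M - psi1 g (L M) = (\<Sum>k=Suc (L M)..M. mangoldt1 g k)"
      unfolding psi1_def by (simp add: sum.union_disjoint)
    have "\<exists>p\<in>{Suc (L M)..M}. prime p \<and> [p = 1] (mod g)"
    proof (rule ccontr)
      assume none: "\<not> ?thesis"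
      have "(\<Sum>k=Suc (L M)..M. mangoldt1 g k) = (\<Sum>k\<in>{k\<in>{Suc (L M)..M}. \<not> prime k}. mangoldt1 g k)"
        using none by (intro sum.mono_neutral_right) (auto simp: mangoldt1_def)
      also have "\<dots> \<le> (\<Sum>k\<in>{k\<in>{1..M}. \<not> prime k}. mangoldt1 g k)"
        by (intro sum_mono2) (auto simp: mangoldt1_nonneg)
      also have "\<dots> \<le> (sqrt (real M) + 1) * (log 2 (real M) + 1) * ln (real M)"
        by (rule prime_power_sum_le) (use elim in simp)
      finally show False using big df by simp
    qed
    then obtain p where p: "p \<in> {Suc (L M)..M}" "prime p" "[p = 1] (mod g)" by blast
    then have "\<alpha> * real M < real p" unfolding L_def by (simp add: Suc_le_eq) linarith
    then show ?case using p by auto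
  qed
qed

section \<open>Asymptotics of alpha\<close>

theorem theorem3:
  fixes g :: nat
  assumes "g > 0"
  shows "(\<lambda>n. real (alpha g n) / sqrt (real g * real n)) \<longlonglongrightarrow> 1"
proof (rule order_tendstoI)
  fix a :: real assume "a < 1"
  define \<beta> where "\<beta> = (max a 0 + 1) / 2"
  have \<beta>: "0 < \<beta>" "\<beta> < 1" "a < \<beta>" using \<open>a < 1\<close> by (auto simp: \<beta>_def)
  \<comment> \<open>A prime up to this bound satisfies \<open>p^2 \<le> g * n\<close>, which implies
    the size condition of \<open>alpha_ge_prime\<close>; primes above \<open>\<beta> * s n\<close>
    lose only the factor \<beta>, chosen between \<open>a\<close> and 1.\<close>
  define s where "s n = nat \<lfloor>sqrt (real g * real n)\<rfloor>" for n
  have "filterlim s at_top sequentially" unfolding s_def using assms by real_asymp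
  from eventually_compose_filterlim[OF primes_one_mod_dense[OF assms \<beta>(1,2)] this]
  have ev: "\<forall>\<^sub>F n in sequentially. \<exists>p. prime p \<and> [p = 1] (mod g) \<and> \<beta> * real (s n) < real p \<and> p \<le> s n" .
  have "(\<lambda>n. (\<beta> * real (s n) - 1) / sqrt (real g * real n)) \<longlonglongrightarrow> \<beta>"
    unfolding s_def using assms \<beta> by real_asymp
  then have "\<forall>\<^sub>F n in sequentially. a < (\<beta> * real (s n) - 1) / sqrt (real g * real n)"
    using \<beta>(3) by (rule order_tendstoD(1))
  then show "\<forall>\<^sub>F n in sequentially. a < real (alpha g n) / sqrt (real g * real n)"
    using ev
  proof eventually_elim
    case (elim n)
    then obtain p where p: "prime p" "[p = 1] (mod g)" "\<beta> * real (s n) < real p" "p \<le> s n" by blast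
    have "real (s n) \<le> sqrt (real g * real n)" unfolding s_def by simp
    then have "real p \<le> sqrt (real g * real n)" using p(4) by linarith
    then have "real p ^ 2 \<le> sqrt (real g * real n) ^ 2" by (intro power_mono) auto
    then have "real (p ^ 2) \<le> real (g * n)" by simp
    then have "p ^ 2 \<le> g * n" by (simp only: of_nat_le_iff)
    moreover have "p * (p - 1) \<le> p ^ 2" unfolding power2_eq_square by (rule mult_le_mono2) simp
    ultimately have "p * (p - 1) \<le> g * n" by (rule order_trans[rotated])
    from alpha_ge_prime[OF p(1,2) assms this]
    have "real p - 1 \<le> real (alpha g n)" by linarith
    then have "(\<beta> * real (s n) - 1) / sqrt (real g * real n) \<le> real (alpha g n) / sqrt (real g * real n)"
      using p(3) by (intro divide_right_mono) auto
    then show ?case using elim(1) by linarith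
  qed
next
  fix a :: real assume "1 < a"
  obtain R where R: "R \<longlonglongrightarrow> 1"
      "\<forall>\<^sub>F n in sequentially. real (alpha g n) / sqrt (real g * real n) \<le> R n"
    using alpha_upper_ratio[OF assms] by blast
  from order_tendstoD(2)[OF R(1) \<open>1 < a\<close>] R(2)
  show "\<forall>\<^sub>F n in sequentially. real (alpha g n) / sqrt (real g * real n) < a"
    by eventually_elim linarith
qed

end
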